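(* Consider the continuous-time symmetric polling model with independent compound Poisson arrivals described in the context, with $\mathcal L$ ergodic. Assume that $\tilde\mu_k\neq1$ for every $1\le k<N$ and that $$[I-P][I-{}^*\widetilde P]=[I-{}^*P][I-\widetilde P],$$ where ${}^*M$ denotes the transpose of $M$. Then the mean stationary waiting time of a customer is $$\begin{aligned}\mathbb E[W]={}&\frac{\tilde\tau}{1-N\lambda\tau}\sum_{l=1}^{N-1}\frac1{1-\tilde\mu_l}+\frac{N\lambda\tau^{(2)}}{2(1-N\lambda\tau)}+\frac{\tilde\tau^{(2)}}{2\tilde\tau}\\&+\frac{b^{(2)}-b}{2b}\left[\frac{\tau+(N-1)\tilde\tau}{1-N\lambda\tau}-\frac{\tilde\tau}{1-N\lambda\tau}\sum_{l=1}^{N-1}\frac{\mu_l-\tilde\mu_l}{1-\tilde\mu_l}\right].\end{aligned}$$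
   Context: Polling model. There are $N$ stations $\mathcal S=\{1,\ldots,N\}$ and one server; station indices are taken modulo $N$. At each station customers arrive in i.i.d. batches (of size at least one) with mean size $b$ and second moment $b^{(2)}$, at the instants of a Poisson process of intensity $\hat\lambda$; the arrival processes at different stations are independent. Put $\lambda=\hat\lambda b$. Customers at each station are served in order of arrival, at most one per visit of the server (1-limited service). When the server polls station $i$ and finds it nonempty, it takes the head-of-line customer (who leaves the queue) and polls next the station $i+d$ with probability $p_d$. When it finds station $i$ empty, it polls next the station $i+d$ with probability $\tilde p_d$. Here $(p_1,\ldots,p_N)$ and $(\tilde p_1,\ldots,\tilde p_N)$ are probability vectors. The corresponding routing matrices are $P=(p_{j-i})_{i,j}$ and $\widetilde P=(\tilde p_{j-i})_{i,j}$. The time between the polling of $i$ and the next polling, at $i+d$, has a law depending only on $d$ and on whether station $i$ was found nonempty or empty, and is independent of the past and of the arrival processes after the polling instant. The (unconditional on $d$) time between two polling instants when the first polled queue is nonempty (resp. empty) has mean $\tau$ and second moment $\tau^{(2)}$ (resp. $\tilde\tau$ and $\tilde\tau^{(2)}$). With $S(n)$ the position of the server and $X(n)\in\mathbb Z_+^N$ the queue lengths at the $n$-th polling instant, $\mathcal L=(S(n),X(n))_n$ is a Markov chain, assumed irreducible and ergodic; all random variables of interest (including stationary queue lengths) are assumed to have finite second moments. $W$ is the stationary waiting time of an arbitrary customer: the time from its arrival until the polling instant at which the server takes it. Notation: $\omega_k=\exp(2\pi\mathrm i k/N)$ with $\mathrm i^2=-1$, $\mu_k=\sum_{d=1}^Np_d\,\omega_k^d$,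 $\tilde\mu_k=\sum_{d=1}^N\tilde p_d\,\omega_k^d$ (eigenvalues of $P$ and $\widetilde P$). *)

theory Defs
  imports "HOL-Probability.Probability" "Jordan_Normal_Form.Matrix"
begin

text \<open>
  Stations are numbered \<open>0, \<dots>, N - 1\<close> (station \<open>N\<close> of the usual numbering is station \<open>0\<close>).

  All the randomness after time \<open>0\<close> comes from a family of independent inputs with values in
  \<open>nat \<times> real\<close>:
  \<^item> \<open>Arrival i k\<close>: size of the \<open>k\<close>-th batch arriving at station \<open>i\<close>, and time elapsed between the
    previous batch of that station (or time \<open>0\<close> if \<open>k = 0\<close>) and this one;
  \<^item> \<open>After_Service n\<close>, \<open>After_Empty n\<close>: jump \<open>d\<close> of the server and time until the next polling
    instant, used at the \<open>n\<close>-th polling instant if the polled station is nonempty, resp. empty.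
\<close>

datatype input = Arrival nat nat | After_Service nat | After_Empty nat

type_synonym scenario = "input \<Rightarrow> nat \<times> real"

text \<open>Position of the server and list of the \<open>N\<close> queue lengths.\<close>

type_synonym state = "nat \<times> nat list"

definition states :: "nat \<Rightarrow> state set" where
  "states N = {(s, x). s < N \<and> length x = N}"

text \<open>The jump \<open>d\<close> has law \<open>p\<close>; given \<open>d\<close>, the time until the next polling has law \<open>H d\<close>.\<close>

definition step_law :: "nat pmf \<Rightarrow> (nat \<Rightarrow> real measure) \<Rightarrow> (nat \<times> real) measure" where
  "step_law p H =
     measure_pmf p \<bind> (\<lambda>d. distr (H d) (count_space UNIV \<Otimes>\<^sub>M borel) (\<lambda>t. (d, t)))"

fun input_law :: "real \<Rightarrow> nat pmf \<Rightarrow> nat pmf \<Rightarrow> (nat \<Rightarrow> real measure) \<Rightarrow>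
    nat pmf \<Rightarrow> (nat \<Rightarrow> real measure) \<Rightarrow> input \<Rightarrow> (nat \<times> real) measure" where
  "input_law rate batch p H p' H' (Arrival i k) =
     measure_pmf batch \<Otimes>\<^sub>M density lborel (\<lambda>t. ennreal (exponential_density rate t))"
| "input_law rate batch p H p' H' (After_Service n) = step_law p H"
| "input_law rate batch p H p' H' (After_Empty n) = step_law p' H'"

definition scenarios :: "real \<Rightarrow> nat pmf \<Rightarrow> nat pmf \<Rightarrow> (nat \<Rightarrow> real measure) \<Rightarrow>
    nat pmf \<Rightarrow> (nat \<Rightarrow> real measure) \<Rightarrow> scenario measure" where
  "scenarios rate batch p H p' H' = PiM UNIV (input_law rate batch p H p' H')"

definition batch_size :: "scenario \<Rightarrow> nat \<Rightarrow> nat \<Rightarrow> nat" where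
  "batch_size \<omega> i k = fst (\<omega> (Arrival i k))"

definition batch_time :: "scenario \<Rightarrow> nat \<Rightarrow> nat \<Rightarrow> real" where
  "batch_time \<omega> i k = (\<Sum>j\<le>k. snd (\<omega> (Arrival i j)))"

definition arrivals :: "scenario \<Rightarrow> nat \<Rightarrow> real \<Rightarrow> real \<Rightarrow> nat" where
  "arrivals \<omega> i t u = (\<Sum>k | t < batch_time \<omega> i k \<and> batch_time \<omega> i k \<le> u. batch_size \<omega> i k)"

text \<open>
  \<open>polling N \<omega> z n\<close>: epoch of the \<open>n\<close>-th polling instant and state at that instant, when a polling
  takes place at time \<open>0\<close> in state \<open>z\<close>. Subtraction on \<^typ>\<open>nat\<close> is truncated, so nothing is
  removed from an empty queue.
\<close>

primrec polling :: "nat \<Rightarrow> scenario \<Rightarrow> state \<Rightarrow> nat \<Rightarrow> real \<times> state" where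
  "polling N \<omega> z 0 = (0, z)"
| "polling N \<omega> z (Suc n) =
     (let (t, s, x) = polling N \<omega> z n;
          (d, u) = \<omega> (if x ! s > 0 then After_Service n else After_Empty n)
      in (t + u, (s + d) mod N,
          map (\<lambda>i. x ! i - (if i = s then 1 else 0) + arrivals \<omega> i t (t + u)) [0..<N]))"

definition poll_time :: "nat \<Rightarrow> scenario \<Rightarrow> state \<Rightarrow> nat \<Rightarrow> real" where
  "poll_time N \<omega> z n = fst (polling N \<omega> z n)"

definition chain :: "nat \<Rightarrow> scenario \<Rightarrow> state \<Rightarrow> nat \<Rightarrow> state" where
  "chain N \<omega> z n = snd (polling N \<omega> z n)"

definition service_at :: "nat \<Rightarrow> scenario \<Rightarrow> state \<Rightarrow> nat \<Rightarrow> nat \<Rightarrow> bool" where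
  "service_at N \<omega> z i n \<longleftrightarrow> (case chain N \<omega> z n of (s, x) \<Rightarrow> s = i \<and> x ! s > 0)"

definition trans_prob :: "scenario measure \<Rightarrow> nat \<Rightarrow> nat \<Rightarrow> state \<Rightarrow> state \<Rightarrow> real" where
  "trans_prob \<Omega> N n y z = measure \<Omega> {\<omega> \<in> space \<Omega>. chain N \<omega> y n = z}"

definition irreducible_chain :: "scenario measure \<Rightarrow> nat \<Rightarrow> bool" where
  "irreducible_chain \<Omega> N \<longleftrightarrow>
     (\<forall>y \<in> states N. \<forall>z \<in> states N. \<exists>n. trans_prob \<Omega> N n y z > 0)"

text \<open>Finite mean return times; the return time is \<open>\<infinity>\<close> if the chain never returns.\<close>

definition positive_recurrent_chain :: "scenario measure \<Rightarrow> nat \<Rightarrow> bool" where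
  "positive_recurrent_chain \<Omega> N \<longleftrightarrow>
     (\<forall>z \<in> states N. (\<integral>\<^sup>+\<omega>. (INF n \<in> {n. n > 0 \<and> chain N \<omega> z n = z}. of_nat n) \<partial>\<Omega>) < \<infinity>)"

text \<open>
  Aperiodicity is not required: the position of the server may be periodic (e.g. cyclic polling).
\<close>

definition ergodic_chain :: "scenario measure \<Rightarrow> nat \<Rightarrow> bool" where
  "ergodic_chain \<Omega> N \<longleftrightarrow> irreducible_chain \<Omega> N \<and> positive_recurrent_chain \<Omega> N"

definition stationary :: "scenario measure \<Rightarrow> nat \<Rightarrow> state pmf \<Rightarrow> bool" where
  "stationary \<Omega> N \<pi> \<longleftrightarrow>
     set_pmf \<pi> \<subseteq> states N \<and>
     (\<forall>z \<in> states N. pmf \<pi> z = measure_pmf.expectation \<pi> (\<lambda>y. trans_prob \<Omega> N 1 y z))"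

text \<open>
  Customer \<open>(i, k, r)\<close> is the \<open>r\<close>-th customer (\<open>r < batch_size \<omega> i k\<close>) of the \<open>k\<close>-th batch arriving at
  station \<open>i\<close>. It is taken at the service of station \<open>i\<close> that is preceded by exactly as many services
  of this station as there are customers in front of it: those present at time \<open>0\<close>, those of earlier
  batches, and the \<open>r\<close> first ones of its own batch. The waiting time of a customer who is never served
  is \<open>\<infinity>\<close>.
\<close>

type_synonym customer = "nat \<times> nat \<times> nat"

fun waiting_time :: "nat \<Rightarrow> (state \<times> scenario) \<times> customer \<Rightarrow> ennreal" where
  "waiting_time N ((z, \<omega>), (i, k, r)) =
     (INF n \<in> {n. service_at N \<omega> z i n \<and>
                  card {m. m < n \<and> service_at N \<omega> z i m} =
                    snd z ! i + (\<Sum>j<k. batch_size \<omega> i j) + r}.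
        ennreal (poll_time N \<omega> z n - batch_time \<omega> i k))"

text \<open>
  The arbitrary customer of the stationary regime (Palm measure of the customer arrivals): the
  system is started at a polling instant from the stationary law \<open>\<pi>\<close>, and every customer who
  arrives between this polling instant and the next one receives the same weight. The normalising
  constant is the mean number of these customers, so that the law of the waiting time under this
  measure charges \<open>A\<close> with the mean number of those whose waiting time is in \<open>A\<close>, divided by the
  mean number of all of them.
\<close>

definition tagged_customer ::
    "scenario measure \<Rightarrow> nat \<Rightarrow> state pmf \<Rightarrow> ((state \<times> scenario) \<times> customer) measure" where
  "tagged_customer \<Omega> N \<pi> =
     uniform_measure ((measure_pmf \<pi> \<Otimes>\<^sub>M \<Omega>) \<Otimes>\<^sub>M count_space UNIV)
       {((z, \<omega>), (i, k, r)). i < N \<and> r < batch_size \<omega> i k \<and>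
          0 < batch_time \<omega> i k \<and> batch_time \<omega> i k \<le> poll_time N \<omega> z 1}"

definition mean_waiting_time :: "scenario measure \<Rightarrow> nat \<Rightarrow> state pmf \<Rightarrow> ennreal" where
  "mean_waiting_time \<Omega> N \<pi> = (\<integral>\<^sup>+c. waiting_time N c \<partial>tagged_customer \<Omega> N \<pi>)"

definition interval_moment :: "nat \<Rightarrow> nat pmf \<Rightarrow> (nat \<Rightarrow> real measure) \<Rightarrow> nat \<Rightarrow> real" where
  "interval_moment N p H m = (\<Sum>d=1..N. pmf p d * (\<integral>t. t ^ m \<partial>H d))"

text \<open>Entry \<open>(i, j)\<close> is \<open>p\<^sub>d\<close> for the \<open>d \<in> {1..N}\<close> such that \<open>d \<equiv> j - i (mod N)\<close>.\<close>

definition routing_mat :: "nat \<Rightarrow> nat pmf \<Rightarrow> real mat" where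
  "routing_mat N p = Matrix.mat N N (\<lambda>(i, j). pmf p (if i < j then j - i else N + j - i))"

definition routing_eigenvalue :: "nat \<Rightarrow> nat pmf \<Rightarrow> nat \<Rightarrow> complex" where
  "routing_eigenvalue N p k =
     (\<Sum>d=1..N. of_real (pmf p d) * exp (2 * of_real pi * \<i> * of_nat k / of_nat N) ^ d)"

end

theory Submission imports Defs
begin

text \<open>
  The stationary system is described as seen from the server. Let \<open>Y\<^sub>j\<close> be the length of the queue
  \<open>j\<close> stations ahead of it (\<open>ahead\<close>), whose mean is split according to whether the polled station is
  nonempty, \<open>f\<^sub>j = E[Y\<^sub>j; nonempty]\<close> (\<open>ahead_busy\<close>), or empty, \<open>e\<^sub>j = E[Y\<^sub>j; empty]\<close> (\<open>ahead_idle\<close>).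
  Two families of balance equations hold.
  Stationarity of \<open>E Y\<^sub>j\<close> says that \<open>f + e\<close> is a convolution of \<open>f\<close> with \<open>p\<close> plus one of \<open>e\<close> with \<open>p'\<close>,
  plus explicit terms (\<open>first_moments\<close>). Stationarity of the cyclic correlation
  \<open>E (\<Sum>i. X\<^sub>i X\<^sub>i\<^sub>+\<^sub>k)\<close> leaves \<open>f\<^sub>k + f\<^sub>-\<^sub>k = S [k = 0] + C\<close> (\<open>second_moments\<close>): the correlations themselves
  cancel, because they do not depend on the position of the server.

  The discrete Fourier transform diagonalises the convolutions: for \<open>l \<noteq> 0\<close> the transform of \<open>e\<close> is an
  explicit term minus \<open>R\<^sub>l\<close> times the transform of \<open>f\<close>, where \<open>R\<^sub>l = (1 - \<mu>\<^sub>l) / (1 - \<mu>'\<^sub>l)\<close>, while the second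
  family gives only the real part of the transform of \<open>f\<close>. The hypothesis on the routing
  matrices says exactly that \<open>R\<^sub>l\<close> is real, so the unknown imaginary parts disappear when real parts are
  taken. Since \<open>e\<^sub>0 = 0\<close> (an empty polled station has no customers), inversion at \<open>0\<close> yields \<open>\<Sum>j. e\<^sub>j\<close>
  (\<open>spectral_solution\<close>).

  The waiting time enters through a form of Little's law (\<open>little\<close>, \<open>mean_waiting_time_eq\<close>): the mean
  total wait of the customers arriving during a step equals their mean wait inside that step plus the
  mean of the number of customers left behind after a poll times the length of the step. This is a
  conservation law for the remaining waiting times of all present customers. These could
  have infinite mean, so it is proved for waiting times truncated after \<open>n\<close> polls, the error being
  controlled by the probability of not having met the empty state, which tends to \<open>0\<close> by
  stationarity and irreducibility (\<open>avoid_limit\<close>). The customers left behind are expressed by \<open>\<Sum>j. f\<^sub>j\<close> and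
  \<open>\<Sum>j. e\<^sub>j\<close>, and \<open>second_moments\<close> summed over \<open>k\<close> expresses \<open>\<Sum>j. f\<^sub>j\<close> by the mean waiting time; the
  formula is the solution of the resulting linear equation.

  All of this uses that the scenario restarts afresh at the first polling instant, which follows
  from the lack of memory of the exponential gaps (\<open>memoryless\<close>, \<open>markov\<close>). The drift computations also
  show that the system is not overloaded: \<open>load_less_1\<close> comes from \<open>\<rho> < 1\<close> and \<open>empty_interval_pos\<close>.
\<close>

section \<open>Marked arrival sequences and their residuals\<close>

definition epoch :: "(nat \<Rightarrow> nat \<times> real) \<Rightarrow> nat \<Rightarrow> real" where
  "epoch a k = (\<Sum>j\<le>k. snd (a j))"

text \<open>
  A relation rather than a function of \<open>u\<close>, because the disjoint events \<open>first_after a u k\<close> are the cases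
  in the proof of the lack of memory.
\<close>

definition first_after :: "(nat \<Rightarrow> nat \<times> real) \<Rightarrow> real \<Rightarrow> nat \<Rightarrow> bool" where
  "first_after a u k \<longleftrightarrow> u < epoch a k \<and> (\<forall>j<k. epoch a j \<le> u)"

text \<open>
  The arrivals seen after time \<open>u\<close>, if \<open>k\<close> is the index of the first of them: only the first gap is
  shortened.
\<close>

definition residual_at :: "(nat \<Rightarrow> nat \<times> real) \<Rightarrow> real \<Rightarrow> nat \<Rightarrow> nat \<Rightarrow> nat \<times> real" where
  "residual_at a u k = (\<lambda>j. if j = 0 then (fst (a k), epoch a k - u) else a (k + j))"

definition count :: "(nat \<Rightarrow> nat \<times> real) \<Rightarrow> real \<Rightarrow> nat" where
  "count a u = (LEAST k. u < epoch a k)"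

definition residual :: "(nat \<Rightarrow> nat \<times> real) \<Rightarrow> real \<Rightarrow> nat \<Rightarrow> nat \<times> real" where
  "residual a u = residual_at a u (count a u)"

definition total :: "(nat \<Rightarrow> nat \<times> real) \<Rightarrow> real \<Rightarrow> nat" where
  "total a u = (\<Sum>j<count a u. fst (a j))"

lemma epoch_case_nat:
  "epoch (case_nat q a) 0 = snd q" "epoch (case_nat q a) (Suc k) = snd q + epoch a k"
  by (simp_all add: epoch_def sum.atMost_Suc_shift del: sum.atMost_Suc)

lemma first_after_case_nat:
  "first_after (case_nat q a) u 0 \<longleftrightarrow> u < snd q"
  "first_after (case_nat q a) u (Suc k) \<longleftrightarrow> snd q \<le> u \<and> first_after a (u - snd q) k"
  by (auto simp: first_after_def epoch_case_nat less_Suc_eq_0_disj All_less_Suc2)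

lemma residual_at_case_nat:
  "residual_at (case_nat q a) u 0 = case_nat (fst q, snd q - u) a"
  "residual_at (case_nat q a) u (Suc k) = residual_at a (u - snd q) k"
  by (auto simp: residual_at_def epoch_case_nat fun_eq_iff split: nat.split)

lemma first_after_unique: "first_after a u k \<Longrightarrow> count a u = k"
  unfolding count_def first_after_def
  by (rule Least_equality) (auto simp: not_less[symmetric])

lemma first_after_count: "\<exists>k. u < epoch a k \<Longrightarrow> first_after a u (count a u)"
  unfolding count_def first_after_def
  by (meson LeastI_ex leI not_less_Least)

abbreviation input_space :: "(nat \<times> real) measure" where
  "input_space \<equiv> count_space UNIV \<Otimes>\<^sub>M borel"

lemma measurable_epoch[measurable]:
  "(\<lambda>a. epoch a k) \<in> borel_measurable (\<Pi>\<^sub>M _\<in>UNIV. input_space)"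
  unfolding epoch_def by measurable

lemma measurable_first_after[measurable]:
  "Measurable.pred ((\<Pi>\<^sub>M _\<in>UNIV. input_space) \<Otimes>\<^sub>M borel) (\<lambda>(a, u). first_after a u k)"
  unfolding first_after_def by measurable

lemma measurable_residual_at[measurable]:
  "(\<lambda>(a, u). residual_at a u k) \<in> (\<Pi>\<^sub>M _\<in>UNIV. input_space) \<Otimes>\<^sub>M borel \<rightarrow>\<^sub>M (\<Pi>\<^sub>M _\<in>UNIV. input_space)"
proof (rule measurable_PiM_single')
  fix j :: nat
  show "(\<lambda>x. (case x of (a, u) \<Rightarrow> residual_at a u k) j) \<in> (\<Pi>\<^sub>M _\<in>UNIV. input_space) \<Otimes>\<^sub>M borel \<rightarrow>\<^sub>M input_space"
    by (cases j) (auto simp: residual_at_def split_beta')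
qed (auto simp: space_PiM space_pair_measure)

lemma measurable_count[measurable]:
  "(\<lambda>(a, u). count a u) \<in> (\<Pi>\<^sub>M _\<in>UNIV. input_space) \<Otimes>\<^sub>M borel \<rightarrow>\<^sub>M count_space UNIV"
  unfolding count_def by measurable

lemma measurable_total[measurable]:
  "(\<lambda>(a, u). total a u) \<in> (\<Pi>\<^sub>M _\<in>UNIV. input_space) \<Otimes>\<^sub>M borel \<rightarrow>\<^sub>M count_space UNIV"
proof -
  have "(\<lambda>x. (\<lambda>k (a, u). \<Sum>j<k. fst (a j)) ((\<lambda>(a, u). count a u) x) x)
     \<in> (\<Pi>\<^sub>M _\<in>UNIV. input_space) \<Otimes>\<^sub>M (borel :: real measure) \<rightarrow>\<^sub>M count_space UNIV"
    by (rule measurable_compose_countable) measurable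
  then show ?thesis by (simp add: total_def split_beta')
qed

lemma measurable_residual[measurable]:
  "(\<lambda>(a, u). residual a u) \<in> (\<Pi>\<^sub>M _\<in>UNIV. input_space) \<Otimes>\<^sub>M borel \<rightarrow>\<^sub>M (\<Pi>\<^sub>M _\<in>UNIV. input_space)"
proof -
  have "(\<lambda>x. (\<lambda>k (a, u). residual_at a u k) ((\<lambda>(a, u). count a u) x) x)
     \<in> (\<Pi>\<^sub>M _\<in>UNIV. input_space) \<Otimes>\<^sub>M (borel :: real measure) \<rightarrow>\<^sub>M (\<Pi>\<^sub>M _\<in>UNIV. input_space)"
    by (rule measurable_compose_countable) measurable
  then show ?thesis by (simp add: residual_def split_beta')
qed

lemma (in sequence_space) nn_integral_iter:
  assumes [measurable]: "f \<in> borel_measurable S"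
  shows "(\<integral>\<^sup>+a. f a \<partial>S) = (\<integral>\<^sup>+q. \<integral>\<^sup>+a. f (case_nat q a) \<partial>S \<partial>M)"
proof -
  have "(\<integral>\<^sup>+a. f a \<partial>S) = (\<integral>\<^sup>+x. f (case x of (s, \<omega>) \<Rightarrow> case_nat s \<omega>) \<partial>(M \<Otimes>\<^sub>M S))"
    by (subst PiM_iter[symmetric]) (subst nn_integral_distr, measurable)
  also have "\<dots> = (\<integral>\<^sup>+q. \<integral>\<^sup>+a. f (case_nat q a) \<partial>S \<partial>M)"
    by (subst P.nn_integral_fst[symmetric]) auto
  finally show ?thesis .
qed

section \<open>Compound Poisson arrivals and the lack of memory\<close>

locale compound_poisson =
  fixes rate :: real and batch :: "nat pmf"
  assumes rate_pos: "0 < rate"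
begin

definition gap_law :: "real measure" where
  "gap_law = density lborel (\<lambda>t. ennreal (exponential_density rate t))"

definition arrival_law :: "(nat \<times> real) measure" where
  "arrival_law = measure_pmf batch \<Otimes>\<^sub>M gap_law"

abbreviation station_law :: "(nat \<Rightarrow> nat \<times> real) measure" where
  "station_law \<equiv> \<Pi>\<^sub>M _\<in>(UNIV :: nat set). arrival_law"

lemma sets_gap_law[measurable_cong]: "sets gap_law = sets borel"
  by (simp add: gap_law_def)

lemma prob_space_gap_law: "prob_space gap_law"
  unfolding gap_law_def by (rule prob_space_exponential_density[OF rate_pos])

sublocale gap: prob_space gap_law
  by (rule prob_space_gap_law)

lemma sets_arrival_law[measurable_cong]: "sets arrival_law = sets input_space"
  unfolding arrival_law_def by (intro sets_pair_measure_cong) (simp_all add: sets_gap_law)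

lemma prob_space_arrival_law: "prob_space arrival_law"
proof -
  interpret pair_prob_space "measure_pmf batch" gap_law ..
  show ?thesis unfolding arrival_law_def by unfold_locales
qed

sublocale arr: prob_space arrival_law
  by (rule prob_space_arrival_law)

sublocale seq: sequence_space arrival_law ..

lemma sets_station_law[measurable_cong]: "sets station_law = sets (\<Pi>\<^sub>M _\<in>UNIV. input_space)"
  by (intro sets_PiM_cong refl sets_arrival_law)

lemma space_laws[simp]: "space gap_law = UNIV" "space arrival_law = UNIV" "space station_law = UNIV"
  using sets_eq_imp_space_eq[OF sets_gap_law] sets_eq_imp_space_eq[OF sets_arrival_law]
    sets_eq_imp_space_eq[OF sets_station_law]
  by (auto simp: space_pair_measure space_PiM)

lemma nn_integral_arrival_law:
  assumes [measurable]: "f \<in> borel_measurable input_space"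
  shows "(\<integral>\<^sup>+q. f q \<partial>arrival_law) = (\<integral>\<^sup>+m. \<integral>\<^sup>+x. f (m, x) \<partial>gap_law \<partial>measure_pmf batch)"
  unfolding arrival_law_def
  by (subst gap.nn_integral_fst[symmetric]) measurable

lemma nn_integral_gap_law:
  assumes [measurable]: "f \<in> borel_measurable borel"
  shows "(\<integral>\<^sup>+x. f x \<partial>gap_law) = (\<integral>\<^sup>+x. ennreal (exponential_density rate x) * f x \<partial>lborel)"
  unfolding gap_law_def by (subst nn_integral_density) auto

lemma gap_memoryless:
  assumes u: "0 \<le> u" and [measurable]: "g \<in> borel_measurable borel"
  shows "(\<integral>\<^sup>+x. indicator {u<..} x * g (x - u) \<partial>gap_law) = ennreal (exp (- rate * u)) * (\<integral>\<^sup>+x. g x \<partial>gap_law)"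
proof -
  have "(\<integral>\<^sup>+x. indicator {u<..} x * g (x - u) \<partial>gap_law)
      = (\<integral>\<^sup>+x. ennreal (exponential_density rate x) * (indicator {u<..} x * g (x - u)) \<partial>lborel)"
    by (rule nn_integral_gap_law) measurable
  also have "\<dots> = (\<integral>\<^sup>+x. ennreal (exponential_density rate (u + 1 * x)) * (indicator {u<..} (u + 1 * x) * g ((u + 1 * x) - u)) \<partial>lborel)"
    by (subst nn_integral_real_affine[where c=1 and t=u]) auto
  also have "\<dots> = (\<integral>\<^sup>+x. ennreal (exp (- rate * u)) * (ennreal (exponential_density rate x) * g x) \<partial>lborel)"
  proof (rule nn_integral_cong_AE)
    have *: "ennreal (exponential_density rate (u + 1 * x)) * (indicator {u<..} (u + 1 * x) * g ((u + 1 * x) - u))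
       = ennreal (exp (- rate * u)) * (ennreal (exponential_density rate x) * g x)" if "x \<noteq> 0" for x
    proof (cases "0 < x")
      case True
      then have "exponential_density rate (u + x) = exp (- rate * u) * exponential_density rate x"
        using u by (simp add: exponential_density_def algebra_simps exp_diff exp_minus divide_inverse)
      then show ?thesis
        using True by (simp add: ennreal_mult' mult.assoc)
    next
      case False
      then have "x < 0" using that by simp
      then show ?thesis
        by (simp add: exponential_density_def)
    qed
    have "AE x in lborel. x \<noteq> (0::real)" by (rule AE_lborel_singleton)
    then show "AE x in lborel. ennreal (exponential_density rate (u + 1 * x)) * (indicator {u<..} (u + 1 * x) * g ((u + 1 * x) - u))
       = ennreal (exp (- rate * u)) * (ennreal (exponential_density rate x) * g x)"
      by eventually_elim (rule *)
  qed
  also have "\<dots> = ennreal (exp (- rate * u)) * (\<integral>\<^sup>+x. ennreal (exponential_density rate x) * g x \<partial>lborel)"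
    by (rule nn_integral_cmult) auto
  also have "(\<integral>\<^sup>+x. ennreal (exponential_density rate x) * g x \<partial>lborel) = (\<integral>\<^sup>+x. g x \<partial>gap_law)"
    by (rule nn_integral_gap_law[symmetric]) simp
  finally show ?thesis .
qed

lemma measurable_case_nat_const[measurable]: "case_nat q \<in> station_law \<rightarrow>\<^sub>M station_law"
proof (rule measurable_PiM_single')
  fix j :: nat
  show "(\<lambda>a. case_nat q a j) \<in> station_law \<rightarrow>\<^sub>M arrival_law"
    by (cases j) auto
qed auto

lemma measurable_case_nat_pair[measurable]:
  "(\<lambda>(q, a). case_nat q a) \<in> arrival_law \<Otimes>\<^sub>M station_law \<rightarrow>\<^sub>M station_law"
proof (rule measurable_PiM_single')
  fix j :: nat
  show "(\<lambda>x. (case x of (q, a) \<Rightarrow> case_nat q a) j) \<in> arrival_law \<Otimes>\<^sub>M station_law \<rightarrow>\<^sub>M arrival_law"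
    by (cases j) (auto simp: split_beta')
qed auto

lemma measurable_first_after'[measurable]:
  "Measurable.pred station_law (\<lambda>a. first_after a u k)"
  unfolding first_after_def by measurable

lemma measurable_residual_at'[measurable]:
  "(\<lambda>a. residual_at a u k) \<in> station_law \<rightarrow>\<^sub>M station_law"
  by measurable

text \<open>
  Conditioning on the first arrival reduces the claim for \<open>k + 1\<close> earlier arrivals to the claim for \<open>k\<close>
  at the earlier time \<open>u - snd q\<close>; for \<open>k = 0\<close> the first gap exceeds \<open>u\<close> and it is the lack of memory of
  the exponential law. The induction passes through \<open>F\<close>, which therefore also sees the number of
  customers in the earlier batches.
\<close>

lemma memoryless_at:
  assumes u: "0 \<le> u" and F: "\<And>c. F c \<in> borel_measurable station_law"
  shows "(\<integral>\<^sup>+a. indicator {a. first_after a u k} a * F (\<Sum>j<k. fst (a j)) (residual_at a u k) \<partial>station_law)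
    = (\<integral>\<^sup>+a. indicator {a. first_after a u k} a * (\<integral>\<^sup>+a'. F (\<Sum>j<k. fst (a j)) a' \<partial>station_law) \<partial>station_law)"
  using u F
proof (induction k arbitrary: u F)
  case 0
  note [measurable] = 0(2)
  have [measurable]: "(\<lambda>q. \<integral>\<^sup>+a. F 0 (case_nat q a) \<partial>station_law) \<in> borel_measurable arrival_law"
    by measurable
  have G[measurable]: "(\<lambda>q. \<integral>\<^sup>+a. F 0 (case_nat q a) \<partial>station_law) \<in> borel_measurable input_space"
    by measurable
  have H[measurable]: "(\<lambda>x. \<integral>\<^sup>+a. F 0 (case_nat (m, x) a) \<partial>station_law) \<in> borel_measurable borel" for m
    by (rule measurable_compose[OF _ G]) simp
  have M1: "(\<lambda>a. indicator {a. first_after a u 0} a * F 0 (residual_at a u 0)) \<in> borel_measurable station_law"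
    by measurable
  have "(\<integral>\<^sup>+a. indicator {a. first_after a u 0} a * F 0 (residual_at a u 0) \<partial>station_law)
    = (\<integral>\<^sup>+q. \<integral>\<^sup>+a. indicator {u<..} (snd q) * F 0 (case_nat (fst q, snd q - u) a) \<partial>station_law \<partial>arrival_law)"
    unfolding seq.nn_integral_iter[OF M1]
    by (simp add: indicator_def first_after_case_nat residual_at_case_nat)
  also have "\<dots> = (\<integral>\<^sup>+q. indicator {u<..} (snd q) * (\<integral>\<^sup>+a. F 0 (case_nat (fst q, snd q - u) a) \<partial>station_law) \<partial>arrival_law)"
    by (intro nn_integral_cong nn_integral_cmult measurable_compose[OF measurable_case_nat_const 0(2)])
  also have "\<dots> = (\<integral>\<^sup>+m. \<integral>\<^sup>+x. indicator {u<..} x * (\<integral>\<^sup>+a. F 0 (case_nat (m, x - u) a) \<partial>station_law) \<partial>gap_law \<partial>measure_pmf batch)"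
    by (subst nn_integral_arrival_law) auto
  also have "\<dots> = (\<integral>\<^sup>+m. ennreal (exp (- rate * u)) * (\<integral>\<^sup>+x. \<integral>\<^sup>+a. F 0 (case_nat (m, x) a) \<partial>station_law \<partial>gap_law) \<partial>measure_pmf batch)"
    by (intro nn_integral_cong gap_memoryless H 0)
  also have "\<dots> = ennreal (exp (- rate * u)) * (\<integral>\<^sup>+q. \<integral>\<^sup>+a. F 0 (case_nat q a) \<partial>station_law \<partial>arrival_law)"
    by (subst nn_integral_cmult) (auto simp: nn_integral_arrival_law)
  also have "\<dots> = ennreal (exp (- rate * u)) * (\<integral>\<^sup>+a. F 0 a \<partial>station_law)"
    using seq.nn_integral_iter[OF 0(2)[of 0]] by simp
  finally have A: "(\<integral>\<^sup>+a. indicator {a. first_after a u 0} a * F 0 (residual_at a u 0) \<partial>station_law)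
    = ennreal (exp (- rate * u)) * (\<integral>\<^sup>+a. F 0 a \<partial>station_law)" .
  have M2: "(\<lambda>a. indicator {a. first_after a u 0} a :: ennreal) \<in> borel_measurable station_law"
    by measurable
  have "(\<integral>\<^sup>+a. indicator {a. first_after a u 0} a \<partial>station_law)
    = (\<integral>\<^sup>+q. \<integral>\<^sup>+a. indicator {u<..} (snd q) \<partial>station_law \<partial>arrival_law)"
    unfolding seq.nn_integral_iter[OF M2]
    by (simp add: indicator_def first_after_case_nat)
  also have "\<dots> = (\<integral>\<^sup>+q. indicator {u<..} (snd q) * 1 \<partial>arrival_law)"
    using seq.P.emeasure_space_1 by simp
  also have "\<dots> = (\<integral>\<^sup>+m. \<integral>\<^sup>+x. indicator {u<..} x * 1 \<partial>gap_law \<partial>measure_pmf batch)"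
    by (subst nn_integral_arrival_law) auto
  also have "\<dots> = ennreal (exp (- rate * u))"
    by (subst gap_memoryless) (use 0(1) gap.emeasure_space_1 in auto)
  finally have B: "(\<integral>\<^sup>+a. indicator {a. first_after a u 0} a \<partial>station_law) = ennreal (exp (- rate * u))" .
  show ?case
    by (simp only: A lessThan_0 sum.empty nn_integral_multc[OF M2] B)
next
  case (Suc k)
  note [measurable] = Suc(3)
  let ?L = "\<lambda>a. indicator {a. first_after a u (Suc k)} a * F (\<Sum>j<Suc k. fst (a j)) (residual_at a u (Suc k))"
  let ?R = "\<lambda>a. indicator {a. first_after a u (Suc k)} a * (\<integral>\<^sup>+a'. F (\<Sum>j<Suc k. fst (a j)) a' \<partial>station_law)"
  have mL: "?L \<in> borel_measurable station_law"
    by measurable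
  have mR: "?R \<in> borel_measurable station_law"
    by measurable
  have MI: "(\<lambda>a. indicator {a. first_after a w k} a * F (c + (\<Sum>j<k. fst (a j))) (residual_at a w k)) \<in> borel_measurable station_law" for w c
    by measurable
  have MJ: "(\<lambda>a. indicator {a. first_after a w k} a * (\<integral>\<^sup>+a'. F (c + (\<Sum>j<k. fst (a j))) a' \<partial>station_law)) \<in> borel_measurable station_law" for w c
    by measurable
  have "(\<integral>\<^sup>+a. ?L a \<partial>station_law)
    = (\<integral>\<^sup>+q. \<integral>\<^sup>+a. indicator {..u} (snd q) * (indicator {a. first_after a (u - snd q) k} a *
         F (fst q + (\<Sum>j<k. fst (a j))) (residual_at a (u - snd q) k)) \<partial>station_law \<partial>arrival_law)"
    unfolding seq.nn_integral_iter[OF mL]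
    by (intro nn_integral_cong)
       (simp add: indicator_def first_after_case_nat residual_at_case_nat sum.lessThan_Suc_shift del: sum.lessThan_Suc)
  also have "\<dots> = (\<integral>\<^sup>+q. indicator {..u} (snd q) * (\<integral>\<^sup>+a. indicator {a. first_after a (u - snd q) k} a *
         F (fst q + (\<Sum>j<k. fst (a j))) (residual_at a (u - snd q) k) \<partial>station_law) \<partial>arrival_law)"
    by (intro nn_integral_cong nn_integral_cmult MI)
  also have "\<dots> = (\<integral>\<^sup>+q. indicator {..u} (snd q) * (\<integral>\<^sup>+a. indicator {a. first_after a (u - snd q) k} a *
         (\<integral>\<^sup>+a'. F (fst q + (\<Sum>j<k. fst (a j))) a' \<partial>station_law) \<partial>station_law) \<partial>arrival_law)"
  proof (intro nn_integral_cong)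
    fix q
    show "indicator {..u} (snd q) * (\<integral>\<^sup>+a. indicator {a. first_after a (u - snd q) k} a *
         F (fst q + (\<Sum>j<k. fst (a j))) (residual_at a (u - snd q) k) \<partial>station_law)
      = indicator {..u} (snd q) * (\<integral>\<^sup>+a. indicator {a. first_after a (u - snd q) k} a *
         (\<integral>\<^sup>+a'. F (fst q + (\<Sum>j<k. fst (a j))) a' \<partial>station_law) \<partial>station_law)"
    proof (cases "snd q \<le> u")
      case True
      then have "0 \<le> u - snd q" by simp
      from Suc.IH[OF this Suc.prems(2), of "\<lambda>c. fst q + c"] show ?thesis
        by simp
    qed simp
  qed
  also have "\<dots> = (\<integral>\<^sup>+q. \<integral>\<^sup>+a. indicator {..u} (snd q) * (indicator {a. first_after a (u - snd q) k} a *
         (\<integral>\<^sup>+a'. F (fst q + (\<Sum>j<k. fst (a j))) a' \<partial>station_law)) \<partial>station_law \<partial>arrival_law)"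
    by (intro nn_integral_cong nn_integral_cmult[symmetric] MJ)
  also have "\<dots> = (\<integral>\<^sup>+a. ?R a \<partial>station_law)"
    unfolding seq.nn_integral_iter[OF mR]
    by (intro nn_integral_cong)
       (auto simp add: indicator_def first_after_case_nat residual_at_case_nat sum.lessThan_Suc_shift simp del: sum.lessThan_Suc)
  finally show ?case .
qed

end

section \<open>Moments of compound Poisson arrivals\<close>

text \<open>
  The expectation of \<open>f (m\<^sub>0 + \<dots> + m\<^sub>k\<^sub>-\<^sub>1) m\<^sub>k\<close> for independent sizes with law \<open>B\<close>, as an iterated integral
  with one integration for each batch, which fits inductions on the number of arrivals.
\<close>

primrec size_integral :: "nat pmf \<Rightarrow> nat \<Rightarrow> (nat \<Rightarrow> nat \<Rightarrow> ennreal) \<Rightarrow> ennreal" where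
  "size_integral B 0 f = (\<integral>\<^sup>+m. f 0 m \<partial>measure_pmf B)"
| "size_integral B (Suc k) f = (\<integral>\<^sup>+m. size_integral B k (\<lambda>c. f (m + c)) \<partial>measure_pmf B)"

text \<open>
  The almost sure event on which batches have distinct epochs, finitely many of them in bounded time;
  on it the path identities hold without exception.
\<close>

definition regular :: "(nat \<Rightarrow> nat \<times> real) \<Rightarrow> bool" where
  "regular a \<longleftrightarrow> (\<forall>k. 0 < snd (a k)) \<and> (\<forall>u. \<exists>k. u < epoch a k)"

lemma epoch_mono: "(\<And>k. 0 < snd (a k)) \<Longrightarrow> j \<le> k \<Longrightarrow> epoch a j \<le> epoch a k"
  unfolding epoch_def by (rule sum_mono2) (auto simp: less_imp_le)

lemma epoch_le_iff_less_count:
  assumes "regular a" shows "epoch a k \<le> u \<longleftrightarrow> k < count a u"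
proof -
  have f: "first_after a u (count a u)"
    using assms by (intro first_after_count) (auto simp: regular_def)
  show ?thesis
  proof
    assume "k < count a u" with f show "epoch a k \<le> u" by (auto simp: first_after_def)
  next
    assume "epoch a k \<le> u"
    then have "\<not> epoch a (count a u) \<le> epoch a k" using f by (auto simp: first_after_def)
    then show "k < count a u"
      using epoch_mono[of a "count a u" k] assms unfolding regular_def by (meson not_le_imp_less)
  qed
qed

lemma epoch_pos: "regular a \<Longrightarrow> 0 < epoch a k"
  unfolding epoch_def regular_def by (intro sum_pos) auto

lemma suminf_epoch_le:
  fixes g :: "nat \<Rightarrow> ennreal"
  assumes "regular a"
  shows "(\<Sum>k. g k * indicator {..u} (epoch a k)) = (\<Sum>k<count a u. g k)"
proof -
  have "(\<Sum>k. g k * indicator {..u} (epoch a k)) = (\<Sum>k<count a u. g k * indicator {..u} (epoch a k))"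
    by (rule suminf_finite) (use epoch_le_iff_less_count[OF assms] in auto)
  also have "\<dots> = (\<Sum>k<count a u. g k)"
    by (rule sum.cong) (use epoch_le_iff_less_count[OF assms] in auto)
  finally show ?thesis .
qed

lemma square_sum_lessThan:
  fixes m :: "nat \<Rightarrow> nat"
  shows "(\<Sum>j<k. 2 * (\<Sum>i<j. m i) * m j + (m j)\<^sup>2) = (\<Sum>j<k. m j)\<^sup>2"
  by (induction k) (auto simp: power2_eq_square algebra_simps)

context compound_poisson
begin

definition mean_size :: ennreal where "mean_size = (\<integral>\<^sup>+m. of_nat m \<partial>measure_pmf batch)"
definition mean_size2 :: ennreal where "mean_size2 = (\<integral>\<^sup>+m. of_nat (m\<^sup>2) \<partial>measure_pmf batch)"

lemma nn_integral_epoch: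
  assumes [measurable]: "\<phi> \<in> borel_measurable borel"
  shows "(\<integral>\<^sup>+a. \<phi> (epoch a k) \<partial>station_law) = (\<integral>\<^sup>+x. ennreal (erlang_density k rate x) * \<phi> x \<partial>lborel)"
  using assms
proof (induction k arbitrary: \<phi>)
  case 0
  note [measurable] = 0
  have M: "(\<lambda>a. \<phi> (epoch a 0)) \<in> borel_measurable station_law" by measurable
  show ?case
    unfolding seq.nn_integral_iter[OF M] epoch_case_nat
    by (simp add: nn_integral_arrival_law nn_integral_gap_law seq.P.emeasure_space_1[simplified])
next
  case (Suc k)
  note [measurable] = Suc(2)
  have M: "(\<lambda>a. \<phi> (epoch a (Suc k))) \<in> borel_measurable station_law" by measurable
  have "(\<integral>\<^sup>+a. \<phi> (epoch a (Suc k)) \<partial>station_law) = (\<integral>\<^sup>+q. \<integral>\<^sup>+a. \<phi> (snd q + epoch a k) \<partial>station_law \<partial>arrival_law)"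
    unfolding seq.nn_integral_iter[OF M] epoch_case_nat ..
  also have "\<dots> = (\<integral>\<^sup>+q. \<integral>\<^sup>+y. ennreal (erlang_density k rate y) * \<phi> (snd q + y) \<partial>lborel \<partial>arrival_law)"
    by (intro nn_integral_cong Suc.IH) measurable
  also have "\<dots> = (\<integral>\<^sup>+x. \<integral>\<^sup>+y. ennreal (erlang_density k rate y) * \<phi> (x + y) \<partial>lborel \<partial>gap_law)"
    by (subst nn_integral_arrival_law) auto
  also have "\<dots> = (\<integral>\<^sup>+x. ennreal (exponential_density rate x) * (\<integral>\<^sup>+y. ennreal (erlang_density k rate y) * \<phi> (x + y) \<partial>lborel) \<partial>lborel)"
    by (subst nn_integral_gap_law) auto
  also have "\<dots> = (\<integral>\<^sup>+x. ennreal (exponential_density rate x) * (\<integral>\<^sup>+z. ennreal (erlang_density k rate (z - x)) * \<phi> z \<partial>lborel) \<partial>lborel)"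
  proof (rule nn_integral_cong, rule arg_cong2[where f="(*)", OF refl])
    fix x :: real
    show "(\<integral>\<^sup>+y. ennreal (erlang_density k rate y) * \<phi> (x + y) \<partial>lborel) = (\<integral>\<^sup>+z. ennreal (erlang_density k rate (z - x)) * \<phi> z \<partial>lborel)"
      by (subst (2) nn_integral_real_affine[where c=1 and t=x]) (auto simp: add.commute)
  qed
  also have "\<dots> = (\<integral>\<^sup>+x. \<integral>\<^sup>+z. ennreal (exponential_density rate x) * (ennreal (erlang_density k rate (z - x)) * \<phi> z) \<partial>lborel \<partial>lborel)"
    by (subst nn_integral_cmult) auto
  also have "\<dots> = (\<integral>\<^sup>+z. \<integral>\<^sup>+x. ennreal (exponential_density rate x) * (ennreal (erlang_density k rate (z - x)) * \<phi> z) \<partial>lborel \<partial>lborel)"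
    by (rule lborel_pair.Fubini') measurable
  also have "\<dots> = (\<integral>\<^sup>+z. (\<integral>\<^sup>+x. ennreal (erlang_density k rate (z - x)) * ennreal (exponential_density rate x) \<partial>lborel) * \<phi> z \<partial>lborel)"
    by (subst nn_integral_multc[symmetric]) (auto simp: ac_simps)
  also have "\<dots> = (\<integral>\<^sup>+z. ennreal (erlang_density (Suc k) rate z) * \<phi> z \<partial>lborel)"
    using fun_cong[OF convolution_erlang_density[OF rate_pos, of k 0]] by simp
  finally show ?case .
qed

text \<open>
  Batch sizes and epochs are independent; the induction removes the first arrival, which shifts the
  argument of \<open>\<phi>\<close> and adds its size to the first argument of \<open>f\<close>.
\<close>

lemma nn_integral_sizes_epoch:
  assumes [measurable]: "\<phi> \<in> borel_measurable borel"
  shows "(\<integral>\<^sup>+a. f (\<Sum>j<k. fst (a j)) (fst (a k)) * \<phi> (epoch a k) \<partial>station_law)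
    = size_integral batch k f * (\<integral>\<^sup>+a. \<phi> (epoch a k) \<partial>station_law)"
  using assms
proof (induction k arbitrary: f \<phi>)
  case 0
  note [measurable] = 0
  have M1: "(\<lambda>a. f (\<Sum>j<0. fst (a j)) (fst (a 0)) * \<phi> (epoch a 0)) \<in> borel_measurable station_law"
    by measurable
  have M2: "(\<lambda>a. \<phi> (epoch a 0)) \<in> borel_measurable station_law"
    by measurable
  show ?case
    unfolding seq.nn_integral_iter[OF M1] seq.nn_integral_iter[OF M2] epoch_case_nat
    by (simp add: nn_integral_arrival_law nn_integral_cmult nn_integral_multc seq.P.emeasure_space_1[simplified])
next
  case (Suc k)
  note [measurable] = Suc(2)
  have M1: "(\<lambda>a. f (\<Sum>j<Suc k. fst (a j)) (fst (a (Suc k))) * \<phi> (epoch a (Suc k))) \<in> borel_measurable station_law"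
    by measurable
  have M2: "(\<lambda>a. \<phi> (epoch a (Suc k))) \<in> borel_measurable station_law"
    by measurable
  have "(\<integral>\<^sup>+a. f (\<Sum>j<Suc k. fst (a j)) (fst (a (Suc k))) * \<phi> (epoch a (Suc k)) \<partial>station_law)
    = (\<integral>\<^sup>+q. \<integral>\<^sup>+a. f (fst q + (\<Sum>j<k. fst (a j))) (fst (a k)) * \<phi> (snd q + epoch a k) \<partial>station_law \<partial>arrival_law)"
    unfolding seq.nn_integral_iter[OF M1] epoch_case_nat
    by (simp add: sum.lessThan_Suc_shift del: sum.lessThan_Suc)
  also have "\<dots> = (\<integral>\<^sup>+q. size_integral batch k (\<lambda>c. f (fst q + c)) * (\<integral>\<^sup>+a. \<phi> (snd q + epoch a k) \<partial>station_law) \<partial>arrival_law)"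
    by (intro nn_integral_cong Suc.IH) measurable
  also have "\<dots> = (\<integral>\<^sup>+m. \<integral>\<^sup>+x. size_integral batch k (\<lambda>c. f (m + c)) * (\<integral>\<^sup>+a. \<phi> (x + epoch a k) \<partial>station_law) \<partial>gap_law \<partial>measure_pmf batch)"
    by (subst nn_integral_arrival_law) auto
  also have "\<dots> = size_integral batch (Suc k) f * (\<integral>\<^sup>+x. \<integral>\<^sup>+a. \<phi> (x + epoch a k) \<partial>station_law \<partial>gap_law)"
    by (simp add: nn_integral_cmult nn_integral_multc)
  also have "(\<integral>\<^sup>+x. \<integral>\<^sup>+a. \<phi> (x + epoch a k) \<partial>station_law \<partial>gap_law) = (\<integral>\<^sup>+a. \<phi> (epoch a (Suc k)) \<partial>station_law)"
    unfolding seq.nn_integral_iter[OF M2] epoch_case_nat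
    by (simp add: nn_integral_arrival_law)
  finally show ?case .
qed

lemma size_integral_size: "size_integral batch k (\<lambda>c m. of_nat m) = mean_size"
  by (induction k) (simp_all add: mean_size_def)

text \<open>
  The increment of the square of a partial sum, with an offset \<open>c\<^sub>0\<close> that makes the induction work.
\<close>

lemma size_integral_square:
  "size_integral batch k (\<lambda>c m. of_nat (2 * (c\<^sub>0 + c) * m + m\<^sup>2)) = 2 * (of_nat c\<^sub>0 + of_nat k * mean_size) * mean_size + mean_size2"
proof (induction k arbitrary: c\<^sub>0)
  case 0
  have "(\<integral>\<^sup>+ m. of_nat (2 * (c\<^sub>0 + 0) * m + m\<^sup>2) \<partial>measure_pmf batch)
     = (\<integral>\<^sup>+ m. 2 * of_nat c\<^sub>0 * of_nat m + of_nat (m\<^sup>2) \<partial>measure_pmf batch)"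
    by (intro nn_integral_cong) simp
  also have "\<dots> = 2 * of_nat c\<^sub>0 * mean_size + mean_size2"
    by (subst nn_integral_add) (auto simp: nn_integral_cmult mean_size_def mean_size2_def)
  finally show ?case by simp
next
  case (Suc k)
  have "size_integral batch (Suc k) (\<lambda>c m. of_nat (2 * (c\<^sub>0 + c) * m + m\<^sup>2))
    = (\<integral>\<^sup>+m. 2 * (of_nat (c\<^sub>0 + m) + of_nat k * mean_size) * mean_size + mean_size2 \<partial>measure_pmf batch)"
    using Suc.IH[of "c\<^sub>0 + _"] by (simp add: add.assoc)
  also have "\<dots> = (\<integral>\<^sup>+m. 2 * (of_nat c\<^sub>0 + of_nat k * mean_size) * mean_size + mean_size2 + 2 * mean_size * of_nat m \<partial>measure_pmf batch)"
    by (intro nn_integral_cong) (simp add: algebra_simps)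
  also have "\<dots> = 2 * (of_nat c\<^sub>0 + of_nat k * mean_size) * mean_size + mean_size2 + 2 * mean_size * mean_size"
    by (subst nn_integral_add) (auto simp: nn_integral_cmult mean_size_def[symmetric])
  also have "\<dots> = 2 * (of_nat c\<^sub>0 + of_nat (Suc k) * mean_size) * mean_size + mean_size2"
    by (simp add: algebra_simps)
  finally show ?case .
qed

lemma exp_series: "(\<lambda>k. (rate * x) ^ k / fact k) sums exp (rate * x)" for x
  using exp_converges[of "rate * x"] by (simp add: divide_inverse ac_simps)

text \<open>
  The epochs of a Poisson process together have constant density \<open>rate\<close>.
\<close>

lemma suminf_erlang:
  assumes "0 \<le> x" shows "(\<Sum>k. ennreal (erlang_density k rate x)) = ennreal rate"
proof -
  have "(\<lambda>k. rate * exp (- rate * x) * ((rate * x) ^ k / fact k)) sums (rate * exp (- rate * x) * exp (rate * x))"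
    by (intro sums_mult exp_series)
  also have "(\<lambda>k. rate * exp (- rate * x) * ((rate * x) ^ k / fact k)) = (\<lambda>k. erlang_density k rate x)"
    using assms by (auto simp: erlang_density_def fun_eq_iff power_mult_distrib)
  also have "rate * exp (- rate * x) * exp (rate * x) = rate"
    by (simp add: exp_minus)
  finally show ?thesis
    using rate_pos by (intro suminf_ennreal_eq) auto
qed

lemma suminf_erlang_weighted:
  assumes "0 \<le> x" shows "(\<Sum>k. of_nat k * ennreal (erlang_density k rate x)) = ennreal (rate\<^sup>2 * x)"
proof -
  have "(\<lambda>k. rate\<^sup>2 * x * exp (- rate * x) * ((rate * x) ^ k / fact k)) sums (rate\<^sup>2 * x * exp (- rate * x) * exp (rate * x))"
    by (intro sums_mult exp_series)
  also have "(\<lambda>k. rate\<^sup>2 * x * exp (- rate * x) * ((rate * x) ^ k / fact k)) = (\<lambda>k. of_nat (Suc k) * erlang_density (Suc k) rate x)"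
    using assms by (auto simp: erlang_density_def fun_eq_iff power_mult_distrib power2_eq_square divide_simps)
  also have "rate\<^sup>2 * x * exp (- rate * x) * exp (rate * x) = rate\<^sup>2 * x"
    by (simp add: exp_minus)
  finally have "(\<lambda>k. of_nat k * erlang_density k rate x) sums (rate\<^sup>2 * x)"
    by (subst (asm) sums_Suc_iff) simp
  then have "(\<Sum>k. ennreal (of_nat k * erlang_density k rate x)) = ennreal (rate\<^sup>2 * x)"
    using rate_pos by (intro suminf_ennreal_eq) auto
  then show ?thesis
    using rate_pos by (simp add: ennreal_mult' ennreal_of_nat_eq_real_of_nat)
qed

lemma nn_integral_suminf_epoch:
  assumes [measurable]: "\<phi> \<in> borel_measurable borel"
  shows "(\<Sum>k. \<integral>\<^sup>+a. \<phi> (epoch a k) \<partial>station_law) = ennreal rate * (\<integral>\<^sup>+x. \<phi> x * indicator {0..} x \<partial>lborel)"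
proof -
  have "(\<Sum>k. \<integral>\<^sup>+a. \<phi> (epoch a k) \<partial>station_law) = (\<integral>\<^sup>+x. (\<Sum>k. ennreal (erlang_density k rate x) * \<phi> x) \<partial>lborel)"
    by (subst nn_integral_suminf) (auto simp: nn_integral_epoch)
  also have "\<dots> = (\<integral>\<^sup>+x. ennreal rate * (\<phi> x * indicator {0..} x) \<partial>lborel)"
  proof (intro nn_integral_cong)
    fix x
    show "(\<Sum>k. ennreal (erlang_density k rate x) * \<phi> x) = ennreal rate * (\<phi> x * indicator {0..} x)"
    proof (cases "0 \<le> x")
      case True then show ?thesis by (simp add: suminf_erlang)
    next
      case False then show ?thesis by (simp add: erlang_density_def)
    qed
  qed
  also have "\<dots> = ennreal rate * (\<integral>\<^sup>+x. \<phi> x * indicator {0..} x \<partial>lborel)"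
    by (rule nn_integral_cmult) measurable
  finally show ?thesis .
qed

lemma nn_integral_suminf_epoch_weighted:
  assumes [measurable]: "\<phi> \<in> borel_measurable borel"
  shows "(\<Sum>k. of_nat k * (\<integral>\<^sup>+a. \<phi> (epoch a k) \<partial>station_law)) = ennreal (rate\<^sup>2) * (\<integral>\<^sup>+x. ennreal x * \<phi> x * indicator {0..} x \<partial>lborel)"
proof -
  have "(\<Sum>k. of_nat k * (\<integral>\<^sup>+a. \<phi> (epoch a k) \<partial>station_law)) = (\<integral>\<^sup>+x. (\<Sum>k. of_nat k * ennreal (erlang_density k rate x) * \<phi> x) \<partial>lborel)"
    by (subst nn_integral_suminf) (auto simp: nn_integral_epoch nn_integral_cmult mult.assoc)
  also have "\<dots> = (\<integral>\<^sup>+x. ennreal (rate\<^sup>2) * (ennreal x * \<phi> x * indicator {0..} x) \<partial>lborel)"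
  proof (intro nn_integral_cong)
    fix x
    show "(\<Sum>k. of_nat k * ennreal (erlang_density k rate x) * \<phi> x) = ennreal (rate\<^sup>2) * (ennreal x * \<phi> x * indicator {0..} x)"
    proof (cases "0 \<le> x")
      case True then show ?thesis
        by (simp add: suminf_erlang_weighted[OF True] ennreal_mult mult.assoc[symmetric])
    next
      case False then show ?thesis by (simp add: erlang_density_def)
    qed
  qed
  also have "\<dots> = ennreal (rate\<^sup>2) * (\<integral>\<^sup>+x. ennreal x * \<phi> x * indicator {0..} x \<partial>lborel)"
    by (rule nn_integral_cmult) measurable
  finally show ?thesis .
qed

lemma nn_integral_indicator_Icc0:
  assumes "0 \<le> u"
  shows "(\<integral>\<^sup>+x. indicator {..u} x * indicator {0..} x \<partial>lborel) = ennreal u"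
proof -
  have "(\<integral>\<^sup>+x. indicator {..u} x * indicator {0..} x \<partial>lborel) = (\<integral>\<^sup>+x. indicator {0..u} x \<partial>lborel)"
    by (intro nn_integral_cong) (auto simp: indicator_def)
  also have "\<dots> = ennreal u" using assms by simp
  finally show ?thesis .
qed

lemma nn_integral_id_Icc0:
  assumes "0 \<le> u"
  shows "(\<integral>\<^sup>+x. ennreal x * indicator {..u} x * indicator {0..} x \<partial>lborel) = ennreal (u\<^sup>2 / 2)"
proof -
  have "(\<integral>\<^sup>+x. ennreal x * indicator {..u} x * indicator {0..} x \<partial>lborel) = (\<integral>\<^sup>+x. ennreal x * indicator {0..u} x \<partial>lborel)"
    by (intro nn_integral_cong) (auto simp: indicator_def)
  also have "\<dots> = ennreal (u\<^sup>2 / 2 - 0\<^sup>2 / 2)"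
    by (rule nn_integral_FTC_Icc) (use assms in \<open>auto intro!: derivative_eq_intros\<close>)
  finally show ?thesis by simp
qed

lemma nn_integral_diff_Icc0:
  assumes "0 \<le> u"
  shows "(\<integral>\<^sup>+x. ennreal (u - x) * indicator {..u} x * indicator {0..} x \<partial>lborel) = ennreal (u\<^sup>2 / 2)"
proof -
  have "(\<integral>\<^sup>+x. ennreal (u - x) * indicator {..u} x * indicator {0..} x \<partial>lborel) = (\<integral>\<^sup>+x. ennreal (u - x) * indicator {0..u} x \<partial>lborel)"
    by (intro nn_integral_cong) (auto simp: indicator_def)
  also have "\<dots> = ennreal ((u * u - u\<^sup>2 / 2) - (u * 0 - 0\<^sup>2 / 2))"
    by (rule nn_integral_FTC_Icc) (use assms in \<open>auto intro!: derivative_eq_intros\<close>)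
  finally show ?thesis by (simp add: power2_eq_square)
qed

lemma AE_gap_pos: "AE a in station_law. 0 < snd (a k)"
proof -
  have "AE x in gap_law. 0 < x"
  proof -
    have "AE x in lborel. x \<noteq> (0::real)" by (rule AE_lborel_singleton)
    then have "AE x in lborel. 0 < ennreal (exponential_density rate x) \<longrightarrow> 0 < x"
      by eventually_elim (auto simp: exponential_density_def)
    then show ?thesis
      unfolding gap_law_def by (simp add: AE_density)
  qed
  interpret pair_sigma_finite "measure_pmf batch" gap_law ..
  have "AE q in measure_pmf batch \<Otimes>\<^sub>M gap_law. 0 < snd q"
    using \<open>AE x in gap_law. 0 < x\<close> by (intro AE_pair_measure) auto
  then have "AE q in arrival_law. 0 < snd q"
    unfolding arrival_law_def .
  then show ?thesis
    by (rule seq.AE_component[rotated]) simp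
qed

text \<open>
  The mean number of epochs in \<open>[0, n]\<close> is finite, so almost surely not all epochs lie there.
\<close>

lemma AE_epoch_unbounded: "AE a in station_law. \<exists>k. real n < epoch a k"
proof -
  have "(\<integral>\<^sup>+a. (\<Sum>k. indicator {..real n} (epoch a k)) \<partial>station_law) = (\<Sum>k. \<integral>\<^sup>+a. indicator {..real n} (epoch a k) \<partial>station_law)"
    by (rule nn_integral_suminf) measurable
  also have "\<dots> = ennreal rate * ennreal (real n)"
    by (subst nn_integral_suminf_epoch) (auto simp: nn_integral_indicator_Icc0)
  finally have "AE a in station_law. (\<Sum>k. indicator {..real n} (epoch a k)) \<noteq> (\<infinity> :: ennreal)"
    by (intro nn_integral_PInf_AE) (auto simp: ennreal_mult_eq_top_iff)
  then show ?thesis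
  proof eventually_elim
    case (elim a)
    show ?case
    proof (rule ccontr)
      assume "\<nexists>k. real n < epoch a k"
      then have "(\<Sum>k. indicator {..real n} (epoch a k)) = (\<Sum>k. 1 :: ennreal)"
        by (intro suminf_cong) (auto simp: not_less indicator_def)
      also have "(\<Sum>k. 1 :: ennreal) = \<infinity>"
      proof (rule ccontr)
        assume "(\<Sum>k. 1 :: ennreal) \<noteq> \<infinity>"
        then obtain n where "(\<Sum>k. 1 :: ennreal) < of_nat n"
          using ennreal_Ex_less_of_nat[of "\<Sum>k. 1 :: ennreal"] by (auto simp: less_top)
        moreover have "of_nat n \<le> (\<Sum>k. 1 :: ennreal)"
          using sum_le_suminf[of "\<lambda>_. 1 :: ennreal" "{..<n}"] by simp
        ultimately show False by simp
      qed
      finally show False using elim by simp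
    qed
  qed
qed

lemma AE_regular: "AE a in station_law. regular a"
proof -
  have "AE a in station_law. (\<forall>k. 0 < snd (a k)) \<and> (\<forall>n::nat. \<exists>k. real n < epoch a k)"
    by (simp add: AE_conj_iff AE_all_countable AE_gap_pos AE_epoch_unbounded)
  then show ?thesis
  proof eventually_elim
    case (elim a)
    have "\<exists>k. u < epoch a k" for u
    proof -
      obtain n :: nat where "u \<le> real n" using real_arch_simple by blast
      then show ?thesis using elim by (meson le_less_trans)
    qed
    with elim show ?case by (simp add: regular_def)
  qed
qed

text \<open>
  In this lemma and the next two, a quantity accumulated up to time \<open>u\<close> is written as a sum over all
  epochs; independence of sizes and epochs and the density of the epochs then give the integral. The
  square is the telescoping sum of \<open>2 c m + m\<^sup>2\<close>, with \<open>c\<close> the customers of the earlier batches.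
\<close>

lemma nn_integral_total:
  assumes u: "0 \<le> u"
  shows "(\<integral>\<^sup>+a. of_nat (total a u) \<partial>station_law) = ennreal (rate * u) * mean_size"
proof -
  have "(\<integral>\<^sup>+a. of_nat (total a u) \<partial>station_law) = (\<integral>\<^sup>+a. (\<Sum>k. of_nat (fst (a k)) * indicator {..u} (epoch a k)) \<partial>station_law)"
    using AE_regular
    by (intro nn_integral_cong_AE) (auto elim!: eventually_mono simp: suminf_epoch_le total_def)
  also have "\<dots> = (\<Sum>k. \<integral>\<^sup>+a. of_nat (fst (a k)) * indicator {..u} (epoch a k) \<partial>station_law)"
    by (rule nn_integral_suminf) measurable
  also have "\<dots> = (\<Sum>k. mean_size * (\<integral>\<^sup>+a. indicator {..u} (epoch a k) \<partial>station_law))"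
    using nn_integral_sizes_epoch[of "indicator {..u}" "\<lambda>c m. of_nat m"]
    by (simp add: size_integral_size)
  also have "\<dots> = mean_size * (ennreal rate * ennreal u)"
    by (simp add: nn_integral_suminf_epoch nn_integral_indicator_Icc0 u)
  finally show ?thesis using rate_pos u by (simp add: ennreal_mult ac_simps)
qed

lemma nn_integral_total_square:
  assumes u: "0 \<le> u"
  shows "(\<integral>\<^sup>+a. of_nat ((total a u)\<^sup>2) \<partial>station_law) = ennreal (rate * u) * mean_size2 + ennreal ((rate * u)\<^sup>2) * mean_size\<^sup>2"
proof -
  let ?f = "\<lambda>c m. of_nat (2 * c * m + m\<^sup>2) :: ennreal"
  have "(\<integral>\<^sup>+a. of_nat ((total a u)\<^sup>2) \<partial>station_law)
    = (\<integral>\<^sup>+a. (\<Sum>k. ?f (\<Sum>j<k. fst (a j)) (fst (a k)) * indicator {..u} (epoch a k)) \<partial>station_law)"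
    using AE_regular
  proof (intro nn_integral_cong_AE, eventually_elim)
    fix a assume a: "regular a"
    show "of_nat ((total a u)\<^sup>2) = (\<Sum>k. ?f (\<Sum>j<k. fst (a j)) (fst (a k)) * indicator {..u} (epoch a k))"
      unfolding suminf_epoch_le[OF a] total_def square_sum_lessThan[symmetric] of_nat_sum ..
  qed
  also have "\<dots> = (\<Sum>k. \<integral>\<^sup>+a. ?f (\<Sum>j<k. fst (a j)) (fst (a k)) * indicator {..u} (epoch a k) \<partial>station_law)"
    by (rule nn_integral_suminf) measurable
  also have "\<dots> = (\<Sum>k. (2 * (of_nat k * mean_size) * mean_size + mean_size2) * (\<integral>\<^sup>+a. indicator {..u} (epoch a k) \<partial>station_law))"
    using size_integral_square[of _ 0]
    by (subst nn_integral_sizes_epoch) simp_all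
  also have "\<dots> = (\<Sum>k. 2 * mean_size\<^sup>2 * (of_nat k * (\<integral>\<^sup>+a. indicator {..u} (epoch a k) \<partial>station_law))
      + mean_size2 * (\<integral>\<^sup>+a. indicator {..u} (epoch a k) \<partial>station_law))"
    by (simp add: algebra_simps power2_eq_square)
  also have "\<dots> = 2 * mean_size\<^sup>2 * (ennreal (rate\<^sup>2) * ennreal (u\<^sup>2 / 2)) + mean_size2 * (ennreal rate * ennreal u)"
    by (subst suminf_add[symmetric])
       (simp_all add: nn_integral_suminf_epoch nn_integral_suminf_epoch_weighted nn_integral_indicator_Icc0 nn_integral_id_Icc0 u)
  also have "2 * mean_size\<^sup>2 * (ennreal (rate\<^sup>2) * ennreal (u\<^sup>2 / 2)) = ennreal ((rate * u)\<^sup>2) * mean_size\<^sup>2"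
  proof -
    have "ennreal ((rate * u)\<^sup>2) = 2 * (ennreal (rate\<^sup>2) * ennreal (u\<^sup>2 / 2))"
      by (simp add: ennreal_mult[symmetric] ennreal_numeral[symmetric] power_mult_distrib del: ennreal_numeral)
    then show ?thesis by (simp add: ac_simps)
  qed
  finally show ?thesis using rate_pos u by (simp add: ennreal_mult ac_simps)
qed

lemma nn_integral_total_delay:
  assumes u: "0 \<le> u"
  shows "(\<integral>\<^sup>+a. (\<Sum>k<count a u. of_nat (fst (a k)) * ennreal (u - epoch a k)) \<partial>station_law) = ennreal (rate * u\<^sup>2 / 2) * mean_size"
proof -
  let ?\<phi> = "\<lambda>x. ennreal (u - x) * indicator {..u} x"
  have "(\<integral>\<^sup>+a. (\<Sum>k<count a u. of_nat (fst (a k)) * ennreal (u - epoch a k)) \<partial>station_law)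
    = (\<integral>\<^sup>+a. (\<Sum>k. of_nat (fst (a k)) * ?\<phi> (epoch a k)) \<partial>station_law)"
    using AE_regular
    by (intro nn_integral_cong_AE) (auto elim!: eventually_mono simp: suminf_epoch_le mult.assoc[symmetric])
  also have "\<dots> = (\<Sum>k. \<integral>\<^sup>+a. of_nat (fst (a k)) * ?\<phi> (epoch a k) \<partial>station_law)"
    by (rule nn_integral_suminf) measurable
  also have "\<dots> = (\<Sum>k. mean_size * (\<integral>\<^sup>+a. ?\<phi> (epoch a k) \<partial>station_law))"
    using nn_integral_sizes_epoch[of ?\<phi> "\<lambda>c m. of_nat m"]
    by (simp add: size_integral_size)
  also have "\<dots> = mean_size * (ennreal rate * ennreal (u\<^sup>2 / 2))"
    unfolding ennreal_suminf_cmult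
    by (subst nn_integral_suminf_epoch) (simp_all add: nn_integral_diff_Icc0 u)
  finally show ?thesis using rate_pos u by (simp add: ennreal_mult[symmetric] ac_simps)
qed

end

section \<open>Independent stations\<close>

lemma suminf_single:
  fixes f :: "nat \<Rightarrow> ennreal"
  assumes "\<And>n. n \<noteq> m \<Longrightarrow> f n = 0"
  shows "(\<Sum>n. f n) = f m"
  by (subst suminf_finite[of "{m}"]) (use assms in auto)

context compound_poisson
begin

lemma measurable_total'[measurable]: "(\<lambda>a. total a u) \<in> station_law \<rightarrow>\<^sub>M count_space UNIV"
  by measurable

lemma measurable_residual'[measurable]: "(\<lambda>a. residual a u) \<in> station_law \<rightarrow>\<^sub>M station_law"
  by measurable

text \<open>
  Summation of \<open>memoryless_at\<close> over the number of batches arriving until \<open>u\<close>.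
\<close>

lemma memoryless:
  assumes u: "0 \<le> u" and F: "\<And>c. F c \<in> borel_measurable station_law"
  shows "(\<integral>\<^sup>+a. F (total a u) (residual a u) \<partial>station_law)
    = (\<integral>\<^sup>+a. \<integral>\<^sup>+a'. F (total a u) a' \<partial>station_law \<partial>station_law)"
proof -
  note [measurable] = F
  have split: "g (total a u) (residual a u) = (\<Sum>k. indicator {a. first_after a u k} a * g (\<Sum>j<k. fst (a j)) (residual_at a u k))"
    if "regular a" for g :: "nat \<Rightarrow> (nat \<Rightarrow> nat \<times> real) \<Rightarrow> ennreal" and a
  proof -
    have "first_after a u (count a u)"
      using that by (intro first_after_count) (auto simp: regular_def)
    then show ?thesis
      by (subst suminf_single[of "count a u"])
         (auto simp: total_def residual_def indicator_def dest: first_after_unique)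
  qed
  have "(\<integral>\<^sup>+a. F (total a u) (residual a u) \<partial>station_law)
    = (\<integral>\<^sup>+a. (\<Sum>k. indicator {a. first_after a u k} a * F (\<Sum>j<k. fst (a j)) (residual_at a u k)) \<partial>station_law)"
    by (rule nn_integral_cong_AE, rule eventually_mono[OF AE_regular], rule split[of _ F])
  also have "\<dots> = (\<Sum>k. \<integral>\<^sup>+a. indicator {a. first_after a u k} a * F (\<Sum>j<k. fst (a j)) (residual_at a u k) \<partial>station_law)"
    by (rule nn_integral_suminf) measurable
  also have "\<dots> = (\<Sum>k. \<integral>\<^sup>+a. indicator {a. first_after a u k} a * (\<integral>\<^sup>+a'. F (\<Sum>j<k. fst (a j)) a' \<partial>station_law) \<partial>station_law)"
    by (intro suminf_cong memoryless_at[OF u F])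
  also have "\<dots> = (\<integral>\<^sup>+a. (\<Sum>k. indicator {a. first_after a u k} a * (\<integral>\<^sup>+a'. F (\<Sum>j<k. fst (a j)) a' \<partial>station_law)) \<partial>station_law)"
    by (rule nn_integral_suminf[symmetric]) measurable
  also have "\<dots> = (\<integral>\<^sup>+a. \<integral>\<^sup>+a'. F (total a u) a' \<partial>station_law \<partial>station_law)"
    by (rule nn_integral_cong_AE, rule eventually_mono[OF AE_regular], rule split[of _ "\<lambda>c _. \<integral>\<^sup>+a'. F c a' \<partial>station_law", symmetric])
  finally show ?thesis .
qed

abbreviation stations_law :: "(nat \<Rightarrow> nat \<Rightarrow> nat \<times> real) measure" where
  "stations_law \<equiv> \<Pi>\<^sub>M _\<in>(UNIV :: nat set). station_law"

sublocale st: sequence_space station_law ..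

lemma space_stations_law[simp]: "space stations_law = UNIV"
  by (simp add: space_PiM)

lemma UNIV_sets[simp]: "UNIV \<in> sets station_law" "UNIV \<in> sets stations_law"
  using sets.top[of station_law] sets.top[of stations_law] by simp_all

lemma measurable_residuals[measurable]:
  "(\<lambda>A i. residual (A i) u) \<in> stations_law \<rightarrow>\<^sub>M stations_law"
  by (rule measurable_PiM_single') auto

text \<open>
  The flag \<open>p\<close> allows the constraint on the number of arrivals to be dropped at stations outside the
  observed ones.
\<close>

lemma total_residual_indep:
  assumes u: "0 \<le> u" and X: "X \<in> sets station_law"
  shows "emeasure station_law {a. (p \<longrightarrow> total a u = c) \<and> residual a u \<in> X}
    = emeasure station_law {a. p \<longrightarrow> total a u = c} * emeasure station_law X"
proof -
  note [measurable] = X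
  have 1: "{a. (p \<longrightarrow> total a u = c) \<and> residual a u \<in> X} \<in> sets station_law"
  proof -
    have "{a\<in>space station_law. (p \<longrightarrow> total a u = c) \<and> residual a u \<in> X} \<in> sets station_law"
      by measurable
    then show ?thesis by simp
  qed
  have 2: "{a. p \<longrightarrow> total a u = c} \<in> sets station_law"
  proof -
    have "{a\<in>space station_law. p \<longrightarrow> total a u = c} \<in> sets station_law"
      by measurable
    then show ?thesis by simp
  qed
  have "emeasure station_law {a. (p \<longrightarrow> total a u = c) \<and> residual a u \<in> X}
    = (\<integral>\<^sup>+a. indicator {n. p \<longrightarrow> n = c} (total a u) * indicator X (residual a u) \<partial>station_law)"
    by (subst nn_integral_indicator[OF 1, symmetric]) (auto intro!: nn_integral_cong simp: indicator_def)
  also have "\<dots> = (\<integral>\<^sup>+a. \<integral>\<^sup>+a'. indicator {n. p \<longrightarrow> n = c} (total a u) * indicator X a' \<partial>station_law \<partial>station_law)"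
    by (rule memoryless[OF u, of "\<lambda>n a. indicator {n. p \<longrightarrow> n = c} n * indicator X a"]) measurable
  also have "\<dots> = (\<integral>\<^sup>+a. indicator {a. p \<longrightarrow> total a u = c} a * emeasure station_law X \<partial>station_law)"
    by (intro nn_integral_cong) (simp add: nn_integral_cmult, simp add: indicator_def)
  also have "\<dots> = emeasure station_law {a. p \<longrightarrow> total a u = c} * emeasure station_law X"
    using 2 by (simp add: nn_integral_multc)
  finally show ?thesis .
qed

text \<open>
  Both sides are finite measures in \<open>G\<close>; they agree on rectangles, where the product over the
  stations splits by \<open>total_residual_indep\<close>.
\<close>

lemma stations_memoryless_event:
  fixes c :: "nat \<Rightarrow> nat" and N :: nat
  assumes u: "0 \<le> u" and [measurable]: "G \<in> borel_measurable stations_law"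
  defines "E \<equiv> {A. \<forall>i<N. total (A i) u = c i}"
  shows "(\<integral>\<^sup>+A. indicator E A * G (\<lambda>i. residual (A i) u) \<partial>stations_law)
    = emeasure stations_law E * (\<integral>\<^sup>+A. G A \<partial>stations_law)"
proof -
  have E[measurable]: "E \<in> sets stations_law"
  proof -
    have "{A \<in> space stations_law. \<forall>i\<in>{..<N}. total (A i) u = c i} \<in> sets stations_law"
      by measurable
    then show ?thesis by (simp add: E_def Ball_def)
  qed
  let ?r = "\<lambda>A i. residual (A i) u"
  let ?\<mu> = "distr (density stations_law (indicator E)) stations_law ?r"
  let ?\<nu> = "density stations_law (\<lambda>_. emeasure stations_law E)"
  have "?\<mu> = ?\<nu>"
  proof (rule measure_eqI_PiM_infinite)
    have "finite_measure (density stations_law (indicator E))"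
      by (rule finite_measureI) (simp add: emeasure_density)
    then show "finite_measure ?\<mu>"
      by (rule finite_measure.finite_measure_distr) measurable
    fix X J assume J: "finite J" "J \<subseteq> (UNIV :: nat set)" and X: "\<And>j. j \<in> J \<Longrightarrow> X j \<in> sets station_law"
    let ?emb = "prod_emb UNIV (\<lambda>_. station_law) J (Pi\<^sub>E J X)"
    have emb: "?emb = {A. \<forall>j\<in>J. A j \<in> X j}"
      by (auto simp: prod_emb_def space_PiM PiE_iff)
    have embs[measurable]: "?emb \<in> sets stations_law"
      using J X by (intro sets_PiM_I) auto
      \<comment> \<open>Sets outside \<open>J\<close> are filled up with the whole space, so that \<open>E\<close> and the rectangle have a common finite index set.\<close>
  define X' where "X' j = (if j \<in> J then X j else UNIV)" for j
    have X': "X' j \<in> sets station_law" for j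
      using X sets.top[of station_law] by (auto simp: X'_def)
    let ?I = "J \<union> {..<N}"
    let ?Y = "\<lambda>i. {a. (i < N \<longrightarrow> total a u = c i) \<and> residual a u \<in> X' i}"
    let ?Z = "\<lambda>i. {a. i < N \<longrightarrow> total a u = c i}"
    have Z: "?Z i \<in> sets station_law" for i
    proof -
      have "{a\<in>space station_law. i < N \<longrightarrow> total a u = c i} \<in> sets station_law"
        by measurable
      then show ?thesis by simp
    qed
    have Y: "?Y i \<in> sets station_law" for i
    proof -
      note [measurable] = X'
      have "{a\<in>space station_law. (i < N \<longrightarrow> total a u = c i) \<and> residual a u \<in> X' i} \<in> sets station_law"
        by measurable
      then show ?thesis by simp
    qed
    have "emeasure ?\<mu> ?emb = emeasure stations_law (E \<inter> ?r -` ?emb)"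
      using measurable_sets[OF measurable_residuals embs]
      by (simp add: emeasure_distr emeasure_density nn_integral_cmult[symmetric] indicator_inter_arith[symmetric] sets.Int)
    also have "E \<inter> ?r -` ?emb = {A\<in>space stations_law. \<forall>i\<in>?I. A i \<in> ?Y i}"
      by (auto simp: E_def emb X'_def)
    also have "emeasure stations_law \<dots> = (\<Prod>i\<in>?I. emeasure station_law (?Y i))"
      using J Y by (intro st.emeasure_PiM_Collect) auto
    also have "\<dots> = (\<Prod>i\<in>?I. emeasure station_law (?Z i)) * (\<Prod>i\<in>?I. emeasure station_law (X' i))"
      by (simp add: total_residual_indep[OF u X'] prod.distrib)
    also have "(\<Prod>i\<in>?I. emeasure station_law (?Z i)) = emeasure stations_law {A\<in>space stations_law. \<forall>i\<in>?I. A i \<in> ?Z i}"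
      using J Z by (intro st.emeasure_PiM_Collect[symmetric]) auto
    also have "{A\<in>space stations_law. \<forall>i\<in>?I. A i \<in> ?Z i} = E"
      by (auto simp: E_def)
    also have "(\<Prod>i\<in>?I. emeasure station_law (X' i)) = emeasure stations_law {A\<in>space stations_law. \<forall>i\<in>?I. A i \<in> X' i}"
      using J X' by (intro st.emeasure_PiM_Collect[symmetric]) auto
    also have "{A\<in>space stations_law. \<forall>i\<in>?I. A i \<in> X' i} = ?emb"
      by (auto simp: emb X'_def)
    also have "emeasure stations_law E * emeasure stations_law ?emb = emeasure ?\<nu> ?emb"
      by (simp add: emeasure_density nn_integral_cmult)
    finally show "emeasure ?\<mu> ?emb = emeasure ?\<nu> ?emb" .
  qed simp_all
  then have "(\<integral>\<^sup>+A. G A \<partial>?\<mu>) = (\<integral>\<^sup>+A. G A \<partial>?\<nu>)"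
    by simp
  then show ?thesis
    by (simp add: nn_integral_distr nn_integral_density nn_integral_cmult)
qed

text \<open>
  Summation of \<open>stations_memoryless_event\<close> over the countably many vectors of numbers of arrivals.
\<close>

lemma stations_memoryless:
  fixes N :: nat and F :: "nat list \<Rightarrow> (nat \<Rightarrow> nat \<Rightarrow> nat \<times> real) \<Rightarrow> ennreal"
  assumes u: "0 \<le> u" and F: "\<And>c. F c \<in> borel_measurable stations_law"
  defines "L \<equiv> \<lambda>A. map (\<lambda>i. total (A i) u) [0..<N]"
  shows "(\<integral>\<^sup>+A. F (L A) (\<lambda>i. residual (A i) u) \<partial>stations_law)
    = (\<integral>\<^sup>+A. \<integral>\<^sup>+A'. F (L A) A' \<partial>stations_law \<partial>stations_law)"
proof -
  note [measurable] = F
  define c :: "nat \<Rightarrow> nat list" where "c n = from_nat n" for n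
  define E where "E n = {A. to_nat (L A) = n}" for n
  have E: "E n = (if length (c n) = N \<and> to_nat (c n) = n then {A. \<forall>i<N. total (A i) u = c n ! i} else {})" for n
  proof -
    have "to_nat (L A) = n \<longleftrightarrow> L A = c n \<and> to_nat (c n) = n" for A
      by (auto simp: c_def)
    then show ?thesis
      by (auto simp: E_def L_def list_eq_iff_nth_eq)
  qed
  have Es[measurable]: "E n \<in> sets stations_law" for n
  proof -
    have "{A \<in> space stations_law. \<forall>i\<in>{..<N}. total (A i) u = c n ! i} \<in> sets stations_law"
      by measurable
    then show ?thesis by (simp add: E Ball_def)
  qed
  have split: "g (L A) = (\<Sum>n. indicator (E n) A * g (c n))" for A and g :: "nat list \<Rightarrow> ennreal"
    by (subst suminf_single[of "to_nat (L A)"]) (auto simp: E_def c_def indicator_def)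
  have ev: "(\<integral>\<^sup>+A. indicator (E n) A * F (c n) (\<lambda>i. residual (A i) u) \<partial>stations_law)
    = emeasure stations_law (E n) * (\<integral>\<^sup>+A. F (c n) A \<partial>stations_law)" for n
    unfolding E by (simp add: stations_memoryless_event[OF u F])
  have "(\<integral>\<^sup>+A. F (L A) (\<lambda>i. residual (A i) u) \<partial>stations_law)
    = (\<integral>\<^sup>+A. (\<Sum>n. indicator (E n) A * F (c n) (\<lambda>i. residual (A i) u)) \<partial>stations_law)"
    by (rule nn_integral_cong, rule split[of "\<lambda>c. F c _"])
  also have "\<dots> = (\<Sum>n. \<integral>\<^sup>+A. indicator (E n) A * F (c n) (\<lambda>i. residual (A i) u) \<partial>stations_law)"
    by (rule nn_integral_suminf) measurable
  also have "\<dots> = (\<Sum>n. \<integral>\<^sup>+A. indicator (E n) A * (\<integral>\<^sup>+A'. F (c n) A' \<partial>stations_law) \<partial>stations_law)"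
    unfolding ev by (simp add: nn_integral_multc)
  also have "\<dots> = (\<integral>\<^sup>+A. (\<Sum>n. indicator (E n) A * (\<integral>\<^sup>+A'. F (c n) A' \<partial>stations_law)) \<partial>stations_law)"
    by (rule nn_integral_suminf[symmetric]) measurable
  also have "\<dots> = (\<integral>\<^sup>+A. \<integral>\<^sup>+A'. F (L A) A' \<partial>stations_law \<partial>stations_law)"
    by (rule nn_integral_cong, rule split[of "\<lambda>c. \<integral>\<^sup>+A'. F c A' \<partial>stations_law", symmetric])
  finally show ?thesis .
qed

end

section \<open>Splitting a scenario into arrivals and steps\<close>

lemma sets_PiM_Collect_finite:
  assumes "finite J" "\<And>j. j \<in> J \<Longrightarrow> X j \<in> sets (M j)"
  shows "{a \<in> space (PiM UNIV M). \<forall>j\<in>J. a j \<in> X j} \<in> sets (PiM UNIV M)"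
proof (intro sets.sets_Collect_finite_All sets_Collect_single')
  fix j assume "j \<in> J"
  then have "{x \<in> space (M j). x \<in> X j} = X j"
    using sets.sets_into_space[OF assms(2)] by blast
  then show "{x \<in> space (M j). x \<in> X j} \<in> sets (M j)"
    using assms(2) \<open>j \<in> J\<close> by simp
qed (use assms in auto)

definition assemble :: "(nat \<Rightarrow> nat \<Rightarrow> nat \<times> real) \<Rightarrow> (nat \<Rightarrow> nat \<times> real) \<Rightarrow> (nat \<Rightarrow> nat \<times> real) \<Rightarrow> scenario" where
  "assemble A S E = case_input (\<lambda>i k. A i k) S E"

lemma assemble_simps[simp]:
  "assemble A S E (Arrival i k) = A i k"
  "assemble A S E (After_Service n) = S n"
  "assemble A S E (After_Empty n) = E n"
  by (simp_all add: assemble_def)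

locale polling_model = compound_poisson +
  fixes N :: nat and p p' :: "nat pmf" and H H' :: "nat \<Rightarrow> real measure"
  assumes N_pos: "1 \<le> N"
    and batch_pos: "0 \<notin> set_pmf batch"
    and batch_sq: "integrable (measure_pmf batch) (\<lambda>n. (real n)\<^sup>2)"
    and p_set: "set_pmf p \<subseteq> {1..N}" and p'_set: "set_pmf p' \<subseteq> {1..N}"
    and H_prob: "\<And>d. prob_space (H d)" and H_sets: "\<And>d. sets (H d) = sets borel"
    and H_nonneg: "\<And>d. AE t in H d. 0 \<le> t"
    and H'_prob: "\<And>d. prob_space (H' d)" and H'_sets: "\<And>d. sets (H' d) = sets borel"
    and H'_nonneg: "\<And>d. AE t in H' d. 0 \<le> t"
    and H_sq: "\<And>d. d \<in> set_pmf p \<Longrightarrow> integrable (H d) (\<lambda>t. t\<^sup>2)"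
    and H'_sq: "\<And>d. d \<in> set_pmf p' \<Longrightarrow> integrable (H' d) (\<lambda>t. t\<^sup>2)"

lemma step_kernel_measurable:
  assumes "\<And>d. prob_space (H d)" "\<And>d. sets (H d) = sets borel"
  shows "(\<lambda>d. distr (H d) input_space (\<lambda>t. (d, t))) \<in> measure_pmf p \<rightarrow>\<^sub>M subprob_algebra input_space"
proof -
  have "distr (H d) input_space (\<lambda>t. (d, t)) \<in> space (subprob_algebra input_space)" for d
  proof -
    interpret prob_space "H d" by fact
    have "(\<lambda>t. (d, t)) \<in> H d \<rightarrow>\<^sub>M input_space"
      using assms(2)[of d] by (simp cong: measurable_cong_sets)
    then show ?thesis
      by (auto simp: space_subprob_algebra intro!: prob_space_imp_subprob_space prob_space_distr)
  qed
  then show ?thesis by simp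
qed

lemma sets_step_law: "sets (step_law p H) = sets input_space"
  unfolding step_law_def by (rule sets_bind) auto

lemma prob_space_step_law:
  assumes "\<And>d. prob_space (H d)" "\<And>d. sets (H d) = sets borel"
  shows "prob_space (step_law p H)"
  unfolding step_law_def
proof (rule measure_pmf.prob_space_bind[OF _ step_kernel_measurable[OF assms]])
  show "AE d in measure_pmf p. prob_space (distr (H d) input_space (\<lambda>t. (d, t)))"
  proof (rule AE_I2)
    fix d
    interpret prob_space "H d" by (rule assms)
    have "(\<lambda>t. (d, t)) \<in> H d \<rightarrow>\<^sub>M input_space"
      using assms(2)[of d] by (simp cong: measurable_cong_sets)
    then show "prob_space (distr (H d) input_space (\<lambda>t. (d, t)))"
      by (rule prob_space_distr)
  qed
qed

lemma nn_integral_step_law: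
  assumes H: "\<And>d. prob_space (H d)" "\<And>d. sets (H d) = sets borel"
    and p: "set_pmf p \<subseteq> {1..N}" and f[measurable]: "f \<in> borel_measurable input_space"
  shows "(\<integral>\<^sup>+q. f q \<partial>step_law p H) = (\<Sum>d=1..N. ennreal (pmf p d) * (\<integral>\<^sup>+t. f (d, t) \<partial>H d))"
proof -
  have "(\<integral>\<^sup>+q. f q \<partial>step_law p H) = (\<integral>\<^sup>+d. \<integral>\<^sup>+q. f q \<partial>distr (H d) input_space (\<lambda>t. (d, t)) \<partial>measure_pmf p)"
    unfolding step_law_def by (rule nn_integral_bind[OF f step_kernel_measurable[OF H]])
  also have "\<dots> = (\<integral>\<^sup>+d. \<integral>\<^sup>+t. f (d, t) \<partial>H d \<partial>measure_pmf p)"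
  proof (rule nn_integral_cong)
    fix d
    have "(\<lambda>t. (d, t)) \<in> H d \<rightarrow>\<^sub>M input_space"
      using H(2)[of d] by (simp cong: measurable_cong_sets)
    then show "(\<integral>\<^sup>+q. f q \<partial>distr (H d) input_space (\<lambda>t. (d, t))) = (\<integral>\<^sup>+t. f (d, t) \<partial>H d)"
      by (simp add: nn_integral_distr)
  qed
  also have "\<dots> = (\<Sum>d=1..N. (\<integral>\<^sup>+t. f (d, t) \<partial>H d) * ennreal (pmf p d))"
    using p by (intro nn_integral_measure_pmf_support) (auto simp: pmf_eq_0_set_pmf)
  finally show ?thesis by (simp add: mult.commute)
qed

lemma AE_step_law:
  assumes H: "\<And>d. prob_space (H d)" "\<And>d. sets (H d) = sets borel" and nn: "\<And>d. AE t in H d. 0 \<le> t"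
  shows "AE q in step_law p H. 0 \<le> snd q"
proof -
  have M: "Measurable.pred input_space (\<lambda>q :: nat \<times> real. 0 \<le> snd q)" by measurable
  show ?thesis
    unfolding step_law_def
    apply (subst AE_bind[OF step_kernel_measurable[OF H] M])
    apply (rule AE_I2)
    subgoal for d
    proof -
      have "(\<lambda>t. (d, t)) \<in> H d \<rightarrow>\<^sub>M input_space"
        using H(2)[of d] by (simp cong: measurable_cong_sets)
      then have "(AE q in distr (H d) input_space (\<lambda>t. (d, t)). 0 \<le> snd q) \<longleftrightarrow> (AE t in H d. 0 \<le> snd (d, t))"
        by (rule AE_distr_iff) (rule M[unfolded pred_def])
      with nn[of d] show ?thesis by simp
    qed
    done
qed

context polling_model
begin

abbreviation SL where "SL \<equiv> step_law p H"
abbreviation SL' where "SL' \<equiv> step_law p' H'"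
abbreviation inputs where "inputs \<equiv> input_law rate batch p H p' H'"
abbreviation \<Omega> where "\<Omega> \<equiv> scenarios rate batch p H p' H'"

lemma inputs_Arrival: "inputs (Arrival i k) = arrival_law"
  by (simp add: arrival_law_def gap_law_def)

sublocale SL: prob_space SL
  by (rule prob_space_step_law[OF H_prob H_sets])

sublocale SL': prob_space SL'
  by (rule prob_space_step_law[OF H'_prob H'_sets])

lemmas sets_SL[measurable_cong] = sets_step_law[of p H]
lemmas sets_SL'[measurable_cong] = sets_step_law[of p' H']

lemma space_SL[simp]: "space SL = UNIV" "space SL' = UNIV"
  using sets_eq_imp_space_eq[OF sets_SL] sets_eq_imp_space_eq[OF sets_SL']
  by (auto simp: space_pair_measure)

sublocale ss: sequence_space SL ..
sublocale ss': sequence_space SL' ..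

lemma sets_inputs: "sets (inputs x) = sets input_space"
proof (cases x)
  case (Arrival i k)
  then show ?thesis by (simp only: inputs_Arrival sets_arrival_law)
qed (simp_all add: sets_step_law)

lemma prob_space_inputs: "prob_space (inputs x)"
proof (cases x)
  case (Arrival i k)
  then show ?thesis by (simp only: inputs_Arrival prob_space_arrival_law)
qed (simp_all add: SL.prob_space_axioms SL'.prob_space_axioms)

sublocale inp: product_prob_space inputs UNIV
  by (intro product_prob_spaceI prob_space_inputs)

lemma \<Omega>_PiM: "\<Omega> = PiM UNIV inputs"
  by (simp add: scenarios_def)

sublocale \<Omega>: prob_space \<Omega>
  unfolding \<Omega>_PiM by (rule inp.P.prob_space_axioms)

lemma sets_\<Omega>[measurable_cong]: "sets \<Omega> = sets (\<Pi>\<^sub>M _\<in>UNIV. input_space)"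
  unfolding \<Omega>_PiM by (intro sets_PiM_cong refl sets_inputs)

lemma space_\<Omega>[simp]: "space \<Omega> = UNIV"
  using sets_eq_imp_space_eq[OF sets_\<Omega>] by (auto simp: space_PiM space_pair_measure)

lemma space_SSeq[simp]: "space (\<Pi>\<^sub>M _\<in>(UNIV :: nat set). SL) = UNIV" "space (\<Pi>\<^sub>M _\<in>(UNIV :: nat set). SL') = UNIV"
  by (simp_all add: space_PiM)

lemma measurable_scenario_component[measurable]: "(\<lambda>\<omega>. \<omega> x) \<in> \<Omega> \<rightarrow>\<^sub>M input_space"
  by measurable

abbreviation parts_law where
  "parts_law \<equiv> stations_law \<Otimes>\<^sub>M ((\<Pi>\<^sub>M _\<in>(UNIV :: nat set). SL) \<Otimes>\<^sub>M (\<Pi>\<^sub>M _\<in>(UNIV :: nat set). SL'))"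

lemma measurable_assemble:
  assumes "f \<in> M \<rightarrow>\<^sub>M stations_law" "g \<in> M \<rightarrow>\<^sub>M (\<Pi>\<^sub>M _\<in>(UNIV :: nat set). SL)" "h \<in> M \<rightarrow>\<^sub>M (\<Pi>\<^sub>M _\<in>(UNIV :: nat set). SL')"
  shows "(\<lambda>w. assemble (f w) (g w) (h w)) \<in> M \<rightarrow>\<^sub>M \<Omega>"
proof -
  have 1: "(\<lambda>A. A i k) \<in> stations_law \<rightarrow>\<^sub>M input_space" for i k
    unfolding measurable_cong_sets[OF refl sets_arrival_law, symmetric]
    by (rule measurable_compose[of "\<lambda>A. A i" _ station_law "\<lambda>a. a k"]; rule measurable_component_singleton) auto
  have 2: "(\<lambda>a. a k) \<in> (\<Pi>\<^sub>M _\<in>(UNIV :: nat set). SL) \<rightarrow>\<^sub>M input_space" for k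
    unfolding measurable_cong_sets[OF refl sets_SL, symmetric]
    by (rule measurable_component_singleton) auto
  have 3: "(\<lambda>a. a k) \<in> (\<Pi>\<^sub>M _\<in>(UNIV :: nat set). SL') \<rightarrow>\<^sub>M input_space" for k
    unfolding measurable_cong_sets[OF refl sets_SL', symmetric]
    by (rule measurable_component_singleton) auto
  have "(\<lambda>w. assemble (f w) (g w) (h w)) \<in> M \<rightarrow>\<^sub>M (\<Pi>\<^sub>M _\<in>UNIV. input_space)"
  proof (rule measurable_PiM_single')
    fix x
    show "(\<lambda>w. assemble (f w) (g w) (h w) x) \<in> M \<rightarrow>\<^sub>M input_space"
      using measurable_compose[OF assms(1) 1] measurable_compose[OF assms(2) 2] measurable_compose[OF assms(3) 3]
      by (cases x) auto
  qed (auto simp: space_pair_measure)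
  then show ?thesis
    by (simp cong: measurable_cong_sets add: sets_\<Omega>)
qed

text \<open>
  A product over all inputs may be regrouped into a product over the stations of the arrival
  sequences, times the two sequences of steps: on finite-dimensional rectangles both sides are the same
  finite product.
\<close>

lemma distr_assemble: "distr parts_law \<Omega> (\<lambda>(A, S, E). assemble A S E) = \<Omega>" (is "distr _ _ ?f = _")
  unfolding \<Omega>_PiM
proof (rule inp.PiM_eq)
  have f[measurable]: "?f \<in> parts_law \<rightarrow>\<^sub>M PiM UNIV inputs"
    unfolding \<Omega>_PiM[symmetric] split_beta' by (intro measurable_assemble) measurable
  fix J X assume J: "finite J" and X: "\<And>j. j \<in> J \<Longrightarrow> X j \<in> sets (inputs j)"
  let ?emb = "prod_emb UNIV inputs J (Pi\<^sub>E J X)"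
  have emb: "?emb = {\<omega>. \<forall>j\<in>J. \<omega> j \<in> X j}"
    using space_\<Omega> unfolding \<Omega>_PiM by (auto simp: prod_emb_def space_PiM PiE_iff)
  have embs: "?emb \<in> sets (PiM UNIV inputs)"
    using J X by (intro sets_PiM_I) auto
  define I where "I = (\<lambda>x. case x of Arrival i k \<Rightarrow> i | _ \<Rightarrow> 0) ` J"
  define K where "K i = Arrival i -` J" for i
  define JS where "JS = After_Service -` J"
  define JE where "JE = After_Empty -` J"
  have fin: "finite I" "finite (K i)" "finite JS" "finite JE" for i
    using J by (auto simp: I_def K_def JS_def JE_def intro!: finite_vimageI injI)
  have I: "Arrival i k \<in> J \<Longrightarrow> i \<in> I" for i k
    unfolding I_def by (force intro: rev_image_eqI)
  have XA: "Arrival i k \<in> J \<Longrightarrow> X (Arrival i k) \<in> sets arrival_law" for i k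
    using X[of "Arrival i k"] by (simp only: inputs_Arrival)
  have XS: "n \<in> JS \<Longrightarrow> X (After_Service n) \<in> sets SL" for n
    using X[of "After_Service n"] by (simp add: JS_def)
  have XE: "n \<in> JE \<Longrightarrow> X (After_Empty n) \<in> sets SL'" for n
    using X[of "After_Empty n"] by (simp add: JE_def)
  let ?C = "\<lambda>i. {a\<in>space station_law. \<forall>k\<in>K i. a k \<in> X (Arrival i k)}"
  have C: "?C i \<in> sets station_law" for i
    using XA fin by (intro sets_PiM_Collect_finite) (auto simp: K_def)
  let ?YA = "{A\<in>space stations_law. \<forall>i\<in>I. A i \<in> ?C i}"
  let ?YS = "{a\<in>space (\<Pi>\<^sub>M _\<in>(UNIV :: nat set). SL). \<forall>n\<in>JS. a n \<in> X (After_Service n)}"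
  let ?YE = "{a\<in>space (\<Pi>\<^sub>M _\<in>(UNIV :: nat set). SL'). \<forall>n\<in>JE. a n \<in> X (After_Empty n)}"
  have YA: "?YA \<in> sets stations_law"
    by (rule sets_PiM_Collect_finite[OF fin(1) C])
  have YS: "?YS \<in> sets (\<Pi>\<^sub>M _\<in>(UNIV :: nat set). SL)"
    by (rule sets_PiM_Collect_finite[OF fin(3) XS])
  have YE: "?YE \<in> sets (\<Pi>\<^sub>M _\<in>(UNIV :: nat set). SL')"
    by (rule sets_PiM_Collect_finite[OF fin(4) XE])
  have decomp: "J = (\<lambda>(i, k). Arrival i k) ` Sigma I K \<union> (After_Service ` JS \<union> After_Empty ` JE)"
    unfolding set_eq_iff
  proof
    fix x show "x \<in> J \<longleftrightarrow> x \<in> (\<lambda>(i, k). Arrival i k) ` Sigma I K \<union> (After_Service ` JS \<union> After_Empty ` JE)"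
      by (cases x) (auto simp: K_def JS_def JE_def I)
  qed
  have "(\<Prod>j\<in>J. emeasure (inputs j) (X j))
    = (\<Prod>j\<in>(\<lambda>(i, k). Arrival i k) ` Sigma I K \<union> (After_Service ` JS \<union> After_Empty ` JE). emeasure (inputs j) (X j))"
    using decomp by simp
  also have "\<dots> = (\<Prod>j\<in>(\<lambda>(i, k). Arrival i k) ` Sigma I K. emeasure (inputs j) (X j)) *
      ((\<Prod>j\<in>After_Service ` JS. emeasure (inputs j) (X j)) * (\<Prod>j\<in>After_Empty ` JE. emeasure (inputs j) (X j)))"
  proof -
    have "finite ((\<lambda>(i, k). Arrival i k) ` Sigma I K)" "finite (After_Service ` JS)" "finite (After_Empty ` JE)"
      using fin by auto
    moreover have "(\<lambda>(i, k). Arrival i k) ` Sigma I K \<inter> (After_Service ` JS \<union> After_Empty ` JE) = {}"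
      "After_Service ` JS \<inter> After_Empty ` JE = {}"
      by auto
    ultimately show ?thesis
      by (simp only: prod.union_disjoint finite_Un)
  qed
  also have "(\<Prod>j\<in>(\<lambda>(i, k). Arrival i k) ` Sigma I K. emeasure (inputs j) (X j))
    = (\<Prod>i\<in>I. \<Prod>k\<in>K i. emeasure arrival_law (X (Arrival i k)))"
    using fin by (subst prod.reindex) (auto simp: inj_on_def prod.Sigma inputs_Arrival split_beta' simp del: input_law.simps)
  also have "(\<Prod>i\<in>I. \<Prod>k\<in>K i. emeasure arrival_law (X (Arrival i k))) = (\<Prod>i\<in>I. emeasure station_law (?C i))"
    using fin XA by (intro prod.cong refl seq.emeasure_PiM_Collect[symmetric]) (auto simp: K_def)
  also have "(\<Prod>i\<in>I. emeasure station_law (?C i)) = emeasure stations_law ?YA"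
    using fin C by (intro st.emeasure_PiM_Collect[symmetric]) auto
  also have "(\<Prod>j\<in>After_Service ` JS. emeasure (inputs j) (X j)) = (\<Prod>n\<in>JS. emeasure SL (X (After_Service n)))"
    by (subst prod.reindex) (auto simp: inj_on_def)
  also have "\<dots> = emeasure (\<Pi>\<^sub>M _\<in>(UNIV :: nat set). SL) ?YS"
    using fin XS by (intro ss.emeasure_PiM_Collect[symmetric]) auto
  also have "(\<Prod>j\<in>After_Empty ` JE. emeasure (inputs j) (X j)) = (\<Prod>n\<in>JE. emeasure SL' (X (After_Empty n)))"
    by (subst prod.reindex) (auto simp: inj_on_def)
  also have "\<dots> = emeasure (\<Pi>\<^sub>M _\<in>(UNIV :: nat set). SL') ?YE"
    using fin XE by (intro ss'.emeasure_PiM_Collect[symmetric]) auto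
  also have "emeasure stations_law ?YA * (emeasure (\<Pi>\<^sub>M _\<in>(UNIV :: nat set). SL) ?YS * emeasure (\<Pi>\<^sub>M _\<in>(UNIV :: nat set). SL') ?YE)
    = emeasure parts_law (?YA \<times> (?YS \<times> ?YE))"
  proof -
    interpret P2: pair_prob_space "\<Pi>\<^sub>M _\<in>(UNIV :: nat set). SL" "\<Pi>\<^sub>M _\<in>(UNIV :: nat set). SL'" ..
    show ?thesis
      using YA YS YE
      by (simp add: ss'.P.emeasure_pair_measure_Times P2.emeasure_pair_measure_Times del: space_stations_law space_SSeq)
  qed
  also have "?YA \<times> (?YS \<times> ?YE) = ?f -` ?emb \<inter> space parts_law"
  proof -
    have "(\<forall>j\<in>J. \<omega> j \<in> X j) \<longleftrightarrow> (\<forall>i\<in>I. \<forall>k\<in>K i. \<omega> (Arrival i k) \<in> X (Arrival i k)) \<and>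
      (\<forall>n\<in>JS. \<omega> (After_Service n) \<in> X (After_Service n)) \<and> (\<forall>n\<in>JE. \<omega> (After_Empty n) \<in> X (After_Empty n))" for \<omega>
      by (subst decomp) auto
    then show ?thesis
      by (auto simp: emb space_pair_measure)
  qed
  finally show "emeasure (distr parts_law (PiM UNIV inputs) ?f) ?emb = (\<Prod>j\<in>J. emeasure (inputs j) (X j))"
    using embs by (simp add: emeasure_distr)
qed simp

abbreviation serv_law where "serv_law \<equiv> \<Pi>\<^sub>M _\<in>(UNIV :: nat set). SL"
abbreviation empt_law where "empt_law \<equiv> \<Pi>\<^sub>M _\<in>(UNIV :: nat set). SL'"

end

section \<open>Restarting at the first polling instant\<close>

lemma (in sequence_space) nn_integral_head_tail:
  assumes [measurable]: "\<phi> \<in> borel_measurable M" "g \<in> borel_measurable S"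
  shows "(\<integral>\<^sup>+a. \<phi> (a 0) * g (\<lambda>n. a (Suc n)) \<partial>S) = (\<integral>\<^sup>+q. \<phi> q \<partial>M) * (\<integral>\<^sup>+a. g a \<partial>S)"
proof -
  have "(\<lambda>a n. a (Suc n)) \<in> S \<rightarrow>\<^sub>M S"
    by (rule measurable_PiM_single') (auto simp: space_PiM)
  note [measurable] = measurable_compose[OF this assms(2)]
  have "(\<lambda>a. \<phi> (a 0) * g (\<lambda>n. a (Suc n))) \<in> borel_measurable S"
    by measurable
  from nn_integral_iter[OF this] show ?thesis
    by (simp add: nn_integral_cmult nn_integral_multc)
qed

definition first_step :: "bool \<Rightarrow> scenario \<Rightarrow> nat \<times> real" where
  "first_step h \<omega> = \<omega> (if h then After_Service 0 else After_Empty 0)"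

definition station :: "scenario \<Rightarrow> nat \<Rightarrow> nat \<Rightarrow> nat \<times> real" where
  "station \<omega> i = (\<lambda>k. \<omega> (Arrival i k))"

text \<open>
  The scenario seen from time \<open>u\<close>, when \<open>u\<close> is the epoch of the first polling instant after \<open>0\<close>: arrivals
  are replaced by their residuals, and the step of either kind with index \<open>0\<close> is consumed.
\<close>

definition shift :: "scenario \<Rightarrow> real \<Rightarrow> scenario" where
  "shift \<omega> u = assemble (\<lambda>i. residual (station \<omega> i) u) (\<lambda>n. \<omega> (After_Service (Suc n))) (\<lambda>n. \<omega> (After_Empty (Suc n)))"

definition totals :: "nat \<Rightarrow> (nat \<Rightarrow> nat \<Rightarrow> nat \<times> real) \<Rightarrow> real \<Rightarrow> nat list" where
  "totals N A u = map (\<lambda>i. total (A i) u) [0..<N]"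

lemma station_assemble[simp]: "station (assemble A S E) = A"
  by (simp add: station_def fun_eq_iff)

lemma first_step_assemble[simp]: "first_step h (assemble A S E) = (if h then S 0 else E 0)"
  by (simp add: first_step_def)

context compound_poisson
begin

lemma measurable_station_component:
  "(\<lambda>A. A i) \<in> stations_law \<rightarrow>\<^sub>M (\<Pi>\<^sub>M _\<in>UNIV. input_space)"
  unfolding measurable_cong_sets[OF refl sets_station_law, symmetric]
  by (rule measurable_component_singleton) simp

lemma measurable_total_component:
  "(\<lambda>x. total (fst x i) (snd x)) \<in> stations_law \<Otimes>\<^sub>M borel \<rightarrow>\<^sub>M count_space UNIV"
proof -
  have "(\<lambda>x. (fst x i, snd x)) \<in> stations_law \<Otimes>\<^sub>M borel \<rightarrow>\<^sub>M (\<Pi>\<^sub>M _\<in>UNIV. input_space) \<Otimes>\<^sub>M borel"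
    by (intro measurable_Pair measurable_compose[OF measurable_fst measurable_station_component] measurable_snd)
  from measurable_compose[OF this measurable_total] show ?thesis by simp
qed

lemma measurable_totals[measurable]:
  "(\<lambda>(A, u). totals N A u) \<in> stations_law \<Otimes>\<^sub>M borel \<rightarrow>\<^sub>M count_space UNIV"
proof (rule measurable_count_space_eq2_countable[THEN iffD2], intro conjI ballI)
  fix l :: "nat list"
  have *: "totals N A u = l \<longleftrightarrow> length l = N \<and> (\<forall>i\<in>{..<N}. total (A i) u = l ! i)" for A u
    unfolding totals_def list_eq_iff_nth_eq by auto
  have "(\<lambda>(A, u). totals N A u) -` {l} \<inter> space (stations_law \<Otimes>\<^sub>M borel)
    = {x \<in> space (stations_law \<Otimes>\<^sub>M borel). length l = N \<and> (\<forall>i\<in>{..<N}. total (fst x i) (snd x) = l ! i)}"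
    unfolding set_eq_iff
  proof
    fix x :: "(nat \<Rightarrow> nat \<Rightarrow> nat \<times> real) \<times> real"
    show "x \<in> (\<lambda>(A, u). totals N A u) -` {l} \<inter> space (stations_law \<Otimes>\<^sub>M borel) \<longleftrightarrow>
      x \<in> {x \<in> space (stations_law \<Otimes>\<^sub>M borel). length l = N \<and> (\<forall>i\<in>{..<N}. total (fst x i) (snd x) = l ! i)}"
      by (cases x) (simp add: *, blast)
  qed
  also have "\<dots> \<in> sets (stations_law \<Otimes>\<^sub>M borel)"
  proof -
    note [measurable] = measurable_total_component
    show ?thesis by measurable
  qed
  finally show "(\<lambda>(A, u). totals N A u) -` {l} \<inter> space (stations_law \<Otimes>\<^sub>M borel) \<in> sets (stations_law \<Otimes>\<^sub>M borel)" .
qed auto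

end

context polling_model
begin

lemma nn_integral_\<Omega>:
  assumes f: "f \<in> borel_measurable \<Omega>"
  shows "(\<integral>\<^sup>+\<omega>. f \<omega> \<partial>\<Omega>) = (\<integral>\<^sup>+S. \<integral>\<^sup>+E. \<integral>\<^sup>+A. f (assemble A S E) \<partial>stations_law \<partial>empt_law \<partial>serv_law)"
proof -
  have M: "(\<lambda>x. assemble (fst x) (fst (snd x)) (snd (snd x))) \<in> parts_law \<rightarrow>\<^sub>M \<Omega>"
    by (intro measurable_assemble) measurable
  have fM: "(\<lambda>x. f (assemble (fst x) (fst (snd x)) (snd (snd x)))) \<in> borel_measurable parts_law"
    by (rule measurable_compose[OF M f])
  interpret P2: pair_prob_space serv_law empt_law ..
  interpret P3: pair_prob_space stations_law "serv_law \<Otimes>\<^sub>M empt_law" ..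
  have M2: "(\<lambda>y. \<integral>\<^sup>+A. f (assemble A (fst y) (snd y)) \<partial>stations_law) \<in> borel_measurable (serv_law \<Otimes>\<^sub>M empt_law)"
  proof (rule st.P.borel_measurable_nn_integral)
    have "(\<lambda>x. assemble (snd x) (fst (fst x)) (snd (fst x))) \<in> (serv_law \<Otimes>\<^sub>M empt_law) \<Otimes>\<^sub>M stations_law \<rightarrow>\<^sub>M \<Omega>"
      by (intro measurable_assemble) measurable
    from measurable_compose[OF this f]
    show "(\<lambda>(y, A). f (assemble A (fst y) (snd y))) \<in> borel_measurable ((serv_law \<Otimes>\<^sub>M empt_law) \<Otimes>\<^sub>M stations_law)"
      by (simp add: split_beta')
  qed
  have "(\<integral>\<^sup>+\<omega>. f \<omega> \<partial>\<Omega>) = (\<integral>\<^sup>+x. f (assemble (fst x) (fst (snd x)) (snd (snd x))) \<partial>parts_law)"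
    by (subst distr_assemble[symmetric]) (use M f in \<open>simp add: nn_integral_distr split_beta'\<close>)
  also have "\<dots> = (\<integral>\<^sup>+y. \<integral>\<^sup>+A. f (assemble A (fst y) (snd y)) \<partial>stations_law \<partial>(serv_law \<Otimes>\<^sub>M empt_law))"
    using P3.nn_integral_snd[OF fM] by simp
  also have "\<dots> = (\<integral>\<^sup>+S. \<integral>\<^sup>+E. \<integral>\<^sup>+A. f (assemble A S E) \<partial>stations_law \<partial>empt_law \<partial>serv_law)"
    using ss'.P.nn_integral_fst[OF M2] by simp
  finally show ?thesis .
qed

definition step where "step h = (if h then SL else SL')"

lemma sets_step[measurable_cong]: "sets (step h) = sets input_space"
  by (simp add: step_def sets_step_law)

lemma AE_step_nonneg: "AE q in step h. 0 \<le> snd q"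
proof (cases h)
  case True
  then have "step h = SL" by (simp add: step_def)
  then show ?thesis
    using AE_step_law[of H p, OF H_prob H_sets H_nonneg] by metis
next
  case False
  then have "step h = SL'" by (simp add: step_def)
  then show ?thesis
    using AE_step_law[of H' p', OF H'_prob H'_sets H'_nonneg] by metis
qed

lemma measurable_first_step[measurable]: "first_step h \<in> \<Omega> \<rightarrow>\<^sub>M input_space"
  unfolding first_step_def by measurable

lemma measurable_stations[measurable]: "station \<in> \<Omega> \<rightarrow>\<^sub>M stations_law"
  unfolding station_def
proof (rule measurable_PiM_single')
  fix i
  show "(\<lambda>\<omega> . (\<lambda>k. \<omega> (Arrival i k))) \<in> \<Omega> \<rightarrow>\<^sub>M station_law"
    by (rule measurable_PiM_single') auto
qed auto

lemma measurable_shift[measurable]: "(\<lambda>(\<omega>, u). shift \<omega> u) \<in> \<Omega> \<Otimes>\<^sub>M borel \<rightarrow>\<^sub>M \<Omega>"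
  unfolding shift_def split_beta'
proof (rule measurable_assemble)
  have 1: "(\<lambda>\<omega>. station \<omega> i) \<in> \<Omega> \<rightarrow>\<^sub>M (\<Pi>\<^sub>M _\<in>UNIV. input_space)" for i
    by (rule measurable_compose[OF measurable_stations measurable_station_component])
  show "(\<lambda>x i. residual (station (fst x) i) (snd x)) \<in> \<Omega> \<Otimes>\<^sub>M borel \<rightarrow>\<^sub>M stations_law"
  proof (rule measurable_PiM_single')
    fix i
    have "(\<lambda>x. (station (fst x) i, snd x)) \<in> \<Omega> \<Otimes>\<^sub>M borel \<rightarrow>\<^sub>M (\<Pi>\<^sub>M _\<in>UNIV. input_space) \<Otimes>\<^sub>M borel"
      by (intro measurable_Pair measurable_compose[OF measurable_fst 1] measurable_snd)
    from measurable_compose[OF this measurable_residual]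
    show "(\<lambda>x. residual (station (fst x) i) (snd x)) \<in> \<Omega> \<Otimes>\<^sub>M borel \<rightarrow>\<^sub>M station_law"
      unfolding measurable_cong_sets[OF refl sets_station_law] by simp
  qed auto
  show "(\<lambda>x n. fst x (After_Service (Suc n))) \<in> \<Omega> \<Otimes>\<^sub>M borel \<rightarrow>\<^sub>M serv_law"
    by (rule measurable_PiM_single') auto
  show "(\<lambda>x n. fst x (After_Empty (Suc n))) \<in> \<Omega> \<Otimes>\<^sub>M borel \<rightarrow>\<^sub>M empt_law"
    by (rule measurable_PiM_single') auto
qed

lemma nn_integral_first_step:
  assumes g: "(\<lambda>(q, A). g q A) \<in> borel_measurable (input_space \<Otimes>\<^sub>M stations_law)"
  shows "(\<integral>\<^sup>+\<omega>. g (first_step h \<omega>) (station \<omega>) \<partial>\<Omega>) = (\<integral>\<^sup>+q. \<integral>\<^sup>+A. g q A \<partial>stations_law \<partial>step h)"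
proof -
  have M: "(\<lambda>\<omega>. g (first_step h \<omega>) (station \<omega>)) \<in> borel_measurable \<Omega>"
    using measurable_compose[OF measurable_Pair[OF measurable_first_step measurable_stations] g] by simp
  have G[measurable]: "(\<lambda>q. \<integral>\<^sup>+A. g q A \<partial>stations_law) \<in> borel_measurable input_space"
    using st.P.borel_measurable_nn_integral[OF g] by simp
  have GS: "(\<lambda>q. \<integral>\<^sup>+A. g q A \<partial>stations_law) \<in> borel_measurable SL"
    and GS': "(\<lambda>q. \<integral>\<^sup>+A. g q A \<partial>stations_law) \<in> borel_measurable SL'"
    unfolding measurable_cong_sets[OF sets_SL refl] measurable_cong_sets[OF sets_SL' refl] by (rule G)+
  show ?thesis
  proof (cases h)
    case True
    have "(\<integral>\<^sup>+\<omega>. g (first_step h \<omega>) (station \<omega>) \<partial>\<Omega>) = (\<integral>\<^sup>+S. (\<integral>\<^sup>+A. g (S 0) A \<partial>stations_law) * 1 \<partial>serv_law)"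
      unfolding nn_integral_\<Omega>[OF M] using True ss'.P.emeasure_space_1 by simp
    also have "\<dots> = (\<integral>\<^sup>+q. \<integral>\<^sup>+A. g q A \<partial>stations_law \<partial>SL)"
      using ss.nn_integral_head_tail[OF GS borel_measurable_const[of 1]] ss.P.emeasure_space_1 by simp
    finally show ?thesis using True by (simp add: step_def)
  next
    case False
    have "(\<integral>\<^sup>+\<omega>. g (first_step h \<omega>) (station \<omega>) \<partial>\<Omega>) = (\<integral>\<^sup>+E. (\<integral>\<^sup>+A. g (E 0) A \<partial>stations_law) * 1 \<partial>empt_law)"
      unfolding nn_integral_\<Omega>[OF M] using False ss.P.emeasure_space_1 by simp
    also have "\<dots> = (\<integral>\<^sup>+q. \<integral>\<^sup>+A. g q A \<partial>stations_law \<partial>SL')"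
      using ss'.nn_integral_head_tail[OF GS' borel_measurable_const[of 1]] ss'.P.emeasure_space_1 by simp
    finally show ?thesis using False by (simp add: step_def)
  qed
qed

text \<open>
  On the event that the first jump is \<open>d\<close> and the arrivals during the first step are \<open>l\<close>, the shifted
  scenario is an independent copy. Given the step, whose duration is then a constant \<open>u\<close>, the arrivals
  are handled by \<open>stations_memoryless\<close>; the unused input of index \<open>0\<close> integrates to one.
\<close>

lemma markov_event:
  fixes h :: bool and d :: nat and l :: "nat list"
  assumes G: "G \<in> borel_measurable \<Omega>"
  defines "I \<equiv> \<lambda>q A. indicator {(d, l)} (fst q, totals N A (snd q)) :: ennreal"
  shows "(\<integral>\<^sup>+\<omega>. I (first_step h \<omega>) (station \<omega>) * G (shift \<omega> (snd (first_step h \<omega>))) \<partial>\<Omega>)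
    = (\<integral>\<^sup>+q. \<integral>\<^sup>+A. I q A \<partial>stations_law \<partial>step h) * (\<integral>\<^sup>+\<omega>. G \<omega> \<partial>\<Omega>)"
proof -
  note [measurable] = G
  have I[measurable]: "(\<lambda>(q, A). I q A) \<in> borel_measurable (input_space \<Otimes>\<^sub>M stations_law)"
    unfolding I_def by measurable
  have Iq: "(\<lambda>A. I q A) \<in> borel_measurable stations_law" for q
    using measurable_compose[OF measurable_Pair1'[of q input_space stations_law] I] by (simp add: space_pair_measure)
  define \<phi> where "\<phi> q = (\<integral>\<^sup>+A. I q A \<partial>stations_law)" for q
  have \<phi>[measurable]: "\<phi> \<in> borel_measurable input_space"
    using st.P.borel_measurable_nn_integral[OF I] by (simp add: \<phi>_def[abs_def])
  have \<phi>S: "\<phi> \<in> borel_measurable SL" and \<phi>E: "\<phi> \<in> borel_measurable SL'"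
    unfolding measurable_cong_sets[OF sets_SL refl] measurable_cong_sets[OF sets_SL' refl] by (rule \<phi>)+
  define G2 where "G2 S E = (\<integral>\<^sup>+A. G (assemble A S E) \<partial>stations_law)" for S E
  have GA: "(\<lambda>A. G (assemble A S E)) \<in> borel_measurable stations_law" for S E
    by (rule measurable_compose[OF measurable_assemble G]) auto
  have G2: "(\<lambda>(S, E). G2 S E) \<in> borel_measurable (serv_law \<Otimes>\<^sub>M empt_law)"
  proof -
    have "(\<lambda>x. assemble (snd x) (fst (fst x)) (snd (fst x))) \<in> (serv_law \<Otimes>\<^sub>M empt_law) \<Otimes>\<^sub>M stations_law \<rightarrow>\<^sub>M \<Omega>"
      by (intro measurable_assemble) measurable
    from measurable_compose[OF this G]
    have "(\<lambda>(y, A). G (assemble A (fst y) (snd y))) \<in> borel_measurable ((serv_law \<Otimes>\<^sub>M empt_law) \<Otimes>\<^sub>M stations_law)"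
      by (simp add: split_beta')
    from st.P.borel_measurable_nn_integral[OF this] show ?thesis
      by (simp add: G2_def split_beta')
  qed
  have G2S: "(\<lambda>E. G2 S E) \<in> borel_measurable empt_law" for S
    using measurable_compose[OF measurable_Pair1'[of S serv_law empt_law] G2] by (simp add: space_pair_measure)
  have G3: "(\<lambda>S. \<integral>\<^sup>+E. G2 S E \<partial>empt_law) \<in> borel_measurable serv_law"
    using ss'.P.borel_measurable_nn_integral[OF G2] by simp
  let ?q = "\<lambda>S E. if h then S 0 else E 0"
  have M: "(\<lambda>\<omega>. I (first_step h \<omega>) (station \<omega>) * G (shift \<omega> (snd (first_step h \<omega>)))) \<in> borel_measurable \<Omega>"
  proof -
    have "(\<lambda>\<omega>. I (first_step h \<omega>) (station \<omega>)) \<in> borel_measurable \<Omega>"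
      using measurable_compose[OF measurable_Pair[OF measurable_first_step measurable_stations] I] by simp
    moreover have "(\<lambda>\<omega>. G (shift \<omega> (snd (first_step h \<omega>)))) \<in> borel_measurable \<Omega>"
      by measurable
    ultimately show ?thesis by (rule borel_measurable_times_ennreal)
  qed
  have "(\<integral>\<^sup>+\<omega>. I (first_step h \<omega>) (station \<omega>) * G (shift \<omega> (snd (first_step h \<omega>))) \<partial>\<Omega>)
    = (\<integral>\<^sup>+S. \<integral>\<^sup>+E. \<integral>\<^sup>+A. I (?q S E) A * G (assemble (\<lambda>i. residual (A i) (snd (?q S E))) (\<lambda>n. S (Suc n)) (\<lambda>n. E (Suc n))) \<partial>stations_law \<partial>empt_law \<partial>serv_law)"
    unfolding nn_integral_\<Omega>[OF M] by (simp add: shift_def)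
  also have "\<dots> = (\<integral>\<^sup>+S. \<integral>\<^sup>+E. \<phi> (?q S E) * G2 (\<lambda>n. S (Suc n)) (\<lambda>n. E (Suc n)) \<partial>empt_law \<partial>serv_law)"
  proof -
    have *: "(\<integral>\<^sup>+A. I q A * G (assemble (\<lambda>i. residual (A i) (snd q)) S E) \<partial>stations_law) = \<phi> q * G2 S E"
      if "0 \<le> snd q" for q S E
    proof -
      have "(\<integral>\<^sup>+A. I q A * G (assemble (\<lambda>i. residual (A i) (snd q)) S E) \<partial>stations_law)
        = (\<integral>\<^sup>+A. \<integral>\<^sup>+A'. I q A * G (assemble A' S E) \<partial>stations_law \<partial>stations_law)"
        unfolding I_def totals_def
        by (rule stations_memoryless[OF that, of "\<lambda>c A. indicator {(d, l)} (fst q, c) * G (assemble A S E)"])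
           (intro borel_measurable_times_ennreal GA borel_measurable_const)
      also have "\<dots> = (\<integral>\<^sup>+A. I q A * G2 S E \<partial>stations_law)"
        by (simp add: nn_integral_cmult[OF GA] G2_def)
      also have "\<dots> = \<phi> q * G2 S E"
        by (simp add: nn_integral_multc[OF Iq] \<phi>_def)
      finally show ?thesis .
    qed
    have S0: "AE S in serv_law. h \<longrightarrow> 0 \<le> snd (S 0)"
    proof (cases h)
      case True
      then have "AE S in serv_law. 0 \<le> snd (S 0)"
        using AE_step_nonneg[of True] unfolding step_def if_True by (intro ss.AE_component) simp_all
      then show ?thesis by eventually_elim simp
    qed simp
    have E0: "AE E in empt_law. \<not> h \<longrightarrow> 0 \<le> snd (E 0)"
    proof (cases h)
      case False
      then have "AE E in empt_law. 0 \<le> snd (E 0)"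
        using AE_step_nonneg[of False] unfolding step_def if_False by (intro ss'.AE_component) simp_all
      then show ?thesis by eventually_elim simp
    qed simp
    show ?thesis
    proof (rule nn_integral_cong_AE, rule eventually_mono[OF S0])
      fix S :: "nat \<Rightarrow> nat \<times> real" assume S: "h \<longrightarrow> 0 \<le> snd (S 0)"
      show "(\<integral>\<^sup>+E. \<integral>\<^sup>+A. I (?q S E) A * G (assemble (\<lambda>i. residual (A i) (snd (?q S E))) (\<lambda>n. S (Suc n)) (\<lambda>n. E (Suc n))) \<partial>stations_law \<partial>empt_law)
        = (\<integral>\<^sup>+E. \<phi> (?q S E) * G2 (\<lambda>n. S (Suc n)) (\<lambda>n. E (Suc n)) \<partial>empt_law)"
        by (rule nn_integral_cong_AE, rule eventually_mono[OF E0], rule *) (use S in auto)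
    qed
  qed
  also have "\<dots> = (\<integral>\<^sup>+q. \<phi> q \<partial>step h) * (\<integral>\<^sup>+S. \<integral>\<^sup>+E. G2 S E \<partial>empt_law \<partial>serv_law)"
  proof (cases h)
    case True
    have tl: "(\<integral>\<^sup>+E. c * G2 S (\<lambda>n. E (Suc n)) \<partial>empt_law) = c * (\<integral>\<^sup>+E. G2 S E \<partial>empt_law)" for c S
      using ss'.nn_integral_head_tail[OF borel_measurable_const[of c] G2S] SL'.emeasure_space_1 by simp
    show ?thesis
      using True ss.nn_integral_head_tail[OF \<phi>S G3] by (simp add: tl step_def)
  next
    case False
    have tl: "(\<integral>\<^sup>+E. \<phi> (E 0) * G2 S (\<lambda>n. E (Suc n)) \<partial>empt_law) = (\<integral>\<^sup>+q. \<phi> q \<partial>SL') * (\<integral>\<^sup>+E. G2 S E \<partial>empt_law)" for S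
      by (rule ss'.nn_integral_head_tail[OF \<phi>E G2S])
    show ?thesis
      using False ss.nn_integral_head_tail[OF borel_measurable_const[of "\<integral>\<^sup>+q. \<phi> q \<partial>SL'"] G3] SL.emeasure_space_1
      by (simp add: tl step_def)
  qed
  also have "(\<integral>\<^sup>+S. \<integral>\<^sup>+E. G2 S E \<partial>empt_law \<partial>serv_law) = (\<integral>\<^sup>+\<omega>. G \<omega> \<partial>\<Omega>)"
    unfolding G2_def by (rule nn_integral_\<Omega>[OF G, symmetric])
  finally show ?thesis unfolding \<phi>_def .
qed

text \<open>
  Summation of \<open>markov_event\<close> over the countably many values of the first jump and of the arrivals.
\<close>

lemma markov_first_step:
  fixes h :: bool and F :: "nat \<times> nat list \<Rightarrow> scenario \<Rightarrow> ennreal"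
  assumes F: "\<And>c. F c \<in> borel_measurable \<Omega>"
  defines "C \<equiv> \<lambda>\<omega>. (fst (first_step h \<omega>), totals N (station \<omega>) (snd (first_step h \<omega>)))"
  shows "(\<integral>\<^sup>+\<omega>. F (C \<omega>) (shift \<omega> (snd (first_step h \<omega>))) \<partial>\<Omega>) = (\<integral>\<^sup>+\<omega>. \<integral>\<^sup>+\<omega>'. F (C \<omega>) \<omega>' \<partial>\<Omega> \<partial>\<Omega>)"
proof -
  note [measurable] = F
  have C[measurable]: "C \<in> \<Omega> \<rightarrow>\<^sub>M count_space UNIV"
    unfolding C_def by measurable
  have sh[measurable]: "(\<lambda>\<omega>. shift \<omega> (snd (first_step h \<omega>))) \<in> \<Omega> \<rightarrow>\<^sub>M \<Omega>"
    by measurable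
  define e where "e n = {\<omega>. to_nat (C \<omega>) = n}" for n
  define c :: "nat \<Rightarrow> nat \<times> nat list" where "c n = from_nat n" for n
  have split: "g (C \<omega>) = (\<Sum>n. indicator (e n) \<omega> * g (c n))" for \<omega> and g :: "nat \<times> nat list \<Rightarrow> ennreal"
    by (subst suminf_single[of "to_nat (C \<omega>)"]) (auto simp: e_def c_def indicator_def)
  have e[measurable]: "e n \<in> sets \<Omega>" for n
    using measurable_sets[OF C, of "{x. to_nat x = n}"] by (simp add: e_def vimage_def)
  have ev: "(\<integral>\<^sup>+\<omega>. indicator (e n) \<omega> * F (c n) (shift \<omega> (snd (first_step h \<omega>))) \<partial>\<Omega>)
    = emeasure \<Omega> (e n) * (\<integral>\<^sup>+\<omega>. F (c n) \<omega> \<partial>\<Omega>)" for n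
  proof (cases "to_nat (c n) = n")
    case True
    obtain d l where dl: "c n = (d, l)" by (cases "c n")
    have ind: "indicator (e n) \<omega> = (indicator {(d, l)} (fst (first_step h \<omega>), totals N (station \<omega>) (snd (first_step h \<omega>))) :: ennreal)" for \<omega>
    proof -
      have "to_nat (C \<omega>) = n \<longleftrightarrow> C \<omega> = (d, l)"
        using True dl by (metis to_nat_split)
      then show ?thesis by (simp add: e_def indicator_def C_def)
    qed
    have "emeasure \<Omega> (e n) = (\<integral>\<^sup>+\<omega>. indicator (e n) \<omega> * 1 \<partial>\<Omega>)"
      by simp
    also have "\<dots> = (\<integral>\<^sup>+q. \<integral>\<^sup>+A. indicator {(d, l)} (fst q, totals N A (snd q)) \<partial>stations_law \<partial>step h) * (\<integral>\<^sup>+\<omega>. 1 \<partial>\<Omega>)"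
      unfolding ind by (rule markov_event) simp
    finally have "emeasure \<Omega> (e n) = (\<integral>\<^sup>+q. \<integral>\<^sup>+A. indicator {(d, l)} (fst q, totals N A (snd q)) \<partial>stations_law \<partial>step h)"
      using \<Omega>.emeasure_space_1 by simp
    then show ?thesis
      unfolding ind by (simp only: markov_event[OF F])
  next
    case False
    then have "e n = {}" by (auto simp: e_def c_def)
    then show ?thesis by simp
  qed
  have "(\<integral>\<^sup>+\<omega>. F (C \<omega>) (shift \<omega> (snd (first_step h \<omega>))) \<partial>\<Omega>)
    = (\<integral>\<^sup>+\<omega>. (\<Sum>n. indicator (e n) \<omega> * F (c n) (shift \<omega> (snd (first_step h \<omega>)))) \<partial>\<Omega>)"
    by (rule nn_integral_cong, rule split[of "\<lambda>c. F c _"])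
  also have "\<dots> = (\<Sum>n. \<integral>\<^sup>+\<omega>. indicator (e n) \<omega> * F (c n) (shift \<omega> (snd (first_step h \<omega>))) \<partial>\<Omega>)"
    by (rule nn_integral_suminf) measurable
  also have "\<dots> = (\<Sum>n. \<integral>\<^sup>+\<omega>. indicator (e n) \<omega> * (\<integral>\<^sup>+\<omega>'. F (c n) \<omega>' \<partial>\<Omega>) \<partial>\<Omega>)"
    unfolding ev by (simp add: nn_integral_multc)
  also have "\<dots> = (\<integral>\<^sup>+\<omega>. (\<Sum>n. indicator (e n) \<omega> * (\<integral>\<^sup>+\<omega>'. F (c n) \<omega>' \<partial>\<Omega>)) \<partial>\<Omega>)"
    by (rule nn_integral_suminf[symmetric]) measurable
  also have "\<dots> = (\<integral>\<^sup>+\<omega>. \<integral>\<^sup>+\<omega>'. F (C \<omega>) \<omega>' \<partial>\<Omega> \<partial>\<Omega>)"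
    by (rule nn_integral_cong, rule split[of "\<lambda>c. \<integral>\<^sup>+\<omega>'. F c \<omega>' \<partial>\<Omega>", symmetric])
  finally show ?thesis .
qed

end

section \<open>Sample paths\<close>

definition nonneg_steps :: "scenario \<Rightarrow> bool" where
  "nonneg_steps \<omega> \<longleftrightarrow> (\<forall>n. 0 \<le> snd (\<omega> (After_Service n)) \<and> 0 \<le> snd (\<omega> (After_Empty n)))"

text \<open>
  The almost sure event on which all path identities below hold.
\<close>

definition nice :: "scenario \<Rightarrow> bool" where
  "nice \<omega> \<longleftrightarrow> (\<forall>i. regular (station \<omega> i)) \<and> nonneg_steps \<omega>"

definition nonempty :: "state \<Rightarrow> bool" where
  "nonempty z \<longleftrightarrow> 0 < snd z ! fst z"

definition after_poll :: "state \<Rightarrow> nat \<Rightarrow> nat" where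
  "after_poll z i = snd z ! i - (if i = fst z then 1 else 0)"

definition successor :: "nat \<Rightarrow> state \<Rightarrow> nat \<times> nat list \<Rightarrow> state" where
  "successor N z c = ((fst z + fst c) mod N, map (\<lambda>i. after_poll z i + snd c ! i) [0..<N])"

lemma batch_time_station: "batch_time \<omega> i k = epoch (station \<omega> i) k"
  by (simp add: batch_time_def epoch_def station_def)

lemma batch_size_station: "batch_size \<omega> i k = fst (station \<omega> i k)"
  by (simp add: batch_size_def station_def)

lemma arrivals_station:
  "arrivals \<omega> i t u = (\<Sum>k | t < epoch (station \<omega> i) k \<and> epoch (station \<omega> i) k \<le> u. fst (station \<omega> i k))"
  by (simp add: arrivals_def batch_time_station batch_size_station)

lemma arrivals_from_0:
  assumes "regular (station \<omega> i)"
  shows "arrivals \<omega> i 0 u = total (station \<omega> i) u"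
proof -
  have "{k. 0 < epoch (station \<omega> i) k \<and> epoch (station \<omega> i) k \<le> u} = {..<count (station \<omega> i) u}"
    using epoch_pos[OF assms] epoch_le_iff_less_count[OF assms] by auto
  then show ?thesis by (simp add: arrivals_station total_def)
qed

lemma epoch_residual_at: "epoch (residual_at a u k) m = epoch a (k + m) - u"
  by (induction m) (simp_all add: epoch_def residual_at_def)

lemma station_shift: "station (shift \<omega> u) i = residual (station \<omega> i) u"
  by (simp add: shift_def)

lemma arrivals_shift:
  assumes r: "regular (station \<omega> i)" and t: "0 \<le> t"
  shows "arrivals (shift \<omega> u) i t v = arrivals \<omega> i (u + t) (u + v)"
proof -
  let ?a = "station \<omega> i"
  let ?K = "count ?a u"
  have e: "epoch (residual ?a u) j = epoch ?a (?K + j) - u" for j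
    by (simp add: residual_def epoch_residual_at)
  have f: "fst (residual ?a u j) = fst (?a (?K + j))" for j
    by (simp add: residual_def residual_at_def)
  have K: "?K \<le> k" if "u + t < epoch ?a k" for k
  proof -
    have "\<not> epoch ?a k \<le> u" using that t by linarith
    then show ?thesis using epoch_le_iff_less_count[OF r] by simp
  qed
  show ?thesis
    unfolding arrivals_station station_shift e f
    by (rule sum.reindex_bij_witness[where i="\<lambda>k. k - ?K" and j="\<lambda>j. ?K + j"]) (use K in auto)
qed

lemma nonneg_steps_shift: "nonneg_steps \<omega> \<Longrightarrow> nonneg_steps (shift \<omega> u)"
  by (simp add: nonneg_steps_def shift_def)

lemma poll_time_0[simp]: "poll_time N \<omega> z 0 = 0" and chain_0[simp]: "chain N \<omega> z 0 = z"
  by (simp_all add: poll_time_def chain_def)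

lemma poll_time_Suc:
  "poll_time N \<omega> z (Suc n) = poll_time N \<omega> z n +
     snd (\<omega> (if nonempty (chain N \<omega> z n) then After_Service n else After_Empty n))"
  by (simp add: poll_time_def chain_def nonempty_def split_beta' Let_def)

lemma chain_Suc:
  "chain N \<omega> z (Suc n) = (let c = chain N \<omega> z n; t = poll_time N \<omega> z n;
       q = \<omega> (if nonempty c then After_Service n else After_Empty n)
     in ((fst c + fst q) mod N, map (\<lambda>i. after_poll c i + arrivals \<omega> i t (t + snd q)) [0..<N]))"
  by (simp add: poll_time_def chain_def nonempty_def after_poll_def split_beta' Let_def)

lemma poll_time_mono: "nonneg_steps \<omega> \<Longrightarrow> m \<le> n \<Longrightarrow> poll_time N \<omega> z m \<le> poll_time N \<omega> z n"
  by (induction n rule: nat_induct)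
     (auto simp: poll_time_Suc nonneg_steps_def le_Suc_eq intro: order_trans add_increasing2)

lemma poll_time_nonneg: "nonneg_steps \<omega> \<Longrightarrow> 0 \<le> poll_time N \<omega> z n"
  using poll_time_mono[of \<omega> 0 n N z] by simp

lemma poll_time_1: "poll_time N \<omega> z (Suc 0) = snd (first_step (nonempty z) \<omega>)"
  by (simp add: poll_time_Suc first_step_def)

text \<open>
  The batches arriving in an interval after the first polling instant \<open>u\<close> are those that arrive, in
  the shifted scenario, in the interval moved back by \<open>u\<close>.
\<close>

lemma polling_shift:
  fixes N :: nat and z :: state
  assumes n: "nice \<omega>"
  defines "u \<equiv> poll_time N \<omega> z (Suc 0)"
  shows "poll_time N \<omega> z (Suc n) = u + poll_time N (shift \<omega> u) (chain N \<omega> z (Suc 0)) n \<and>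
    chain N \<omega> z (Suc n) = chain N (shift \<omega> u) (chain N \<omega> z (Suc 0)) n"
proof (induction n)
  case 0
  show ?case by (simp add: u_def)
next
  case (Suc n)
  have s: "nonneg_steps (shift \<omega> u)" using n by (simp add: nice_def nonneg_steps_shift)
  have a: "arrivals (shift \<omega> u) i t v = arrivals \<omega> i (u + t) (u + v)" if "0 \<le> t" for i t v
    using n that by (intro arrivals_shift) (auto simp: nice_def)
  have sh: "shift \<omega> u (After_Service n) = \<omega> (After_Service (Suc n))" "shift \<omega> u (After_Empty n) = \<omega> (After_Empty (Suc n))"
    by (simp_all add: shift_def)
  show ?case
    unfolding poll_time_Suc[of N \<omega> z "Suc n"] chain_Suc[of N \<omega> z "Suc n"]
      poll_time_Suc[of N "shift \<omega> u" _ n] chain_Suc[of N "shift \<omega> u" _ n] Let_def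
    using Suc poll_time_nonneg[OF s] by (simp add: a sh add.assoc)
qed

lemma chain_successor:
  assumes "nice \<omega>"
  shows "chain N \<omega> z (Suc 0) = successor N z (fst (first_step (nonempty z) \<omega>), totals N (station \<omega>) (snd (first_step (nonempty z) \<omega>)))"
  using assms
  by (simp add: chain_Suc successor_def first_step_def totals_def Let_def arrivals_from_0 nice_def)

lemma chain_in_states: "1 \<le> N \<Longrightarrow> z \<in> states N \<Longrightarrow> chain N \<omega> z n \<in> states N"
  by (cases n) (auto simp: states_def chain_Suc Let_def)

section \<open>Measurability of the sample paths\<close>

text \<open>
  The states are countable, and a sum over their codes can be interchanged with an outer integral by
  monotone convergence. Numbers that encode no element contribute \<open>0\<close>.
\<close>

lemma nn_integral_countable_range:
  fixes C :: "'w \<Rightarrow> 'a :: countable" and g :: "'a \<Rightarrow> ennreal"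
  assumes C: "C \<in> M \<rightarrow>\<^sub>M count_space UNIV"
  shows "(\<integral>\<^sup>+w. g (C w) \<partial>M) = (\<Sum>n. if to_nat (from_nat n :: 'a) = n then g (from_nat n) * emeasure M {w \<in> space M. C w = from_nat n} else 0)"
proof -
  let ?c = "\<lambda>n. from_nat n :: 'a"
  let ?e = "\<lambda>n. {w \<in> space M. C w = ?c n}"
  have e: "?e n \<in> sets M" for n
    using measurable_sets[OF C, of "{?c n}"] by (simp add: vimage_def Int_def conj_commute)
  have "(\<integral>\<^sup>+w. g (C w) \<partial>M) = (\<integral>\<^sup>+w. (\<Sum>n. if to_nat (?c n) = n then g (?c n) * indicator (?e n) w else 0) \<partial>M)"
  proof (rule nn_integral_cong)
    fix w assume "w \<in> space M"
    then show "g (C w) = (\<Sum>n. if to_nat (?c n) = n then g (?c n) * indicator (?e n) w else 0)"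
      by (subst suminf_single[of "to_nat (C w)"]) (auto simp: indicator_def)
  qed
  also have "\<dots> = (\<Sum>n. \<integral>\<^sup>+w. (if to_nat (?c n) = n then g (?c n) * indicator (?e n) w else 0) \<partial>M)"
    using e by (intro nn_integral_suminf) auto
  also have "\<dots> = (\<Sum>n. if to_nat (?c n) = n then g (?c n) * emeasure M (?e n) else 0)"
    using e by (intro suminf_cong) (auto simp: nn_integral_cmult)
  finally show ?thesis .
qed

lemma measurable_map_upt:
  assumes "\<And>i. i < N \<Longrightarrow> f i \<in> M \<rightarrow>\<^sub>M count_space UNIV"
  shows "(\<lambda>w. map (\<lambda>i. f i w :: nat) [0..<N]) \<in> M \<rightarrow>\<^sub>M count_space UNIV"
  using assms
proof (induction N)
  case (Suc N)
  have "(\<lambda>w. (\<lambda>l w. l @ [f N w]) (map (\<lambda>i. f i w) [0..<N]) w) \<in> M \<rightarrow>\<^sub>M count_space UNIV"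
  proof (rule measurable_compose_countable[where f="\<lambda>l w. l @ [f N w]" and g="\<lambda>w. map (\<lambda>i. f i w) [0..<N]"])
    fix l :: "nat list"
    show "(\<lambda>w. l @ [f N w]) \<in> M \<rightarrow>\<^sub>M count_space UNIV"
      by (rule measurable_compose[OF Suc.prems[of N]]) auto
    show "(\<lambda>w. map (\<lambda>i. f i w) [0..<N]) \<in> M \<rightarrow>\<^sub>M count_space UNIV"
      by (rule Suc.IH) (use Suc.prems in auto)
  qed
  then show ?case by simp
qed simp

context polling_model
begin

lemma measurable_batch_time[measurable]: "(\<lambda>\<omega>. batch_time \<omega> i k) \<in> borel_measurable \<Omega>"
  unfolding batch_time_def by measurable

lemma measurable_batch_size[measurable]: "(\<lambda>\<omega>. batch_size \<omega> i k) \<in> \<Omega> \<rightarrow>\<^sub>M count_space UNIV"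
  unfolding batch_size_def by measurable

text \<open>
  A sum over an infinite set is \<open>0\<close> by convention, so the number of arrivals in an interval is
  described by two cases: from some index on no batch falls into the interval, or infinitely many do.
\<close>

lemma measurable_arrivals:
  assumes [measurable]: "f \<in> borel_measurable \<Omega>" "g \<in> borel_measurable \<Omega>"
  shows "(\<lambda>\<omega>. arrivals \<omega> i (f \<omega>) (g \<omega>)) \<in> \<Omega> \<rightarrow>\<^sub>M count_space UNIV"
proof (rule measurable_count_space_eq2_countable[THEN iffD2], intro conjI ballI)
  fix c :: nat
  let ?P = "\<lambda>\<omega> k. f \<omega> < batch_time \<omega> i k \<and> batch_time \<omega> i k \<le> g \<omega>"
  have *: "arrivals \<omega> i (f \<omega>) (g \<omega>) = c \<longleftrightarrow>
      (\<exists>m. (\<forall>k\<in>{m..}. \<not> ?P \<omega> k) \<and> (\<Sum>k<m. if ?P \<omega> k then batch_size \<omega> i k else 0) = c)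
      \<or> ((\<forall>m. \<exists>k\<in>{m..}. ?P \<omega> k) \<and> c = 0)" for \<omega>
  proof (cases "\<exists>m. \<forall>k\<in>{m..}. \<not> ?P \<omega> k")
    case True
    have eq: "arrivals \<omega> i (f \<omega>) (g \<omega>) = (\<Sum>k<m. if ?P \<omega> k then batch_size \<omega> i k else 0)"
      if "\<forall>k\<in>{m..}. \<not> ?P \<omega> k" for m
    proof -
      have "{k. ?P \<omega> k} = {k\<in>{..<m}. ?P \<omega> k}"
        using that by (auto simp: not_le[symmetric])
      then show ?thesis
        by (simp add: arrivals_def sum.If_cases Int_def)
    qed
    with True show ?thesis by auto
  next
    case False
    have "infinite {k. ?P \<omega> k}"
    proof
      assume "finite {k. ?P \<omega> k}"
      then obtain b where "\<forall>k\<in>{k. ?P \<omega> k}. k < b" using finite_nat_set_iff_bounded by blast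
      then have "\<forall>k\<in>{b..}. \<not> ?P \<omega> k" by force
      with False show False by blast
    qed
    then have "arrivals \<omega> i (f \<omega>) (g \<omega>) = 0" by (simp add: arrivals_def)
    with False show ?thesis by auto
  qed
  have P: "Measurable.pred \<Omega> (\<lambda>\<omega>. ?P \<omega> k)" for k
    using borel_measurable_less[OF assms(1) measurable_batch_time[of i k]] borel_measurable_le[OF measurable_batch_time[of i k] assms(2)]
    by (intro pred_intros_logic) (simp_all only: pred_def)
  have S: "(\<lambda>\<omega>. \<Sum>k<m. if ?P \<omega> k then batch_size \<omega> i k else 0) \<in> \<Omega> \<rightarrow>\<^sub>M count_space UNIV" for m
  proof (induction m)
    case (Suc m)
    note [measurable] = Suc P
    show ?case unfolding sum.lessThan_Suc by measurable
  qed simp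
  have "(\<lambda>\<omega>. arrivals \<omega> i (f \<omega>) (g \<omega>)) -` {c} \<inter> space \<Omega> = {\<omega>\<in>space \<Omega>. arrivals \<omega> i (f \<omega>) (g \<omega>) = c}"
    by auto
  also have "\<dots> = {\<omega>\<in>space \<Omega>.
      (\<exists>m. (\<forall>k\<in>{m..}. \<not> ?P \<omega> k) \<and> (\<Sum>k<m. if ?P \<omega> k then batch_size \<omega> i k else 0) = c)
      \<or> ((\<forall>m. \<exists>k\<in>{m..}. ?P \<omega> k) \<and> c = 0)}"
    by (simp only: *)
  also have "\<dots> \<in> sets \<Omega>"
  proof -
    note [measurable] = P S
    show ?thesis by measurable
  qed
  finally show "(\<lambda>\<omega>. arrivals \<omega> i (f \<omega>) (g \<omega>)) -` {c} \<inter> space \<Omega> \<in> sets \<Omega>" .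
qed auto

lemma measurable_polling:
  "(\<lambda>\<omega>. poll_time N \<omega> z n) \<in> borel_measurable \<Omega> \<and> (\<lambda>\<omega>. chain N \<omega> z n) \<in> \<Omega> \<rightarrow>\<^sub>M count_space UNIV"
proof (induction n)
  case (Suc n)
  then have t[measurable]: "(\<lambda>\<omega>. poll_time N \<omega> z n) \<in> borel_measurable \<Omega>"
    and c: "(\<lambda>\<omega>. chain N \<omega> z n) \<in> \<Omega> \<rightarrow>\<^sub>M count_space UNIV" by auto
  let ?q = "\<lambda>c \<omega>. \<omega> (if nonempty c then After_Service n else After_Empty n)"
  have q[measurable]: "?q c \<in> \<Omega> \<rightarrow>\<^sub>M input_space" for c
    by measurable
  have 1: "(\<lambda>\<omega>. (\<lambda>c \<omega>. poll_time N \<omega> z n + snd (?q c \<omega>)) (chain N \<omega> z n) \<omega>) \<in> borel_measurable \<Omega>"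
    by (rule measurable_compose_countable[OF _ c]) measurable
  have 2: "(\<lambda>\<omega>. (\<lambda>c \<omega>. ((fst c + fst (?q c \<omega>)) mod N,
        map (\<lambda>i. after_poll c i + arrivals \<omega> i (poll_time N \<omega> z n) (poll_time N \<omega> z n + snd (?q c \<omega>))) [0..<N]))
      (chain N \<omega> z n) \<omega>) \<in> \<Omega> \<rightarrow>\<^sub>M count_space UNIV"
  proof (rule measurable_compose_countable[OF _ c])
    fix c :: state
    have d: "(\<lambda>\<omega>. fst (?q c \<omega>)) \<in> \<Omega> \<rightarrow>\<^sub>M count_space UNIV" by measurable
    have a: "(\<lambda>\<omega>. after_poll c i + arrivals \<omega> i (poll_time N \<omega> z n) (poll_time N \<omega> z n + snd (?q c \<omega>))) \<in> \<Omega> \<rightarrow>\<^sub>M count_space UNIV" for i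
      by (rule measurable_compose[OF measurable_arrivals]) measurable
    show "(\<lambda>\<omega>. ((fst c + fst (?q c \<omega>)) mod N,
        map (\<lambda>i. after_poll c i + arrivals \<omega> i (poll_time N \<omega> z n) (poll_time N \<omega> z n + snd (?q c \<omega>))) [0..<N])) \<in> \<Omega> \<rightarrow>\<^sub>M count_space UNIV"
    proof (rule measurable_compose_countable[OF _ d, where f="\<lambda>d \<omega>. ((fst c + d) mod N,
        map (\<lambda>i. after_poll c i + arrivals \<omega> i (poll_time N \<omega> z n) (poll_time N \<omega> z n + snd (?q c \<omega>))) [0..<N])"])
      fix d
      show "(\<lambda>\<omega>. ((fst c + d) mod N,
        map (\<lambda>i. after_poll c i + arrivals \<omega> i (poll_time N \<omega> z n) (poll_time N \<omega> z n + snd (?q c \<omega>))) [0..<N])) \<in> \<Omega> \<rightarrow>\<^sub>M count_space UNIV"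
        by (rule measurable_compose[OF measurable_map_upt[OF a]]) auto
    qed
  qed
  show ?case
    unfolding poll_time_Suc chain_Suc Let_def using 1 2 by (rule conjI)
qed auto

lemma measurable_poll_time[measurable]: "(\<lambda>\<omega>. poll_time N \<omega> z n) \<in> borel_measurable \<Omega>"
  and measurable_chain[measurable]: "(\<lambda>\<omega>. chain N \<omega> z n) \<in> \<Omega> \<rightarrow>\<^sub>M count_space UNIV"
  using measurable_polling by auto

lemma AE_nice: "AE \<omega> in \<Omega>. nice \<omega>"
proof -
  have 1: "AE \<omega> in \<Omega>. 0 \<le> snd (\<omega> (After_Service n))" for n
    unfolding \<Omega>_PiM
  proof (rule inp.AE_component)
    show "AE x in inputs (After_Service n). 0 \<le> snd x"
      using AE_step_nonneg[of True] unfolding step_def if_True if_False input_law.simps .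
  qed simp
  have 2: "AE \<omega> in \<Omega>. 0 \<le> snd (\<omega> (After_Empty n))" for n
    unfolding \<Omega>_PiM
  proof (rule inp.AE_component)
    show "AE x in inputs (After_Empty n). 0 \<le> snd x"
      using AE_step_nonneg[of False] unfolding step_def if_True if_False input_law.simps .
  qed simp
  have 3: "AE \<omega> in \<Omega>. regular (station \<omega> i)" for i
  proof -
    have "distr (PiM UNIV inputs) (\<Pi>\<^sub>M k\<in>UNIV. inputs (Arrival i k)) (\<lambda>\<omega>. \<lambda>k\<in>UNIV. \<omega> (Arrival i k)) = (\<Pi>\<^sub>M k\<in>UNIV. inputs (Arrival i k))"
      by (rule distr_PiM_reindex) (auto simp: prob_space_inputs inj_on_def simp del: input_law.simps)
    then have d: "distr \<Omega> station_law (\<lambda>\<omega>. station \<omega> i) = station_law"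
      unfolding \<Omega>_PiM inputs_Arrival by (simp add: station_def restrict_UNIV)
    have m: "(\<lambda>\<omega>. station \<omega> i) \<in> \<Omega> \<rightarrow>\<^sub>M station_law"
      unfolding measurable_cong_sets[OF refl sets_station_law]
      by (rule measurable_compose[OF measurable_stations measurable_station_component])
    show ?thesis
      by (rule AE_distrD[OF m]) (simp only: d AE_regular)
  qed
  have "AE \<omega> in \<Omega>. \<forall>i. regular (station \<omega> i)"
    using 3 by (rule AE_all_countable[THEN iffD2, OF allI])
  moreover have "AE \<omega> in \<Omega>. \<forall>n. 0 \<le> snd (\<omega> (After_Service n))"
    using 1 by (rule AE_all_countable[THEN iffD2, OF allI])
  moreover have "AE \<omega> in \<Omega>. \<forall>n. 0 \<le> snd (\<omega> (After_Empty n))"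
    using 2 by (rule AE_all_countable[THEN iffD2, OF allI])
  ultimately show ?thesis
    unfolding nice_def nonneg_steps_def by eventually_elim simp
qed

section \<open>The Markov chain and its return to the empty state\<close>

lemma markov:
  fixes F :: "state \<Rightarrow> scenario \<Rightarrow> ennreal"
  assumes F: "\<And>z. F z \<in> borel_measurable \<Omega>"
  shows "(\<integral>\<^sup>+\<omega>. F (chain N \<omega> z (Suc 0)) (shift \<omega> (poll_time N \<omega> z (Suc 0))) \<partial>\<Omega>)
    = (\<integral>\<^sup>+\<omega>. \<integral>\<^sup>+\<omega>'. F (chain N \<omega> z (Suc 0)) \<omega>' \<partial>\<Omega> \<partial>\<Omega>)"
proof -
  let ?h = "nonempty z"
  let ?C = "\<lambda>\<omega>. (fst (first_step ?h \<omega>), totals N (station \<omega>) (snd (first_step ?h \<omega>)))"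
  have "(\<integral>\<^sup>+\<omega>. F (chain N \<omega> z (Suc 0)) (shift \<omega> (poll_time N \<omega> z (Suc 0))) \<partial>\<Omega>)
    = (\<integral>\<^sup>+\<omega>. F (successor N z (?C \<omega>)) (shift \<omega> (snd (first_step ?h \<omega>))) \<partial>\<Omega>)"
    by (rule nn_integral_cong_AE, rule eventually_mono[OF AE_nice]) (simp add: chain_successor poll_time_1)
  also have "\<dots> = (\<integral>\<^sup>+\<omega>. \<integral>\<^sup>+\<omega>'. F (successor N z (?C \<omega>)) \<omega>' \<partial>\<Omega> \<partial>\<Omega>)"
    by (rule markov_first_step[of "\<lambda>c. F (successor N z c)"]) (rule F)
  also have "\<dots> = (\<integral>\<^sup>+\<omega>. \<integral>\<^sup>+\<omega>'. F (chain N \<omega> z (Suc 0)) \<omega>' \<partial>\<Omega> \<partial>\<Omega>)"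
    by (rule nn_integral_cong_AE, rule eventually_mono[OF AE_nice]) (simp add: chain_successor)
  finally show ?thesis .
qed

text \<open>
  The transition operator of the chain, acting on functions of the state.
\<close>

definition expect :: "(state \<Rightarrow> ennreal) \<Rightarrow> state \<Rightarrow> ennreal" where
  "expect f z = (\<integral>\<^sup>+\<omega>. f (chain N \<omega> z (Suc 0)) \<partial>\<Omega>)"

lemma measurable_of_chain[measurable]: "(\<lambda>\<omega>. f (chain N \<omega> z n)) \<in> borel_measurable \<Omega>"
  for f :: "state \<Rightarrow> ennreal"
  by (rule measurable_compose[OF measurable_chain]) simp

lemma expect_mono: "(\<And>z. f z \<le> g z) \<Longrightarrow> expect f z \<le> expect g z"
  unfolding expect_def by (intro nn_integral_mono)

lemma expect_Suc:
  "(\<integral>\<^sup>+\<omega>. f (chain N \<omega> z (Suc n)) \<partial>\<Omega>) = expect (\<lambda>z. \<integral>\<^sup>+\<omega>. f (chain N \<omega> z n) \<partial>\<Omega>) z"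
proof -
  have "(\<integral>\<^sup>+\<omega>. f (chain N \<omega> z (Suc n)) \<partial>\<Omega>)
    = (\<integral>\<^sup>+\<omega>. f (chain N (shift \<omega> (poll_time N \<omega> z (Suc 0))) (chain N \<omega> z (Suc 0)) n) \<partial>\<Omega>)"
    by (rule nn_integral_cong_AE, rule eventually_mono[OF AE_nice], rule arg_cong[where f=f], rule polling_shift[THEN conjunct2])
  also have "\<dots> = expect (\<lambda>z. \<integral>\<^sup>+\<omega>. f (chain N \<omega> z n) \<partial>\<Omega>) z"
    unfolding expect_def by (rule markov[of "\<lambda>z \<omega>. f (chain N \<omega> z n)"]) measurable
  finally show ?thesis .
qed

lemma emeasure_chain: "emeasure \<Omega> {\<omega>. chain N \<omega> z n = w} = (\<integral>\<^sup>+\<omega>. indicator {w} (chain N \<omega> z n) \<partial>\<Omega>)"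
proof -
  have "{\<omega>. chain N \<omega> z n = w} \<in> sets \<Omega>"
    using measurable_sets[OF measurable_chain[of z n], of "{w}"] by (simp add: vimage_def)
  then have "emeasure \<Omega> {\<omega>. chain N \<omega> z n = w} = (\<integral>\<^sup>+\<omega>. indicator {\<omega>. chain N \<omega> z n = w} \<omega> \<partial>\<Omega>)"
    by simp
  then show ?thesis by (simp add: indicator_def)
qed

lemma ennreal_trans_prob: "ennreal (trans_prob \<Omega> N n z w) = emeasure \<Omega> {\<omega>. chain N \<omega> z n = w}"
  by (simp add: trans_prob_def \<Omega>.emeasure_eq_measure)

lemma stationary_expect:
  assumes st: "stationary \<Omega> N \<pi>"
  shows "(\<integral>\<^sup>+z. expect f z \<partial>measure_pmf \<pi>) = (\<integral>\<^sup>+z. f z \<partial>measure_pmf \<pi>)"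
proof -
  have st: "set_pmf \<pi> \<subseteq> states N"
    and eq: "\<And>w. w \<in> states N \<Longrightarrow> pmf \<pi> w = measure_pmf.expectation \<pi> (\<lambda>y. trans_prob \<Omega> N 1 y w)"
    using st by (auto simp: stationary_def)
  have nn: "0 \<le> trans_prob \<Omega> N n y w" "trans_prob \<Omega> N n y w \<le> 1" for n y w
    by (simp_all add: trans_prob_def)
  have tp: "(\<integral>\<^sup>+z. ennreal (trans_prob \<Omega> N 1 z w) \<partial>measure_pmf \<pi>) = ennreal (pmf \<pi> w)" for w
  proof (cases "w \<in> states N")
    case True
    have "integrable (measure_pmf \<pi>) (\<lambda>y. trans_prob \<Omega> N 1 y w)"
      using nn by (intro measure_pmf.integrable_const_bound[where B=1]) auto
    then show ?thesis
      using nn by (simp add: nn_integral_eq_integral eq[OF True])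
  next
    case False
    have "trans_prob \<Omega> N 1 z w = 0" if "z \<in> set_pmf \<pi>" for z
    proof -
      have "{\<omega>. chain N \<omega> z 1 = w} = {}"
        using chain_in_states[OF N_pos, of z] that st False by auto
      then show ?thesis by (simp add: trans_prob_def)
    qed
    then have "(\<integral>\<^sup>+z. ennreal (trans_prob \<Omega> N 1 z w) \<partial>measure_pmf \<pi>) = (\<integral>\<^sup>+z. 0 \<partial>measure_pmf \<pi>)"
      by (intro nn_integral_cong_AE AE_pmfI) simp
    then show ?thesis using False st by (auto simp: pmf_eq_0_set_pmf)
  qed
  let ?c = "\<lambda>n. from_nat n :: state"
  have "(\<integral>\<^sup>+z. expect f z \<partial>measure_pmf \<pi>)
    = (\<integral>\<^sup>+z. (\<Sum>n. if to_nat (?c n) = n then f (?c n) * ennreal (trans_prob \<Omega> N 1 z (?c n)) else 0) \<partial>measure_pmf \<pi>)"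
    unfolding expect_def nn_integral_countable_range[OF measurable_chain]
    by (intro nn_integral_cong suminf_cong) (auto simp: ennreal_trans_prob)
  also have "\<dots> = (\<Sum>n. \<integral>\<^sup>+z. (if to_nat (?c n) = n then f (?c n) * ennreal (trans_prob \<Omega> N 1 z (?c n)) else 0) \<partial>measure_pmf \<pi>)"
    by (rule nn_integral_suminf) simp
  also have "\<dots> = (\<Sum>n. if to_nat (?c n) = n then f (?c n) * ennreal (pmf \<pi> (?c n)) else 0)"
    by (intro suminf_cong) (auto simp: nn_integral_cmult tp[simplified])
  also have "\<dots> = (\<integral>\<^sup>+z. f z \<partial>measure_pmf \<pi>)"
    using nn_integral_countable_range[of "\<lambda>z. z" "measure_pmf \<pi>" f]
    by (auto intro!: suminf_cong simp: emeasure_pmf_single)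
  finally show ?thesis .
qed

lemma stationary_expect_iter:
  assumes st: "stationary \<Omega> N \<pi>"
  shows "(\<integral>\<^sup>+z. \<integral>\<^sup>+\<omega>. f (chain N \<omega> z n) \<partial>\<Omega> \<partial>measure_pmf \<pi>) = (\<integral>\<^sup>+z. f z \<partial>measure_pmf \<pi>)"
proof (induction n)
  case 0
  show ?case using \<Omega>.emeasure_space_1 by simp
next
  case (Suc n)
  then show ?case
    unfolding expect_Suc stationary_expect[OF st] .
qed

text \<open>
  Some state has positive mass, and \<open>w\<close> is reached from it with positive probability.
\<close>

lemma stationary_pos:
  assumes st: "stationary \<Omega> N \<pi>" and irr: "irreducible_chain \<Omega> N" and w: "w \<in> states N"
  shows "0 < pmf \<pi> w"
proof -
  obtain z where z: "z \<in> set_pmf \<pi>" using set_pmf_not_empty[of \<pi>] by blast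
  then have "z \<in> states N" using st by (auto simp: stationary_def)
  with irr w obtain n where n: "0 < trans_prob \<Omega> N n z w"
    unfolding irreducible_chain_def by blast
  have "0 < ennreal (trans_prob \<Omega> N n z w) * ennreal (pmf \<pi> z)"
    using n z by (simp add: ennreal_zero_less_mult_iff pmf_positive)
  also have "\<dots> = (\<integral>\<^sup>+y. ennreal (trans_prob \<Omega> N n z w) * indicator {z} y \<partial>measure_pmf \<pi>)"
    by (simp add: nn_integral_cmult emeasure_pmf_single)
  also have "\<dots> \<le> (\<integral>\<^sup>+y. \<integral>\<^sup>+\<omega>. indicator {w} (chain N \<omega> y n) \<partial>\<Omega> \<partial>measure_pmf \<pi>)"
    unfolding emeasure_chain[symmetric] ennreal_trans_prob[symmetric]
    by (intro nn_integral_mono) (simp add: indicator_def)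
  also have "\<dots> = ennreal (pmf \<pi> w)"
    unfolding stationary_expect_iter[OF st] by (simp add: emeasure_pmf_single)
  finally show ?thesis by simp
qed

text \<open>
  The value at \<open>w\<close>, weighted by the probability of moving from \<open>y\<close> to \<open>w\<close> in \<open>n\<close> steps, is at most the
  mean of \<open>f\<close> after \<open>n\<close> steps, which is \<open>f y\<close>.
\<close>

lemma harmonic_zero:
  assumes irr: "irreducible_chain \<Omega> N" and h: "\<And>z. z \<in> states N \<Longrightarrow> expect f z = f z"
    and y: "y \<in> states N" "f y = 0" and w: "w \<in> states N"
  shows "f w = 0"
proof -
  obtain n where n: "0 < trans_prob \<Omega> N n y w"
    using irr y w unfolding irreducible_chain_def by blast
  have it: "(\<integral>\<^sup>+\<omega>. f (chain N \<omega> z m) \<partial>\<Omega>) = f z" if "z \<in> states N" for z m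
    using that
  proof (induction m arbitrary: z)
    case 0
    show ?case using \<Omega>.emeasure_space_1 by simp
  next
    case (Suc m)
    have "expect (\<lambda>z. \<integral>\<^sup>+\<omega>. f (chain N \<omega> z m) \<partial>\<Omega>) z = expect f z"
      unfolding expect_def
      by (intro nn_integral_cong Suc.IH chain_in_states[OF N_pos] Suc.prems)
    then show ?case using h[OF Suc.prems] by (simp only: expect_Suc)
  qed
  have "f w * ennreal (trans_prob \<Omega> N n y w) = (\<integral>\<^sup>+\<omega>. f w * indicator {w} (chain N \<omega> y n) \<partial>\<Omega>)"
    unfolding ennreal_trans_prob emeasure_chain by (rule nn_integral_cmult[symmetric]) measurable
  also have "\<dots> \<le> (\<integral>\<^sup>+\<omega>. f (chain N \<omega> y n) \<partial>\<Omega>)"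
    by (intro nn_integral_mono) (simp add: indicator_def)
  also have "\<dots> = 0" using it y by simp
  finally show ?thesis using n by simp
qed

text \<open>
  A customer present at time \<open>0\<close> has been taken by the time this state is met, whence its role as
  reference state for the service of all customers.
\<close>

definition empty_state :: state where "empty_state = (0, replicate N 0)"

lemma empty_state_in_states: "empty_state \<in> states N"
  using N_pos by (simp add: empty_state_def states_def)

text \<open>
  The probability that the chain does not meet the empty state during the first \<open>n\<close> steps after time \<open>0\<close>.
\<close>

primrec avoid :: "nat \<Rightarrow> state \<Rightarrow> ennreal" where
  "avoid 0 z = 1"
| "avoid (Suc n) z = expect (\<lambda>y. if y = empty_state then 0 else avoid n y) z"

lemma expect_le_1: "(\<And>y. f y \<le> 1) \<Longrightarrow> expect f z \<le> 1"
  unfolding expect_def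
  by (rule order_trans[OF nn_integral_mono[of _ _ "\<lambda>_. 1"]]) (use \<Omega>.emeasure_space_1 in auto)

lemma avoid_le_1: "avoid n z \<le> 1"
  by (induction n arbitrary: z) (auto intro!: expect_le_1)

lemma avoid_decseq: "avoid (Suc n) z \<le> avoid n z"
proof (induction n arbitrary: z)
  case 0
  show ?case using avoid_le_1[of "Suc 0" z] by simp
next
  case (Suc n)
  have "avoid (Suc (Suc n)) z = expect (\<lambda>y. if y = empty_state then 0 else avoid (Suc n) y) z" by simp
  also have "\<dots> \<le> expect (\<lambda>y. if y = empty_state then 0 else avoid n y) z"
    by (rule expect_mono) (use Suc in auto)
  finally show ?case by simp
qed

text \<open>
  The limit \<open>v\<close> is the probability of never meeting the empty state after time \<open>0\<close>, so \<open>v\<close> is the image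
  under \<open>expect\<close> of \<open>v\<close> with the value at the empty state replaced by \<open>0\<close>. Integrating against the
  stationary law shows that this value is \<open>0\<close>; then \<open>v\<close> is harmonic and \<open>harmonic_zero\<close> applies.
\<close>

lemma avoid_limit:
  assumes st: "stationary \<Omega> N \<pi>" and irr: "irreducible_chain \<Omega> N" and z: "z \<in> states N"
  shows "(\<lambda>n. avoid n z) \<longlonglongrightarrow> 0"
proof -
  define v where "v z = (INF n. avoid n z)" for z
  have dec: "decseq (\<lambda>n. avoid n z)" for z
    using avoid_decseq by (simp add: decseq_Suc_iff)
  have lim: "(\<lambda>n. avoid n z) \<longlonglongrightarrow> v z" for z
    unfolding v_def by (rule LIMSEQ_INF[OF dec])
  have v1: "v z \<le> 1" for z
    unfolding v_def by (rule order_trans[OF INF_lower[of 0]]) auto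
  have rec: "v z = expect (\<lambda>y. if y = empty_state then 0 else v y) z" for z
  proof -
    have "expect (\<lambda>y. if y = empty_state then 0 else v y) z
      = (\<integral>\<^sup>+\<omega>. (INF n. if chain N \<omega> z (Suc 0) = empty_state then 0 else avoid n (chain N \<omega> z (Suc 0))) \<partial>\<Omega>)"
      unfolding expect_def v_def by (intro nn_integral_cong) auto
    also have "\<dots> = (INF n. \<integral>\<^sup>+\<omega>. (if chain N \<omega> z (Suc 0) = empty_state then 0 else avoid n (chain N \<omega> z (Suc 0))) \<partial>\<Omega>)"
    proof (rule nn_integral_monotone_convergence_INF_decseq)
      show "decseq (\<lambda>n \<omega>. if chain N \<omega> z (Suc 0) = empty_state then 0 else avoid n (chain N \<omega> z (Suc 0)))"
        by (intro decseq_SucI le_funI) (use avoid_decseq in auto)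
      show "(\<lambda>\<omega>. if chain N \<omega> z (Suc 0) = empty_state then 0 else avoid n (chain N \<omega> z (Suc 0))) \<in> borel_measurable \<Omega>" for n
        by (rule measurable_of_chain[of "\<lambda>y. if y = empty_state then 0 else avoid n y"])
      have "(\<integral>\<^sup>+\<omega>. (if chain N \<omega> z (Suc 0) = empty_state then 0 else avoid 0 (chain N \<omega> z (Suc 0))) \<partial>\<Omega>) \<le> 1"
        using avoid_le_1[of "Suc 0" z] by (simp add: expect_def)
      then show "(\<integral>\<^sup>+\<omega>. (if chain N \<omega> z (Suc 0) = empty_state then 0 else avoid 0 (chain N \<omega> z (Suc 0))) \<partial>\<Omega>) < \<infinity>"
        by (rule le_less_trans) simp
    qed
    also have "\<dots> = (INF n. avoid (Suc n) z)"
      by (simp add: expect_def)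
    also have "\<dots> = v z"
      by (rule LIMSEQ_unique[OF LIMSEQ_INF LIMSEQ_Suc[OF lim]]) (intro decseq_SucI avoid_decseq)
    finally show ?thesis ..
  qed
  \<comment> \<open>The two integrals differ by the mass \<open>v empty_state * pmf \<pi> empty_state\<close>, and both are finite.\<close>
  have "(\<integral>\<^sup>+z. v z \<partial>measure_pmf \<pi>) = (\<integral>\<^sup>+z. (if z = empty_state then 0 else v z) \<partial>measure_pmf \<pi>)"
    by (subst rec) (rule stationary_expect[OF st])
  moreover have "(\<integral>\<^sup>+z. v z \<partial>measure_pmf \<pi>)
      = (\<integral>\<^sup>+z. (if z = empty_state then 0 else v z) + v empty_state * indicator {empty_state} z \<partial>measure_pmf \<pi>)"
    by (intro nn_integral_cong) auto
  moreover have "\<dots> = (\<integral>\<^sup>+z. (if z = empty_state then 0 else v z) \<partial>measure_pmf \<pi>) + v empty_state * ennreal (pmf \<pi> empty_state)"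
    by (subst nn_integral_add) (auto simp: nn_integral_cmult emeasure_pmf_single)
  moreover have "(\<integral>\<^sup>+z. (if z = empty_state then 0 else v z) \<partial>measure_pmf \<pi>) \<noteq> \<infinity>"
  proof -
    have "(\<integral>\<^sup>+z. (if z = empty_state then 0 else v z) \<partial>measure_pmf \<pi>) \<le> (\<integral>\<^sup>+z. 1 \<partial>measure_pmf \<pi>)"
      by (intro nn_integral_mono) (use v1 in auto)
    then show ?thesis by (auto simp: top_unique)
  qed
  ultimately have "(\<integral>\<^sup>+z. (if z = empty_state then 0 else v z) \<partial>measure_pmf \<pi>) + v empty_state * ennreal (pmf \<pi> empty_state)
      = (\<integral>\<^sup>+z. (if z = empty_state then 0 else v z) \<partial>measure_pmf \<pi>) + 0"
    and "(\<integral>\<^sup>+z. (if z = empty_state then 0 else v z) \<partial>measure_pmf \<pi>) \<noteq> \<infinity>"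
    by (metis add.right_neutral, blast)
  then have "v empty_state * ennreal (pmf \<pi> empty_state) = 0"
    unfolding ennreal_add_left_cancel infinity_ennreal_def by blast
  then have v0: "v empty_state = 0"
    using stationary_pos[OF st irr empty_state_in_states] by (simp add: ennreal_eq_0_iff)
  have "expect v z = v z" for z
  proof -
    have "(\<lambda>y. if y = empty_state then 0 else v y) = v" using v0 by auto
    then show ?thesis using rec[of z] by simp
  qed
  from harmonic_zero[OF irr this empty_state_in_states v0 z] lim[of z] show ?thesis by simp
qed

end

section \<open>Remaining waiting times\<close>

lemma INF_nat_split: "(INF n. g n) = min (g 0) (INF n. g (Suc n))" for g :: "nat \<Rightarrow> ennreal"
proof -
  have "range g = insert (g 0) (range (\<lambda>n. g (Suc n)))"
    by (auto simp: image_iff) (metis not0_implies_Suc)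
  then show ?thesis by (simp add: inf_min)
qed

lemma INF_set_if: "(INF n\<in>S. f n) = (INF n. if n \<in> S then f n else \<infinity>)" for f :: "'a \<Rightarrow> ennreal"
proof (rule antisym)
  show "(INF n\<in>S. f n) \<le> (INF n. if n \<in> S then f n else \<infinity>)"
    by (rule INF_greatest) (simp add: INF_lower)
  show "(INF n. if n \<in> S then f n else \<infinity>) \<le> (INF n\<in>S. f n)"
  proof (rule INF_greatest)
    fix n assume n: "n \<in> S"
    have "(INF n. if n \<in> S then f n else \<infinity>) \<le> (if n \<in> S then f n else \<infinity>)"
      by (rule INF_lower) simp
    then show "(INF n. if n \<in> S then f n else \<infinity>) \<le> f n"
      by (simp only: n if_True)
  qed
qed

definition head :: "state \<Rightarrow> nat \<Rightarrow> nat" where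
  "head z i = (if fst z = i \<and> nonempty z then 1 else 0)"

text \<open>
  At the \<open>n\<close>-th polling instant the customer is taken who has \<open>j\<close> customers of station \<open>i\<close> in front of it.
\<close>

definition served :: "nat \<Rightarrow> state \<Rightarrow> scenario \<Rightarrow> nat \<Rightarrow> nat \<Rightarrow> nat \<Rightarrow> bool" where
  "served N z \<omega> i j n \<longleftrightarrow> service_at N \<omega> z i n \<and> card {m. m < n \<and> service_at N \<omega> z i m} = j"

text \<open>
  The time until the customer with \<open>j\<close> customers of station \<open>i\<close> in front of it is taken, \<open>\<infinity>\<close> if never.
\<close>

definition rest :: "nat \<Rightarrow> state \<Rightarrow> scenario \<Rightarrow> nat \<Rightarrow> nat \<Rightarrow> ennreal" where
  "rest N z \<omega> i j = (INF n. if served N z \<omega> i j n then ennreal (poll_time N \<omega> z n) else \<infinity>)"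

text \<open>
  The remaining waiting time stopped at the \<open>n\<close>-th polling instant. Its means are finite, which allows
  the subtractions in Little's law.
\<close>

definition truncated :: "nat \<Rightarrow> nat \<Rightarrow> state \<Rightarrow> scenario \<Rightarrow> nat \<Rightarrow> nat \<Rightarrow> ennreal" where
  "truncated N n z \<omega> i j =
     (INF m. if m = n \<or> m < n \<and> served N z \<omega> i j m then ennreal (poll_time N \<omega> z m) else \<infinity>)"

lemma service_at_chain: "service_at N \<omega> z i n \<longleftrightarrow> fst (chain N \<omega> z n) = i \<and> nonempty (chain N \<omega> z n)"
  by (auto simp: service_at_def nonempty_def split_beta')

lemma service_at_0: "service_at N \<omega> z i 0 \<longleftrightarrow> head z i = 1"
  by (simp add: service_at_chain head_def)

lemma after_poll_head: "fst z < N \<Longrightarrow> snd z ! i = after_poll z i + head z i"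
  by (auto simp: after_poll_def head_def nonempty_def)

lemma served_0: "served N z \<omega> i j 0 \<longleftrightarrow> head z i = 1 \<and> j = 0"
  by (auto simp: served_def service_at_0)

abbreviation next_scenario :: "nat \<Rightarrow> state \<Rightarrow> scenario \<Rightarrow> scenario" where
  "next_scenario N z \<omega> \<equiv> shift \<omega> (poll_time N \<omega> z (Suc 0))"

abbreviation next_state :: "nat \<Rightarrow> state \<Rightarrow> scenario \<Rightarrow> state" where
  "next_state N z \<omega> \<equiv> chain N \<omega> z (Suc 0)"

lemma poll_time_shift:
  "nice \<omega> \<Longrightarrow> poll_time N \<omega> z (Suc n) = poll_time N \<omega> z (Suc 0) + poll_time N (next_scenario N z \<omega>) (next_state N z \<omega>) n"
  using polling_shift[of \<omega> N z n] by blast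

lemma service_at_shift:
  "nice \<omega> \<Longrightarrow> service_at N \<omega> z i (Suc n) \<longleftrightarrow> service_at N (next_scenario N z \<omega>) (next_state N z \<omega>) i n"
  using polling_shift[of \<omega> N z n] by (simp add: service_at_chain)

lemma card_service_shift:
  assumes "nice \<omega>"
  shows "card {m. m < Suc n \<and> service_at N \<omega> z i m}
    = head z i + card {m. m < n \<and> service_at N (next_scenario N z \<omega>) (next_state N z \<omega>) i m}"
proof -
  have e: "{m. m < Suc n \<and> service_at N \<omega> z i m} = {m. m = 0 \<and> service_at N \<omega> z i m} \<union>
      Suc ` {m. m < n \<and> service_at N (next_scenario N z \<omega>) (next_state N z \<omega>) i m}"
    unfolding set_eq_iff
  proof
    fix m show "m \<in> {m. m < Suc n \<and> service_at N \<omega> z i m} \<longleftrightarrow> m \<in> {m. m = 0 \<and> service_at N \<omega> z i m} \<union>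
      Suc ` {m. m < n \<and> service_at N (next_scenario N z \<omega>) (next_state N z \<omega>) i m}"
      using service_at_shift[OF assms] by (cases m) auto
  qed
  have "card {m. m = 0 \<and> service_at N \<omega> z i m} = head z i"
  proof (cases "head z i = 1")
    case True
    then have "{m. m = 0 \<and> service_at N \<omega> z i m} = {0}" using service_at_0[of N \<omega> z i] by auto
    then show ?thesis using True by simp
  next
    case False
    then have "{m. m = 0 \<and> service_at N \<omega> z i m} = {}" using service_at_0[of N \<omega> z i] by auto
    then have "card {m. m = 0 \<and> service_at N \<omega> z i m} = 0" by (simp only: card.empty)
    moreover have "head z i = 0" using False by (simp add: head_def split: if_splits)
    ultimately show ?thesis by simp
  qed
  then show ?thesis
    unfolding e by (subst card_Un_disjoint) (auto simp: card_image)
qed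

lemma served_shift:
  assumes "nice \<omega>"
  shows "served N z \<omega> i (head z i + j) (Suc n) \<longleftrightarrow> served N (next_state N z \<omega>) (next_scenario N z \<omega>) i j n"
    and "served N z \<omega> i j (Suc n) \<Longrightarrow> head z i \<le> j"
  by (simp_all only: served_def service_at_shift[OF assms] card_service_shift[OF assms] served_def add_left_cancel)
     auto

context
  fixes N :: nat and z :: state and \<omega> :: scenario and i :: nat
  assumes nice: "nice \<omega>"
begin

lemma served_shift': "served N z \<omega> i (head z i + j) (Suc n) \<longleftrightarrow> served N (next_state N z \<omega>) (next_scenario N z \<omega>) i j n"
  by (rule served_shift(1)[OF nice])

lemma ennreal_poll_time_shift:
  "ennreal (poll_time N \<omega> z (Suc n)) = ennreal (poll_time N \<omega> z (Suc 0)) +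
     ennreal (poll_time N (next_scenario N z \<omega>) (next_state N z \<omega>) n)"
  using nice unfolding poll_time_shift[OF nice, of N z n]
  by (intro ennreal_plus poll_time_nonneg nonneg_steps_shift) (auto simp: nice_def)

lemma truncated_0: "truncated N 0 z \<omega> i j = 0"
  unfolding truncated_def by (rule antisym) (auto intro: INF_lower2[of 0])

lemma truncated_served_now:
  "head z i = 1 \<Longrightarrow> truncated N (Suc n) z \<omega> i 0 = 0"
proof -
  assume h: "head z i = 1"
  have "truncated N (Suc n) z \<omega> i 0 \<le> (if 0 = Suc n \<or> 0 < Suc n \<and> served N z \<omega> i 0 0 then ennreal (poll_time N \<omega> z 0) else \<infinity>)"
    unfolding truncated_def by (rule INF_lower) simp
  also have "\<dots> = 0" using h by (simp add: served_0)
  finally show ?thesis by simp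
qed

text \<open>
  A customer who is not taken at time \<open>0\<close> waits for the first step and then, having lost one customer in
  front of it if its own station was served, for its remaining time in the shifted scenario.
\<close>

lemma truncated_shift:
  assumes "\<not> (head z i = 1 \<and> head z i + j = 0)"
  shows "truncated N (Suc n) z \<omega> i (head z i + j) =
    ennreal (poll_time N \<omega> z (Suc 0)) + truncated N n (next_state N z \<omega>) (next_scenario N z \<omega>) i j"
proof -
  have "truncated N (Suc n) z \<omega> i (head z i + j) =
    (INF m. if Suc m = Suc n \<or> Suc m < Suc n \<and> served N z \<omega> i (head z i + j) (Suc m) then ennreal (poll_time N \<omega> z (Suc m)) else \<infinity>)"
    unfolding truncated_def by (subst INF_nat_split) (use assms in \<open>auto simp: served_0\<close>)
  also have "\<dots> = (INF m. ennreal (poll_time N \<omega> z (Suc 0)) + (if m = n \<or> m < n \<and> served N (next_state N z \<omega>) (next_scenario N z \<omega>) i j m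
      then ennreal (poll_time N (next_scenario N z \<omega>) (next_state N z \<omega>) m) else \<infinity>))"
  proof (intro INF_cong refl)
    fix m
    show "(if Suc m = Suc n \<or> Suc m < Suc n \<and> served N z \<omega> i (head z i + j) (Suc m) then ennreal (poll_time N \<omega> z (Suc m)) else \<infinity>)
      = ennreal (poll_time N \<omega> z (Suc 0)) + (if m = n \<or> m < n \<and> served N (next_state N z \<omega>) (next_scenario N z \<omega>) i j m
      then ennreal (poll_time N (next_scenario N z \<omega>) (next_state N z \<omega>) m) else \<infinity>)"
      unfolding served_shift'[of j m] ennreal_poll_time_shift[of m] by auto
  qed
  also have "\<dots> = ennreal (poll_time N \<omega> z (Suc 0)) + truncated N n (next_state N z \<omega>) (next_scenario N z \<omega>) i j"
    unfolding truncated_def by (rule INF_ennreal_const_add)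
  finally show ?thesis .
qed

lemma truncated_mono: "truncated N n z \<omega> i j \<le> truncated N (Suc n) z \<omega> i j"
  unfolding truncated_def
proof (rule INF_greatest)
  fix m
  have nn: "nonneg_steps \<omega>" using nice by (simp add: nice_def)
  let ?f = "\<lambda>n m. if m = n \<or> m < n \<and> served N z \<omega> i j m then ennreal (poll_time N \<omega> z m) else \<infinity>"
  show "(INF m. ?f n m) \<le> ?f (Suc n) m"
  proof (cases "m < n \<and> served N z \<omega> i j m")
    case True
    then show ?thesis by (intro INF_lower2[of m]) auto
  next
    case False
    show ?thesis
    proof (cases "m = Suc n \<or> m = n \<and> served N z \<omega> i j m")
      case True
      then have "n \<le> m" by auto
      with True show ?thesis
        using poll_time_mono[OF nn \<open>n \<le> m\<close>, of N z] by (intro INF_lower2[of n]) (auto intro: ennreal_leI)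
    next
      case False
      with \<open>\<not> (m < n \<and> served N z \<omega> i j m)\<close> have "?f (Suc n) m = \<infinity>" by (auto simp: less_Suc_eq)
      then show ?thesis by simp
    qed
  qed
qed

lemma truncated_le_rest: "truncated N n z \<omega> i j \<le> rest N z \<omega> i j"
  unfolding rest_def
proof (rule INF_greatest)
  fix m
  have nn: "nonneg_steps \<omega>" using nice by (simp add: nice_def)
  show "truncated N n z \<omega> i j \<le> (if served N z \<omega> i j m then ennreal (poll_time N \<omega> z m) else \<infinity>)"
  proof (cases "served N z \<omega> i j m")
    case True
    show ?thesis
    proof (cases "m < n")
      case True
      then show ?thesis using \<open>served N z \<omega> i j m\<close>
        unfolding truncated_def by (intro INF_lower2[of m]) auto
    next
      case False
      then have "n \<le> m" by simp
      then show ?thesis using \<open>served N z \<omega> i j m\<close> poll_time_mono[OF nn \<open>n \<le> m\<close>, of N z]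
        unfolding truncated_def by (intro INF_lower2[of n]) (auto intro: ennreal_leI)
    qed
  qed simp
qed

lemma rest_le_truncated:
  assumes "served N z \<omega> i j m" "m < n"
  shows "rest N z \<omega> i j \<le> truncated N n z \<omega> i j"
  unfolding truncated_def
proof (rule INF_greatest)
  fix k
  have nn: "nonneg_steps \<omega>" using nice by (simp add: nice_def)
  show "rest N z \<omega> i j \<le> (if k = n \<or> k < n \<and> served N z \<omega> i j k then ennreal (poll_time N \<omega> z k) else \<infinity>)"
  proof (cases "served N z \<omega> i j k")
    case True
    then show ?thesis unfolding rest_def by (intro INF_lower2[of k]) auto
  next
    case False
    have "rest N z \<omega> i j \<le> ennreal (poll_time N \<omega> z m)"
      unfolding rest_def using assms by (intro INF_lower2[of m]) auto
    also have "\<dots> \<le> ennreal (poll_time N \<omega> z n)"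
      using poll_time_mono[OF nn less_imp_le[OF assms(2)], of N z] by (rule ennreal_leI)
    finally show ?thesis using False by auto
  qed
qed

lemma truncated_limit:
  assumes "served N z \<omega> i j m"
  shows "(\<lambda>n. truncated N n z \<omega> i j) \<longlonglongrightarrow> rest N z \<omega> i j"
proof (rule tendsto_eventually, rule eventually_sequentiallyI[of "Suc m"])
  fix n assume "Suc m \<le> n"
  then show "truncated N n z \<omega> i j = rest N z \<omega> i j"
    using rest_le_truncated[OF assms, of n] truncated_le_rest[of n j] by (intro antisym) auto
qed

text \<open>
  A customer arriving during the first step waits until the next polling instant, and is then one of
  the present customers: in front of it are those left behind by the poll, those of the
  earlier batches and the first ones of its own batch.
\<close>

lemma waiting_time_rest:
  assumes z: "fst z < N" and b: "batch_time \<omega> i k \<le> poll_time N \<omega> z (Suc 0)"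
  shows "waiting_time N ((z, \<omega>), (i, k, r)) = ennreal (poll_time N \<omega> z (Suc 0) - batch_time \<omega> i k) +
    rest N (next_state N z \<omega>) (next_scenario N z \<omega>) i (after_poll z i + ((\<Sum>j<k. batch_size \<omega> i j) + r))"
proof -
  let ?q = "after_poll z i + ((\<Sum>j<k. batch_size \<omega> i j) + r)"
  let ?b = "batch_time \<omega> i k"
  have "waiting_time N ((z, \<omega>), (i, k, r)) = (INF n\<in>{n. served N z \<omega> i (head z i + ?q) n}. ennreal (poll_time N \<omega> z n - ?b))"
    by (simp add: served_def after_poll_head[OF z] ac_simps)
  also have "\<dots> = (INF n. if served N z \<omega> i (head z i + ?q) n then ennreal (poll_time N \<omega> z n - ?b) else \<infinity>)"
    by (subst INF_set_if) simp
  also have "\<dots> = (INF n. if served N z \<omega> i (head z i + ?q) (Suc n) then ennreal (poll_time N \<omega> z (Suc n) - ?b) else \<infinity>)"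
  proof -
    have *: "\<not> served N z \<omega> i (head z i + ?q) 0" by (auto simp: served_0)
    show ?thesis
      by (subst INF_nat_split) (simp only: * if_False infinity_ennreal_def, rule min_absorb2, rule top_greatest)
  qed
  also have "\<dots> = (INF n. ennreal (poll_time N \<omega> z (Suc 0) - ?b) + (if served N (next_state N z \<omega>) (next_scenario N z \<omega>) i ?q n
       then ennreal (poll_time N (next_scenario N z \<omega>) (next_state N z \<omega>) n) else \<infinity>))"
  proof (intro INF_cong refl)
    fix n
    have "ennreal (poll_time N \<omega> z (Suc n) - ?b) = ennreal (poll_time N \<omega> z (Suc 0) - ?b) + ennreal (poll_time N (next_scenario N z \<omega>) (next_state N z \<omega>) n)"
      using nice b poll_time_nonneg[OF nonneg_steps_shift, of \<omega>] unfolding poll_time_shift[OF nice, of N z n]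
      by (subst ennreal_plus[symmetric]) (auto simp: nice_def algebra_simps)
    then show "(if served N z \<omega> i (head z i + ?q) (Suc n) then ennreal (poll_time N \<omega> z (Suc n) - ?b) else \<infinity>)
      = ennreal (poll_time N \<omega> z (Suc 0) - ?b) + (if served N (next_state N z \<omega>) (next_scenario N z \<omega>) i ?q n
       then ennreal (poll_time N (next_scenario N z \<omega>) (next_state N z \<omega>) n) else \<infinity>)"
      unfolding served_shift'[of ?q n] by simp
  qed
  also have "\<dots> = ennreal (poll_time N \<omega> z (Suc 0) - ?b) + rest N (next_state N z \<omega>) (next_scenario N z \<omega>) i ?q"
    unfolding rest_def by (rule INF_ennreal_const_add)
  finally show ?thesis .
qed

end

lemma interval_moment_nn_integral:
  fixes N :: nat and p :: "nat pmf" and H :: "nat \<Rightarrow> real measure"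
  assumes prob: "\<And>d. prob_space (H d)" and sets: "\<And>d. sets (H d) = sets borel" and nn: "\<And>d. AE t in H d. 0 \<le> t"
    and sq: "\<And>d. d \<in> set_pmf p \<Longrightarrow> integrable (H d) (\<lambda>t. t\<^sup>2)" and m: "m \<in> {1, 2}"
  shows "(\<Sum>d=1..N. ennreal (pmf p d) * (\<integral>\<^sup>+t. ennreal (t ^ m) \<partial>H d)) = ennreal (interval_moment N p H m)"
    and "0 \<le> interval_moment N p H m"
proof -
  have pos: "0 \<le> (\<integral>t. t ^ m \<partial>H d)" for d
    by (rule integral_nonneg_AE, rule eventually_mono[OF nn]) simp
  then show "0 \<le> interval_moment N p H m"
    unfolding interval_moment_def by (intro sum_nonneg mult_nonneg_nonneg) auto
  have "ennreal (pmf p d) * (\<integral>\<^sup>+t. ennreal (t ^ m) \<partial>H d) = ennreal (pmf p d * (\<integral>t. t ^ m \<partial>H d))" for d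
  proof (cases "d \<in> set_pmf p")
    case True
    interpret prob_space "H d" by (rule prob)
    have meas: "(\<lambda>t. t) \<in> borel_measurable (H d)"
      using sets[of d] by (simp cong: measurable_cong_sets)
    have "integrable (H d) (\<lambda>t. t ^ m)"
      using m sq[OF True] square_integrable_imp_integrable[OF meas sq[OF True]] by auto
    then have "(\<integral>\<^sup>+t. ennreal (t ^ m) \<partial>H d) = ennreal (\<integral>t. t ^ m \<partial>H d)"
      by (rule nn_integral_eq_integral) (rule eventually_mono[OF nn], simp)
    then show ?thesis using pos by (simp add: ennreal_mult)
  next
    case False
    then show ?thesis by (simp add: set_pmf_iff)
  qed
  then show "(\<Sum>d=1..N. ennreal (pmf p d) * (\<integral>\<^sup>+t. ennreal (t ^ m) \<partial>H d)) = ennreal (interval_moment N p H m)"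
    using pos unfolding interval_moment_def by (subst sum_ennreal[symmetric]) auto
qed

context polling_model
begin

definition moment :: "bool \<Rightarrow> nat \<Rightarrow> real" where
  "moment h m = (if h then interval_moment N p H m else interval_moment N p' H' m)"

lemma nn_integral_step_moment:
  assumes m: "m \<in> {1, 2}"
  shows "(\<integral>\<^sup>+q. ennreal (snd q ^ m) \<partial>step h) = ennreal (moment h m)" and "0 \<le> moment h m"
proof -
  have f: "(\<lambda>q. ennreal (snd q ^ m)) \<in> borel_measurable input_space" by measurable
  show "(\<integral>\<^sup>+q. ennreal (snd q ^ m) \<partial>step h) = ennreal (moment h m)"
    unfolding step_def moment_def
    using nn_integral_step_law[OF H_prob H_sets p_set f] nn_integral_step_law[OF H'_prob H'_sets p'_set f]
      interval_moment_nn_integral(1)[OF H_prob H_sets H_nonneg H_sq m, where N=N]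
      interval_moment_nn_integral(1)[OF H'_prob H'_sets H'_nonneg H'_sq m, where N=N]
    by (cases h) simp_all
  show "0 \<le> moment h m"
    unfolding moment_def
    using interval_moment_nn_integral(2)[OF H_prob H_sets H_nonneg H_sq m, where N=N]
      interval_moment_nn_integral(2)[OF H'_prob H'_sets H'_nonneg H'_sq m, where N=N]
    by simp
qed

lemma nn_integral_poll_time:
  "(\<integral>\<^sup>+\<omega>. ennreal (poll_time N \<omega> z (Suc 0)) \<partial>\<Omega>) = ennreal (moment (nonempty z) 1)"
proof -
  have "(\<integral>\<^sup>+\<omega>. ennreal (poll_time N \<omega> z (Suc 0)) \<partial>\<Omega>) = (\<integral>\<^sup>+q. \<integral>\<^sup>+A. ennreal (snd q) \<partial>stations_law \<partial>step (nonempty z))"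
    unfolding poll_time_1 by (rule nn_integral_first_step[of "\<lambda>q A. ennreal (snd q)"]) measurable
  also have "\<dots> = (\<integral>\<^sup>+q. ennreal (snd q ^ 1) \<partial>step (nonempty z))"
    using st.P.emeasure_space_1 by simp
  also have "\<dots> = ennreal (moment (nonempty z) 1)"
    by (rule nn_integral_step_moment) simp
  finally show ?thesis .
qed

definition longest_step :: real where "longest_step = moment True 1 + moment False 1"

lemma moment_le_longest: "moment h 1 \<le> longest_step" "0 \<le> longest_step"
  using nn_integral_step_moment(2)[of 1 True] nn_integral_step_moment(2)[of 1 False]
  by (cases h; simp add: longest_step_def)+

lemma measurable_service_at[measurable]: "Measurable.pred \<Omega> (\<lambda>\<omega>. service_at N \<omega> z i n)"
  unfolding service_at_chain
  by (rule measurable_compose[OF measurable_chain, where g="\<lambda>c. fst c = i \<and> nonempty c"]) simp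

lemma card_service_sum: "card {m. m < n \<and> service_at N \<omega> z i m} = (\<Sum>m<n. if service_at N \<omega> z i m then 1 else 0)"
  by (simp add: sum.If_cases Int_def)

lemma measurable_served[measurable]: "Measurable.pred \<Omega> (\<lambda>\<omega>. served N z \<omega> i j n)"
proof -
  have [measurable]: "(\<lambda>\<omega>. \<Sum>m<n. if service_at N \<omega> z i m then 1 else 0 :: nat) \<in> \<Omega> \<rightarrow>\<^sub>M count_space UNIV"
  proof (induction n)
    case (Suc n)
    note [measurable] = Suc
    show ?case unfolding sum.lessThan_Suc by measurable
  qed simp
  show ?thesis
    unfolding served_def card_service_sum by measurable
qed

lemma measurable_rest[measurable]: "(\<lambda>\<omega>. rest N z \<omega> i j) \<in> borel_measurable \<Omega>"
  unfolding rest_def by measurable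

lemma measurable_truncated[measurable]: "(\<lambda>\<omega>. truncated N n z \<omega> i j) \<in> borel_measurable \<Omega>"
  unfolding truncated_def by measurable

definition mean_truncated :: "nat \<Rightarrow> nat \<Rightarrow> nat \<Rightarrow> state \<Rightarrow> ennreal" where
  "mean_truncated n i j z = (\<integral>\<^sup>+\<omega>. truncated N n z \<omega> i j \<partial>\<Omega>)"

definition mean_rest :: "nat \<Rightarrow> nat \<Rightarrow> state \<Rightarrow> ennreal" where
  "mean_rest i j z = (\<integral>\<^sup>+\<omega>. rest N z \<omega> i j \<partial>\<Omega>)"

lemma mean_truncated_0: "mean_truncated 0 i j z = 0"
proof -
  have "mean_truncated 0 i j z = (\<integral>\<^sup>+\<omega>. 0 \<partial>\<Omega>)"
    unfolding mean_truncated_def by (rule nn_integral_cong_AE, rule eventually_mono[OF AE_nice]) (rule truncated_0)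
  then show ?thesis by simp
qed

lemma mean_truncated_served_now: "head z i = 1 \<Longrightarrow> mean_truncated (Suc n) i 0 z = 0"
proof -
  assume h: "head z i = 1"
  have "mean_truncated (Suc n) i 0 z = (\<integral>\<^sup>+\<omega>. 0 \<partial>\<Omega>)"
    unfolding mean_truncated_def by (rule nn_integral_cong_AE, rule eventually_mono[OF AE_nice]) (rule truncated_served_now[OF _ h])
  then show ?thesis by simp
qed

lemma mean_truncated_Suc:
  assumes "\<not> (head z i = 1 \<and> head z i + j = 0)"
  shows "mean_truncated (Suc n) i (head z i + j) z = ennreal (moment (nonempty z) 1) + expect (mean_truncated n i j) z"
proof -
  have sh: "(\<lambda>\<omega>. next_scenario N z \<omega>) \<in> \<Omega> \<rightarrow>\<^sub>M \<Omega>" by measurable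
  have M: "(\<lambda>\<omega>. truncated N n (next_state N z \<omega>) (next_scenario N z \<omega>) i j) \<in> borel_measurable \<Omega>"
    by (rule measurable_compose_countable[OF measurable_compose[OF sh measurable_truncated] measurable_chain])
  have "mean_truncated (Suc n) i (head z i + j) z = (\<integral>\<^sup>+\<omega>. ennreal (poll_time N \<omega> z (Suc 0)) + truncated N n (next_state N z \<omega>) (next_scenario N z \<omega>) i j \<partial>\<Omega>)"
    unfolding mean_truncated_def by (rule nn_integral_cong_AE, rule eventually_mono[OF AE_nice]) (rule truncated_shift[OF _ assms])
  also have "\<dots> = (\<integral>\<^sup>+\<omega>. ennreal (poll_time N \<omega> z (Suc 0)) \<partial>\<Omega>) + (\<integral>\<^sup>+\<omega>. truncated N n (next_state N z \<omega>) (next_scenario N z \<omega>) i j \<partial>\<Omega>)"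
    by (rule nn_integral_add[OF _ M]) measurable
  also have "(\<integral>\<^sup>+\<omega>. truncated N n (next_state N z \<omega>) (next_scenario N z \<omega>) i j \<partial>\<Omega>) = expect (mean_truncated n i j) z"
    unfolding expect_def mean_truncated_def by (rule markov[of "\<lambda>z \<omega>. truncated N n z \<omega> i j"]) measurable
  finally show ?thesis by (simp only: nn_integral_poll_time)
qed

lemma mean_truncated_mono: "mean_truncated n i j z \<le> mean_truncated (Suc n) i j z"
  unfolding mean_truncated_def by (rule nn_integral_mono_AE, rule eventually_mono[OF AE_nice]) (rule truncated_mono)

lemma next_state_ge: "i < N \<Longrightarrow> after_poll z i \<le> snd (next_state N z \<omega>) ! i"
  by (simp add: chain_Suc Let_def)

lemma next_state_ne_empty: "i < N \<Longrightarrow> j < after_poll z i \<Longrightarrow> next_state N z \<omega> \<noteq> empty_state"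
  using next_state_ge[of i z \<omega>] by (auto simp: empty_state_def)

text \<open>
  Prolonging the truncation by one step costs at most the mean length of one step, and only if the
  customer is still waiting; in that case the empty state has not been met.
\<close>

lemma mean_truncated_increment:
  assumes "i < N" "fst z < N" "j < snd z ! i"
  shows "mean_truncated (Suc n) i j z \<le> mean_truncated n i j z + ennreal longest_step * avoid n z"
  using assms
proof (induction n arbitrary: z j)
  case (0 z j)
  show ?case
  proof (cases "head z i = 1 \<and> j = 0")
    case True
    then show ?thesis using mean_truncated_served_now[of z i 0] by simp
  next
    case False
    then obtain k where k: "j = head z i + k" "\<not> (head z i = 1 \<and> head z i + k = 0)"
      by (metis add_0 le_add_diff_inverse head_def less_one linorder_not_less)
    have "mean_truncated (Suc 0) i j z = ennreal (moment (nonempty z) 1) + expect (mean_truncated 0 i k) z"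
      unfolding k(1) by (rule mean_truncated_Suc[OF k(2)])
    also have "expect (mean_truncated 0 i k) z = 0" by (simp add: expect_def mean_truncated_0)
    finally show ?thesis using moment_le_longest(1)[of "nonempty z"] by (simp add: mean_truncated_0 ennreal_leI)
  qed
next
  case (Suc n z j)
  show ?case
  proof (cases "head z i = 1 \<and> j = 0")
    case True
    then show ?thesis using mean_truncated_served_now[of z i "Suc n"] by simp
  next
    case False
    then obtain k where k: "j = head z i + k" "\<not> (head z i = 1 \<and> head z i + k = 0)"
      by (metis add_0 le_add_diff_inverse head_def less_one linorder_not_less)
    have kl: "k < after_poll z i" using Suc.prems k(1) after_poll_head[OF Suc.prems(2), of i] by simp
    let ?a = "\<lambda>y. if y = empty_state then 0 else avoid n y"
    have M: "(\<lambda>\<omega>. f (next_state N z \<omega>)) \<in> borel_measurable \<Omega>" for f :: "state \<Rightarrow> ennreal"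
      by measurable
    have "expect (mean_truncated (Suc n) i k) z \<le> (\<integral>\<^sup>+\<omega>. mean_truncated n i k (next_state N z \<omega>) + ennreal longest_step * ?a (next_state N z \<omega>) \<partial>\<Omega>)"
      unfolding expect_def
    proof (rule nn_integral_mono)
      fix \<omega>
      have "mean_truncated (Suc n) i k (next_state N z \<omega>) \<le> mean_truncated n i k (next_state N z \<omega>) + ennreal longest_step * avoid n (next_state N z \<omega>)"
        using Suc.prems kl next_state_ge[of i z \<omega>] N_pos
        by (intro Suc.IH) (auto simp: chain_Suc Let_def)
      then show "mean_truncated (Suc n) i k (next_state N z \<omega>) \<le> mean_truncated n i k (next_state N z \<omega>) + ennreal longest_step * ?a (next_state N z \<omega>)"
        using next_state_ne_empty[OF Suc.prems(1) kl] by simp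
    qed
    also have "\<dots> = expect (mean_truncated n i k) z + ennreal longest_step * avoid (Suc n) z"
    proof -
      have 1: "(\<lambda>\<omega>. mean_truncated n i k (next_state N z \<omega>)) \<in> borel_measurable \<Omega>" by (rule M)
      have 2: "(\<lambda>\<omega>. ?a (next_state N z \<omega>)) \<in> borel_measurable \<Omega>" by (rule M[of ?a])
      have 3: "(\<lambda>\<omega>. ennreal longest_step * ?a (next_state N z \<omega>)) \<in> borel_measurable \<Omega>"
        by (intro borel_measurable_times_ennreal borel_measurable_const 2)
      show ?thesis
        unfolding nn_integral_add[OF 1 3] nn_integral_cmult[OF 2] expect_def avoid.simps ..
    qed
    finally show ?thesis
      unfolding k(1) mean_truncated_Suc[OF k(2)] by (simp add: add.assoc add_left_mono)
  qed
qed

definition unserved :: "nat \<Rightarrow> nat \<Rightarrow> nat \<Rightarrow> state \<Rightarrow> ennreal" where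
  "unserved n i j z = (\<integral>\<^sup>+\<omega>. indicator {\<omega>. \<forall>m<n. \<not> served N z \<omega> i j m} \<omega> \<partial>\<Omega>)"

lemma measurable_unserved[measurable]:
  "(\<lambda>\<omega>. indicator {\<omega>. \<forall>m<n. \<not> served N z \<omega> i j m} \<omega> :: ennreal) \<in> borel_measurable \<Omega>"
  by measurable

text \<open>
  As long as the customer waits the system is not empty. The induction follows the customer through the
  first step, where the number of customers in front of it may drop by one.
\<close>

lemma unserved_le_avoid:
  assumes "i < N" "fst z < N" "j < snd z ! i"
  shows "unserved n i j z \<le> avoid n z"
  using assms
proof (induction n arbitrary: z j)
  case (0 z j)
  show ?case using \<Omega>.emeasure_space_1 by (simp add: unserved_def)
next
  case (Suc n z j)
  show ?case
  proof (cases "head z i = 1 \<and> j = 0")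
    case True
    then have "unserved (Suc n) i j z = (\<integral>\<^sup>+\<omega>. 0 \<partial>\<Omega>)"
      unfolding unserved_def by (intro nn_integral_cong) (auto simp: served_0 indicator_def)
    then show ?thesis by simp
  next
    case False
    then obtain k where k: "j = head z i + k" "\<not> (head z i = 1 \<and> head z i + k = 0)"
      by (metis add_0 le_add_diff_inverse head_def less_one linorder_not_less)
    have kl: "k < after_poll z i" using Suc.prems k(1) after_poll_head[OF Suc.prems(2), of i] by simp
    have "unserved (Suc n) i j z
        = (\<integral>\<^sup>+\<omega>. indicator {\<omega>'. \<forall>m<n. \<not> served N (next_state N z \<omega>) \<omega>' i k m} (next_scenario N z \<omega>) \<partial>\<Omega>)"
      unfolding unserved_def
    proof (rule nn_integral_cong_AE, rule eventually_mono[OF AE_nice])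
      fix \<omega> assume "nice \<omega>"
      then have "(\<forall>m<Suc n. \<not> served N z \<omega> i j m) \<longleftrightarrow> (\<forall>m<n. \<not> served N (next_state N z \<omega>) (next_scenario N z \<omega>) i k m)"
        unfolding All_less_Suc2 k(1) using served_shift(1)[of \<omega> N z i k] k(2) by (simp add: served_0)
      then show "indicator {\<omega>. \<forall>m<Suc n. \<not> served N z \<omega> i j m} \<omega>
          = (indicator {\<omega>'. \<forall>m<n. \<not> served N (next_state N z \<omega>) \<omega>' i k m} (next_scenario N z \<omega>) :: ennreal)"
        by (simp add: indicator_def)
    qed
    also have "\<dots> = expect (unserved n i k) z"
      unfolding expect_def unserved_def
      by (rule markov[of "\<lambda>z. indicator {\<omega>'. \<forall>m<n. \<not> served N z \<omega>' i k m}"]) measurable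
    also have "\<dots> \<le> avoid (Suc n) z"
      unfolding avoid.simps expect_def
    proof (rule nn_integral_mono)
      fix \<omega>
      have "unserved n i k (next_state N z \<omega>) \<le> avoid n (next_state N z \<omega>)"
        using Suc.prems kl next_state_ge[of i z \<omega>] N_pos
        by (intro Suc.IH) (auto simp: chain_Suc Let_def)
      then show "unserved n i k (next_state N z \<omega>) \<le> (if next_state N z \<omega> = empty_state then 0 else avoid n (next_state N z \<omega>))"
        using next_state_ne_empty[OF Suc.prems(1) kl] by simp
    qed
    finally show ?thesis .
  qed
qed

lemma AE_served:
  assumes st: "stationary \<Omega> N \<pi>" and irr: "irreducible_chain \<Omega> N" and z: "z \<in> states N"
    and i: "i < N" and j: "j < snd z ! i"
  shows "AE \<omega> in \<Omega>. \<exists>m. served N z \<omega> i j m"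
proof -
  have s: "fst z < N" using z by (auto simp: states_def)
  let ?U = "{\<omega>. \<forall>m. \<not> served N z \<omega> i j m}"
  have M: "(\<lambda>\<omega>. indicator ?U \<omega> :: ennreal) \<in> borel_measurable \<Omega>" by measurable
  have "(\<integral>\<^sup>+\<omega>. indicator ?U \<omega> \<partial>\<Omega>) \<le> avoid n z" for n
  proof -
    have "(\<integral>\<^sup>+\<omega>. indicator ?U \<omega> \<partial>\<Omega>) \<le> unserved n i j z"
      unfolding unserved_def by (intro nn_integral_mono) (auto simp: indicator_def)
    also have "\<dots> \<le> avoid n z" by (rule unserved_le_avoid[OF i s j])
    finally show ?thesis .
  qed
  then have "(\<integral>\<^sup>+\<omega>. indicator ?U \<omega> \<partial>\<Omega>) \<le> 0"
    by (intro LIMSEQ_le_const[OF avoid_limit[OF st irr z]]) auto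
  then have "AE \<omega> in \<Omega>. indicator ?U \<omega> = (0::ennreal)"
    using nn_integral_0_iff_AE[OF M] by simp
  then show ?thesis
    by (rule eventually_mono) (auto simp: indicator_def split: if_splits)
qed

text \<open>
  The truncated times increase to the full one because the customer is almost surely taken.
\<close>

lemma mean_truncated_limit:
  assumes st: "stationary \<Omega> N \<pi>" and irr: "irreducible_chain \<Omega> N" and z: "z \<in> states N"
    and i: "i < N" and j: "j < snd z ! i"
  shows "(\<lambda>n. mean_truncated n i j z) \<longlonglongrightarrow> mean_rest i j z"
proof -
  have "(\<lambda>n. mean_truncated n i j z) \<longlonglongrightarrow> (SUP n. mean_truncated n i j z)"
    by (rule LIMSEQ_SUP) (simp add: incseq_Suc_iff mean_truncated_mono)
  also have "(SUP n. mean_truncated n i j z) = (\<integral>\<^sup>+\<omega>. (SUP n. truncated N n z \<omega> i j) \<partial>\<Omega>)"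
    unfolding mean_truncated_def
    by (rule nn_integral_monotone_convergence_SUP_AE[symmetric])
       (auto intro: eventually_mono[OF AE_nice] truncated_mono)
  also have "\<dots> = mean_rest i j z"
    unfolding mean_rest_def
  proof (rule nn_integral_cong_AE)
    show "AE \<omega> in \<Omega>. (SUP n. truncated N n z \<omega> i j) = rest N z \<omega> i j"
      using AE_nice AE_served[OF assms]
    proof eventually_elim
      case (elim \<omega>)
      then obtain m where "served N z \<omega> i j m" by blast
      from truncated_limit[OF elim(1) this] show ?case
        by (intro LIMSEQ_unique[OF LIMSEQ_SUP]) (auto simp: incseq_Suc_iff intro: truncated_mono[OF elim(1)])
    qed
  qed
  finally show ?thesis .
qed

end

lemma (in sequence_space) nn_integral_component:
  assumes f: "f \<in> borel_measurable M"
  shows "(\<integral>\<^sup>+a. f (a i) \<partial>S) = (\<integral>\<^sup>+q. f q \<partial>M)"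
proof -
  have "(\<integral>\<^sup>+q. f q \<partial>M) = (\<integral>\<^sup>+q. f q \<partial>distr S M (\<lambda>a. a i))"
    by (subst PiM_component) auto
  also have "\<dots> = (\<integral>\<^sup>+a. f (a i) \<partial>S)"
    using f by (intro nn_integral_distr) auto
  finally show ?thesis by simp
qed

lemma (in sequence_space) nn_integral_two_components:
  assumes f: "f \<in> borel_measurable M" and g: "g \<in> borel_measurable M" and ij: "i < j"
  shows "(\<integral>\<^sup>+a. f (a i) * g (a j) \<partial>S) = (\<integral>\<^sup>+q. f q \<partial>M) * (\<integral>\<^sup>+q. g q \<partial>M)"
  using ij
proof (induction i arbitrary: j)
  note [measurable] = f g
  {
    case 0
    then obtain k where j: "j = Suc k" by (cases j) auto
    have "(\<lambda>a. f (a 0) * g (a j)) \<in> borel_measurable S" by measurable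
    from nn_integral_iter[OF this] show ?case
      using nn_integral_component[OF g, of k] by (simp add: j nn_integral_cmult nn_integral_multc f)
  next
    case (Suc i)
    then obtain k where j: "j = Suc k" "i < k" by (cases j) auto
    have "(\<lambda>a. f (a (Suc i)) * g (a j)) \<in> borel_measurable S" by measurable
    from nn_integral_iter[OF this] show ?case
      using Suc.IH[OF j(2)] M.emeasure_space_1 by (simp add: j)
  }
qed

lemma sum_lessThan_shift: "(\<Sum>q<n. g (a + q)) = (\<Sum>j\<in>{a..<a + n}. g j)" for g :: "nat \<Rightarrow> 'a :: comm_monoid_add"
  by (rule sum.reindex_bij_witness[where i="\<lambda>j. j - a" and j="\<lambda>q. a + q"]) auto

lemma sum_lessThan_split: "a \<le> n \<Longrightarrow> (\<Sum>j<n. g j) = (\<Sum>j<a. g j) + (\<Sum>j\<in>{a..<n}. g j)" for g :: "nat \<Rightarrow> 'a :: comm_monoid_add"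
  using sum.atLeastLessThan_concat[of 0 a n g] by (simp add: lessThan_atLeast0)

text \<open>
  This passes from customers indexed by batch and rank in the batch to positions in the queue.
\<close>

lemma sum_blocks:
  fixes g :: "nat \<Rightarrow> 'a :: comm_monoid_add" and K :: nat and m :: "nat \<Rightarrow> nat"
  shows "(\<Sum>k<K. \<Sum>r<m k. g ((\<Sum>j<k. m j) + r)) = (\<Sum>q<(\<Sum>k<K. m k). g q)"
proof (induction K)
  case (Suc K)
  have "(\<Sum>q<(\<Sum>k<K. m k) + m K. g q) = (\<Sum>q<(\<Sum>k<K. m k). g q) + (\<Sum>r<m K. g ((\<Sum>j<K. m j) + r))"
    unfolding sum_lessThan_shift by (rule sum_lessThan_split) simp
  then show ?case by (simp add: Suc)
qed simp

definition total_after :: "nat \<Rightarrow> state \<Rightarrow> nat" where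
  "total_after N z = (\<Sum>i<N. after_poll z i)"

definition queue_total :: "nat \<Rightarrow> state \<Rightarrow> nat" where
  "queue_total N z = (\<Sum>i<N. snd z ! i)"

lemma total_after_le: "total_after N z \<le> queue_total N z"
  unfolding total_after_def queue_total_def after_poll_def by (intro sum_mono) simp

context polling_model
begin

section \<open>Little's law\<close>

definition mean_backlog :: "nat \<Rightarrow> state \<Rightarrow> ennreal" where
  "mean_backlog n z = (\<Sum>i<N. \<Sum>j<snd z ! i. mean_truncated n i j z)"

text \<open>
  The contribution to the remaining waiting times at the next polling instant of the customers who
  arrived during the first step. They are the ones at positions from \<open>after_poll z i\<close> on.
\<close>

definition new_wait :: "(nat \<Rightarrow> nat \<Rightarrow> state \<Rightarrow> ennreal) \<Rightarrow> state \<Rightarrow> ennreal" where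
  "new_wait g z = (\<integral>\<^sup>+\<omega>. (\<Sum>i<N. \<Sum>j\<in>{after_poll z i..<snd (next_state N z \<omega>) ! i}. g i j (next_state N z \<omega>)) \<partial>\<Omega>)"

text \<open>
  Conservation of waiting time over one step: each customer left behind waits for the whole step,
  and at the next polling instant the present customers are these and the new ones.
\<close>

lemma mean_backlog_step:
  assumes "fst z < N"
  shows "mean_backlog (Suc n) z + new_wait (mean_truncated n) z = of_nat (total_after N z) * ennreal (moment (nonempty z) 1) + expect (mean_backlog n) z"
proof -
  let ?m = "ennreal (moment (nonempty z) 1)"
  have "(\<Sum>j<snd z ! i. mean_truncated (Suc n) i j z) = (\<Sum>j<after_poll z i. ?m + expect (mean_truncated n i j) z)" if "i < N" for i
  proof -
    have "(\<Sum>j<snd z ! i. mean_truncated (Suc n) i j z) = (\<Sum>j<after_poll z i. mean_truncated (Suc n) i (head z i + j) z)"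
    proof (cases "head z i = 1")
      case True
      then show ?thesis
        unfolding after_poll_head[OF assms] using mean_truncated_served_now[OF True, of n]
        by (simp add: sum.lessThan_Suc_shift del: sum.lessThan_Suc)
    next
      case False
      then have "head z i = 0" by (simp add: head_def split: if_splits)
      then show ?thesis unfolding after_poll_head[OF assms] by simp
    qed
    then show ?thesis by (simp add: mean_truncated_Suc)
  qed
  then have "mean_backlog (Suc n) z = (\<Sum>i<N. \<Sum>j<after_poll z i. ?m + expect (mean_truncated n i j) z)"
    by (simp add: mean_backlog_def)
  also have "\<dots> = of_nat (total_after N z) * ?m + (\<Sum>i<N. \<Sum>j<after_poll z i. expect (mean_truncated n i j) z)"
    by (simp add: sum.distrib total_after_def sum_distrib_right)
  also have "(\<Sum>i<N. \<Sum>j<after_poll z i. expect (mean_truncated n i j) z)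
    = (\<integral>\<^sup>+\<omega>. (\<Sum>i<N. \<Sum>j<after_poll z i. mean_truncated n i j (next_state N z \<omega>)) \<partial>\<Omega>)"
    unfolding expect_def by (simp add: nn_integral_sum measurable_of_chain)
  finally have "mean_backlog (Suc n) z + new_wait (mean_truncated n) z = of_nat (total_after N z) * ?m +
      ((\<integral>\<^sup>+\<omega>. (\<Sum>i<N. \<Sum>j<after_poll z i. mean_truncated n i j (next_state N z \<omega>)) \<partial>\<Omega>) + new_wait (mean_truncated n) z)"
    by (simp add: add.assoc)
  also have "(\<integral>\<^sup>+\<omega>. (\<Sum>i<N. \<Sum>j<after_poll z i. mean_truncated n i j (next_state N z \<omega>)) \<partial>\<Omega>) + new_wait (mean_truncated n) z
    = (\<integral>\<^sup>+\<omega>. (\<Sum>i<N. \<Sum>j<after_poll z i. mean_truncated n i j (next_state N z \<omega>)) +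
        (\<Sum>i<N. \<Sum>j\<in>{after_poll z i..<snd (next_state N z \<omega>) ! i}. mean_truncated n i j (next_state N z \<omega>)) \<partial>\<Omega>)"
    unfolding new_wait_def
    by (rule nn_integral_add[symmetric])
       (rule measurable_of_chain[of "\<lambda>y. \<Sum>i<N. \<Sum>j<after_poll z i. mean_truncated n i j y"]
             measurable_of_chain[of "\<lambda>y. \<Sum>i<N. \<Sum>j\<in>{after_poll z i..<snd y ! i}. mean_truncated n i j y"])+
  also have "\<dots> = expect (mean_backlog n) z"
    unfolding expect_def mean_backlog_def
  proof (rule nn_integral_cong)
    fix \<omega>
    show "(\<Sum>i<N. \<Sum>j<after_poll z i. mean_truncated n i j (next_state N z \<omega>)) +
        (\<Sum>i<N. \<Sum>j\<in>{after_poll z i..<snd (next_state N z \<omega>) ! i}. mean_truncated n i j (next_state N z \<omega>))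
      = (\<Sum>i<N. \<Sum>j<snd (next_state N z \<omega>) ! i. mean_truncated n i j (next_state N z \<omega>))"
      unfolding sum.distrib[symmetric]
      by (intro sum.cong refl sum_lessThan_split[symmetric] next_state_ge) simp
  qed
  finally show ?thesis .
qed

lemma new_wait_limit:
  assumes st: "stationary \<Omega> N \<pi>" and irr: "irreducible_chain \<Omega> N" and z: "z \<in> states N"
  shows "(\<lambda>n. new_wait (mean_truncated n) z) \<longlonglongrightarrow> new_wait mean_rest z"
  unfolding new_wait_def
proof (rule nn_integral_LIMSEQ)
  let ?f = "\<lambda>n \<omega>. \<Sum>i<N. \<Sum>j\<in>{after_poll z i..<snd (next_state N z \<omega>) ! i}. mean_truncated n i j (next_state N z \<omega>)"
  show "incseq ?f"
    by (intro incseq_SucI le_funI sum_mono mean_truncated_mono)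
  show "?f n \<in> borel_measurable \<Omega>" for n
    by (rule measurable_of_chain[of "\<lambda>y. \<Sum>i<N. \<Sum>j\<in>{after_poll z i..<snd y ! i}. mean_truncated n i j y"])
  show "(\<lambda>n. ?f n \<omega>) \<longlonglongrightarrow> (\<Sum>i<N. \<Sum>j\<in>{after_poll z i..<snd (next_state N z \<omega>) ! i}. mean_rest i j (next_state N z \<omega>))" for \<omega>
    by (intro tendsto_sum mean_truncated_limit[OF st irr chain_in_states[OF N_pos z]]) auto
qed

text \<open>
  In the stationary regime the mean backlog cancels from \<open>mean_backlog_step\<close> up to its increment in the
  truncation level \<open>n\<close>. This increment is nonnegative, and bounded by \<open>longest_step\<close> times the mean of
  the number of present customers on the event that the empty state is avoided for \<open>n\<close> steps, which
  tends to \<open>0\<close> by dominated convergence.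
\<close>

lemma little:
  assumes st: "stationary \<Omega> N \<pi>" and irr: "irreducible_chain \<Omega> N"
    and fin: "(\<integral>\<^sup>+z. of_nat (queue_total N z) \<partial>measure_pmf \<pi>) < \<infinity>"
  shows "(\<integral>\<^sup>+z. new_wait mean_rest z \<partial>measure_pmf \<pi>)
    = (\<integral>\<^sup>+z. of_nat (total_after N z) * ennreal (moment (nonempty z) 1) \<partial>measure_pmf \<pi>)" (is "?F = ?A")
proof -
  have sp: "AE z in measure_pmf \<pi>. z \<in> states N"
    using st by (intro AE_pmfI) (auto simp: stationary_def)
  let ?V = "\<lambda>n. \<integral>\<^sup>+z. mean_backlog n z \<partial>measure_pmf \<pi>"
  let ?N = "\<lambda>n. \<integral>\<^sup>+z. new_wait (mean_truncated n) z \<partial>measure_pmf \<pi>"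
  let ?D = "\<lambda>n. \<integral>\<^sup>+z. of_nat (queue_total N z) * avoid n z \<partial>measure_pmf \<pi>"
  have A: "?A < \<infinity>"
  proof -
    have "?A \<le> (\<integral>\<^sup>+z. ennreal longest_step * of_nat (queue_total N z) \<partial>measure_pmf \<pi>)"
      using total_after_le moment_le_longest
      by (intro nn_integral_mono) (subst mult.commute, intro mult_mono ennreal_leI of_nat_mono, auto)
    also have "\<dots> < \<infinity>"
      using fin by (simp add: nn_integral_cmult ennreal_mult_less_top)
    finally show ?thesis .
  qed
  have step: "?V (Suc n) + ?N n = ?A + ?V n" for n
  proof -
    have "?V (Suc n) + ?N n = (\<integral>\<^sup>+z. mean_backlog (Suc n) z + new_wait (mean_truncated n) z \<partial>measure_pmf \<pi>)"
      by (rule nn_integral_add[symmetric]) auto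
    also have "\<dots> = (\<integral>\<^sup>+z. of_nat (total_after N z) * ennreal (moment (nonempty z) 1) + expect (mean_backlog n) z \<partial>measure_pmf \<pi>)"
      by (rule nn_integral_cong_AE, rule eventually_mono[OF sp]) (rule mean_backlog_step, auto simp: states_def)
    also have "\<dots> = ?A + ?V n"
      by (subst nn_integral_add) (auto simp: stationary_expect[OF st])
    finally show ?thesis .
  qed
  \<comment> \<open>Integrated mean backlogs are finite, so they may be cancelled below.\<close>
  have Vfin: "?V n < \<infinity>" for n
  proof (induction n)
    case 0
    show ?case by (simp add: mean_backlog_def mean_truncated_0)
  next
    case (Suc n)
    have "?V (Suc n) \<le> ?A + ?V n" unfolding step[symmetric] by simp
    also have "\<dots> < \<infinity>" using A Suc by simp
    finally show ?case .
  qed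
  have Nle: "?N n \<le> ?A" for n
  proof -
    have "?V n \<le> ?V (Suc n)"
      unfolding mean_backlog_def by (intro nn_integral_mono sum_mono mean_truncated_mono)
    then have "?V n + ?N n \<le> ?V (Suc n) + ?N n"
      by (rule add_right_mono)
    then have "?V n + ?N n \<le> ?V n + ?A"
      unfolding step by (simp only: add.commute)
    then show ?thesis using Vfin[of n] by (auto simp: ennreal_add_left_cancel_le)
  qed
  have Ale: "?A \<le> ennreal longest_step * ?D n + ?N n" for n
  proof -
    have "?V (Suc n) \<le> (\<integral>\<^sup>+z. mean_backlog n z + ennreal longest_step * (of_nat (queue_total N z) * avoid n z) \<partial>measure_pmf \<pi>)"
    proof (rule nn_integral_mono_AE, rule eventually_mono[OF sp])
      fix z assume z: "z \<in> states N"
      have "mean_backlog (Suc n) z \<le> (\<Sum>i<N. \<Sum>j<snd z ! i. mean_truncated n i j z + ennreal longest_step * avoid n z)"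
        unfolding mean_backlog_def using z by (intro sum_mono mean_truncated_increment) (auto simp: states_def)
      also have "\<dots> = mean_backlog n z + ennreal longest_step * (of_nat (queue_total N z) * avoid n z)"
        by (simp add: mean_backlog_def sum.distrib queue_total_def sum_distrib_right sum_distrib_left ac_simps)
      finally show "mean_backlog (Suc n) z \<le> mean_backlog n z + ennreal longest_step * (of_nat (queue_total N z) * avoid n z)" .
    qed
    also have "\<dots> = ?V n + ennreal longest_step * ?D n"
      by (subst nn_integral_add) (auto simp: nn_integral_cmult)
    finally have "?V (Suc n) + ?N n \<le> ?V n + ennreal longest_step * ?D n + ?N n"
      by (rule add_right_mono)
    then have "?V n + ?A \<le> ?V n + (ennreal longest_step * ?D n + ?N n)"
      unfolding step by (simp only: add.assoc add.commute[of ?A])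
    then show ?thesis using Vfin[of n] by (auto simp: ennreal_add_left_cancel_le)
  qed
  have D: "?D \<longlonglongrightarrow> (\<integral>\<^sup>+z. 0 \<partial>measure_pmf \<pi>)"
  proof (rule nn_integral_dominated_convergence[where w="\<lambda>z. of_nat (queue_total N z)"])
    show "AE z in measure_pmf \<pi>. of_nat (queue_total N z) * avoid n z \<le> of_nat (queue_total N z)" for n
    proof (rule AE_I2)
      fix z show "of_nat (queue_total N z) * avoid n z \<le> of_nat (queue_total N z)"
        using mult_left_mono[OF avoid_le_1[of n z], of "of_nat (queue_total N z)"] by simp
    qed
    show "AE z in measure_pmf \<pi>. (\<lambda>n. of_nat (queue_total N z) * avoid n z) \<longlonglongrightarrow> 0"
    proof (rule eventually_mono[OF sp])
      fix z assume "z \<in> states N"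
      from ennreal_tendsto_cmult[OF _ avoid_limit[OF st irr this], of "of_nat (queue_total N z)"]
      show "(\<lambda>n. of_nat (queue_total N z) * avoid n z) \<longlonglongrightarrow> 0"
        by (simp add: ennreal_of_nat_eq_real_of_nat)
    qed
  qed (use fin in auto)
  have Nlim: "?N \<longlonglongrightarrow> ?F"
  proof -
    let ?g = "\<lambda>n z. if z \<in> states N then new_wait (mean_truncated n) z else 0"
    have "(\<lambda>n. \<integral>\<^sup>+z. ?g n z \<partial>measure_pmf \<pi>) \<longlonglongrightarrow> (\<integral>\<^sup>+z. (if z \<in> states N then new_wait mean_rest z else 0) \<partial>measure_pmf \<pi>)"
    proof (rule nn_integral_LIMSEQ)
      show "incseq ?g"
        by (intro incseq_SucI le_funI) (auto simp: new_wait_def intro!: nn_integral_mono sum_mono mean_truncated_mono)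
    qed (auto intro: new_wait_limit[OF st irr])
    moreover have "(\<integral>\<^sup>+z. (if z \<in> states N then h z else 0) \<partial>measure_pmf \<pi>) = (\<integral>\<^sup>+z. h z \<partial>measure_pmf \<pi>)" for h :: "state \<Rightarrow> ennreal"
      by (rule nn_integral_cong_AE, rule eventually_mono[OF sp]) simp
    ultimately show ?thesis by simp
  qed
  show ?thesis
  proof (rule antisym)
    show "?F \<le> ?A"
      by (rule LIMSEQ_le_const2[OF Nlim]) (use Nle in auto)
    have "(\<lambda>n. ennreal longest_step * ?D n + ?N n) \<longlonglongrightarrow> ennreal longest_step * 0 + ?F"
      using D by (intro tendsto_add ennreal_tendsto_cmult Nlim) auto
    from LIMSEQ_le_const[OF this, of ?A] Ale show "?A \<le> ?F" by auto
  qed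
qed

section \<open>Customers arriving between two polling instants\<close>

definition arriving :: "state \<Rightarrow> scenario \<Rightarrow> customer set" where
  "arriving z \<omega> = {(i, k, r). i < N \<and> r < batch_size \<omega> i k \<and> 0 < batch_time \<omega> i k \<and> batch_time \<omega> i k \<le> poll_time N \<omega> z (Suc 0)}"

lemma arriving_Sigma:
  assumes "nice \<omega>"
  shows "arriving z \<omega> = (SIGMA i:{..<N}. SIGMA k:{..<count (station \<omega> i) (poll_time N \<omega> z (Suc 0))}. {..<batch_size \<omega> i k})"
proof -
  have r: "regular (station \<omega> i)" for i using assms by (simp add: nice_def)
  show ?thesis
    using epoch_pos[OF r] epoch_le_iff_less_count[OF r]
    by (auto simp: arriving_def batch_time_station)
qed

lemma sum_arriving:
  assumes "nice \<omega>"
  shows "(\<integral>\<^sup>+c. f c * indicator (arriving z \<omega>) c \<partial>count_space UNIV)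
    = (\<Sum>i<N. \<Sum>k<count (station \<omega> i) (poll_time N \<omega> z (Suc 0)). \<Sum>r<batch_size \<omega> i k. f (i, k, r))"
proof -
  have fin: "finite (arriving z \<omega>)" unfolding arriving_Sigma[OF assms] by simp
  have "(\<integral>\<^sup>+c. f c * indicator (arriving z \<omega>) c \<partial>count_space UNIV) = (\<integral>\<^sup>+c. f c \<partial>count_space (arriving z \<omega>))"
    by (simp add: nn_integral_count_space_indicator)
  also have "\<dots> = (\<Sum>c\<in>arriving z \<omega>. f c)"
    by (rule nn_integral_count_space_finite[OF fin])
  finally show ?thesis
    unfolding arriving_Sigma[OF assms] by (simp add: sum.Sigma split_beta')
qed

text \<open>
  The total wait until time \<open>u\<close> of the customers who arrived before it.
\<close>

definition delay :: "real \<Rightarrow> (nat \<Rightarrow> nat \<times> real) \<Rightarrow> ennreal" where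
  "delay u a = (\<Sum>k<count a u. of_nat (fst (a k)) * ennreal (u - epoch a k))"

text \<open>
  The customers who arrive at station \<open>i\<close> during the first step stand at consecutive positions behind
  those left by the poll, and the arrivals of several batches are enumerated by \<open>sum_blocks\<close>.
\<close>

lemma sum_waiting:
  assumes nice: "nice \<omega>" and z: "z \<in> states N"
  shows "(\<integral>\<^sup>+c. waiting_time N ((z, \<omega>), c) * indicator (arriving z \<omega>) c \<partial>count_space UNIV)
    = (\<Sum>i<N. delay (poll_time N \<omega> z (Suc 0)) (station \<omega> i))
      + (\<Sum>i<N. \<Sum>j\<in>{after_poll z i..<snd (next_state N z \<omega>) ! i}. rest N (next_state N z \<omega>) (next_scenario N z \<omega>) i j)"
proof -
  let ?u = "poll_time N \<omega> z (Suc 0)"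
  have s: "fst z < N" using z by (simp add: states_def split_beta')
  have r: "regular (station \<omega> i)" for i using nice by (simp add: nice_def)
  have "(\<Sum>k<count (station \<omega> i) ?u. \<Sum>r<batch_size \<omega> i k. waiting_time N ((z, \<omega>), (i, k, r)))
    = delay ?u (station \<omega> i) + (\<Sum>j\<in>{after_poll z i..<snd (next_state N z \<omega>) ! i}. rest N (next_state N z \<omega>) (next_scenario N z \<omega>) i j)"
    if i: "i < N" for i
  proof -
    let ?K = "count (station \<omega> i) ?u"
    let ?g = "\<lambda>q. rest N (next_state N z \<omega>) (next_scenario N z \<omega>) i (after_poll z i + q)"
    have "(\<Sum>k<?K. \<Sum>r<batch_size \<omega> i k. waiting_time N ((z, \<omega>), (i, k, r)))
      = (\<Sum>k<?K. \<Sum>r<batch_size \<omega> i k. ennreal (?u - epoch (station \<omega> i) k) + ?g ((\<Sum>j<k. batch_size \<omega> i j) + r))"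
    proof (intro sum.cong refl)
      fix k r assume "k \<in> {..<?K}"
      then have b: "batch_time \<omega> i k \<le> ?u"
        using epoch_le_iff_less_count[OF r, of i k ?u] by (simp add: batch_time_station)
      show "waiting_time N ((z, \<omega>), (i, k, r)) = ennreal (?u - epoch (station \<omega> i) k) + ?g ((\<Sum>j<k. batch_size \<omega> i j) + r)"
        unfolding waiting_time_rest[OF nice s b] by (simp add: batch_time_station)
    qed
    also have "\<dots> = delay ?u (station \<omega> i) + (\<Sum>q<(\<Sum>k<?K. batch_size \<omega> i k). ?g q)"
      unfolding sum_blocks[symmetric]
      by (simp add: sum.distrib delay_def batch_size_station)
    also have "(\<Sum>q<(\<Sum>k<?K. batch_size \<omega> i k). ?g q)
      = (\<Sum>j\<in>{after_poll z i..<after_poll z i + (\<Sum>k<?K. batch_size \<omega> i k)}. rest N (next_state N z \<omega>) (next_scenario N z \<omega>) i j)"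
      by (rule sum_lessThan_shift)
    also have "after_poll z i + (\<Sum>k<?K. batch_size \<omega> i k) = snd (next_state N z \<omega>) ! i"
      using i unfolding chain_successor[OF nice]
      by (simp add: successor_def totals_def total_def batch_size_station poll_time_1)
    finally show ?thesis .
  qed
  then show ?thesis
    unfolding sum_arriving[OF nice] by (simp add: sum.distrib)
qed

end

section \<open>Fourier analysis on the cyclic group of stations\<close>

lemma sum_mod_shift:
  fixes g :: "nat \<Rightarrow> 'a :: comm_monoid_add" and N k :: nat
  shows "(\<Sum>i<N. g ((i + k) mod N)) = (\<Sum>i<N. g i)"
proof (cases "N = 0")
  case False
  have inj: "inj_on (\<lambda>i. (i + k) mod N) {..<N}"
  proof (rule linorder_inj_onI')
    fix i j assume ij: "i \<in> {..<N}" "j \<in> {..<N}" "i < j"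
    show "(i + k) mod N \<noteq> (j + k) mod N"
    proof
      assume "(i + k) mod N = (j + k) mod N"
      then have "N dvd (j + k) - (i + k)"
        using ij by (subst mod_eq_dvd_iff_nat[symmetric]) auto
      then have "N dvd j - i" by simp
      then have "N \<le> j - i" using ij by (intro dvd_imp_le) auto
      with ij show False by simp
    qed
  qed
  moreover have "(\<lambda>i. (i + k) mod N) ` {..<N} \<subseteq> {..<N}" using False by auto
  ultimately have "bij_betw (\<lambda>i. (i + k) mod N) {..<N} {..<N}"
    by (simp add: bij_betw_def endo_inj_surj)
  then show ?thesis by (rule sum.reindex_bij_betw)
qed simp

definition unity_root :: "nat \<Rightarrow> nat \<Rightarrow> complex" where
  "unity_root N l = exp (2 * of_real pi * \<i> * of_nat l / of_nat N)"

lemma unity_root_power_N: "1 \<le> N \<Longrightarrow> unity_root N l ^ N = 1"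
  unfolding unity_root_def by (rule complex_root_unity) simp

lemma unity_root_ne_1: "1 \<le> l \<Longrightarrow> l < N \<Longrightarrow> unity_root N l \<noteq> 1"
  unfolding unity_root_def using complex_root_unity_eq_1[of N l] by (auto dest: dvd_imp_le)

lemma unity_root_power_swap: "unity_root N l ^ j = unity_root N j ^ l"
  by (simp add: unity_root_def exp_of_nat_mult[symmetric] ac_simps)

lemma unity_root_cnj: "unity_root N l * cnj (unity_root N l) = 1"
proof -
  have "unity_root N l = cis (2 * pi * of_nat l / of_nat N)"
    by (simp add: unity_root_def cis_conv_exp ac_simps)
  then show ?thesis by (simp add: cis_cnj cis_mult)
qed

lemma unity_root_minus:
  assumes "l \<le> N" "1 \<le> N" shows "unity_root N (N - l) = cnj (unity_root N l)"
proof -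
  have "unity_root N (N - l) * unity_root N l = exp (2 * of_real pi * \<i> * of_nat N / of_nat N)"
    unfolding unity_root_def exp_add[symmetric] using assms
    by (simp add: of_nat_diff add_divide_distrib[symmetric] diff_divide_distrib ring_distribs)
  also have "\<dots> = 1" using assms by simp
  finally have "unity_root N (N - l) * (unity_root N l * cnj (unity_root N l)) = cnj (unity_root N l)"
    by (simp add: mult.assoc[symmetric])
  then show ?thesis by (simp add: unity_root_cnj)
qed

lemma power_mod_root:
  fixes w :: complex
  assumes "w ^ N = 1" shows "w ^ (n mod N) = w ^ n"
proof -
  have "w ^ n = w ^ (n mod N + N * (n div N))" by simp
  also have "\<dots> = w ^ (n mod N)" unfolding power_add power_mult by (simp add: assms)
  finally show ?thesis by simp
qed

lemma sum_root_powers: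
  fixes w :: complex
  assumes "w ^ N = 1" "w \<noteq> 1" shows "(\<Sum>j<N. w ^ j) = 0"
  using assms geometric_sum[of w N] by simp

lemma sum_cnj_root_powers:
  assumes "1 \<le> l" "l < N" shows "(\<Sum>j<N. cnj (unity_root N l) ^ j) = 0"
proof (rule sum_root_powers)
  show "cnj (unity_root N l) ^ N = 1"
    using unity_root_power_N[of N l] assms by (metis complex_cnj_one complex_cnj_power le_trans less_imp_le)
  show "cnj (unity_root N l) \<noteq> 1"
    using unity_root_ne_1[OF assms] by (metis complex_cnj_cnj complex_cnj_one)
qed

definition fourier :: "nat \<Rightarrow> (nat \<Rightarrow> real) \<Rightarrow> nat \<Rightarrow> complex" where
  "fourier N g l = (\<Sum>j<N. cnj (unity_root N l) ^ j * of_real (g j))"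

lemma fourier_shift:
  assumes N: "1 \<le> N"
  shows "(\<Sum>j<N. cnj (unity_root N l) ^ j * of_real (g ((j + d) mod N))) = unity_root N l ^ d * fourier N g l"
proof -
  let ?w = "unity_root N l"
  have "cnj ?w ^ j = ?w ^ d * cnj ?w ^ ((j + d) mod N)" for j
  proof -
    have "cnj ?w ^ N = 1" using unity_root_power_N[OF N, of l] by (metis complex_cnj_one complex_cnj_power)
    then have "?w ^ d * cnj ?w ^ ((j + d) mod N) = ?w ^ d * cnj ?w ^ (j + d)" by (simp only: power_mod_root)
    also have "\<dots> = (?w * cnj ?w) ^ d * cnj ?w ^ j" by (simp add: power_add power_mult_distrib)
    finally show ?thesis by (simp add: unity_root_cnj)
  qed
  note * = this
  have "(\<Sum>j<N. cnj ?w ^ j * of_real (g ((j + d) mod N)))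
    = (\<Sum>j<N. (\<lambda>m. ?w ^ d * (cnj ?w ^ m * of_real (g m))) ((j + d) mod N))"
  proof (intro sum.cong refl)
    fix j
    show "cnj ?w ^ j * of_real (g ((j + d) mod N)) = (\<lambda>m. ?w ^ d * (cnj ?w ^ m * of_real (g m))) ((j + d) mod N)"
      using *[of j] by (simp only: mult.assoc)
  qed
  also have "\<dots> = (\<Sum>m<N. ?w ^ d * (cnj ?w ^ m * of_real (g m)))"
    by (rule sum_mod_shift)
  finally show ?thesis by (simp add: fourier_def sum_distrib_left)
qed

lemma fourier_inversion_0:
  assumes N: "1 \<le> N" shows "(\<Sum>l<N. fourier N g l) = of_nat N * of_real (g 0)"
proof -
  have "(\<Sum>l<N. fourier N g l) = (\<Sum>j<N. \<Sum>l<N. cnj (unity_root N l) ^ j * of_real (g j))"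
    unfolding fourier_def by (rule sum.swap)
  also have "\<dots> = (\<Sum>j<N. of_real (g j) * (\<Sum>l<N. cnj (unity_root N j) ^ l))"
    unfolding sum_distrib_left
  proof (intro sum.cong refl)
    fix j l
    have "cnj (unity_root N l) ^ j = cnj (unity_root N j) ^ l"
      by (metis complex_cnj_power unity_root_power_swap)
    then show "cnj (unity_root N l) ^ j * of_real (g j) = of_real (g j) * cnj (unity_root N j) ^ l" by simp
  qed
  also have "\<dots> = (\<Sum>j<N. if j = 0 then of_nat N * of_real (g 0) else 0)"
  proof (intro sum.cong refl)
    fix j assume "j \<in> {..<N}"
    then show "of_real (g j) * (\<Sum>l<N. cnj (unity_root N j) ^ l) = (if j = 0 then of_nat N * of_real (g 0) else 0)"
    proof (cases "j = 0")
      case True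
      have "unity_root N 0 = 1" by (simp add: unity_root_def)
      then show ?thesis using True by simp
    next
      case False
      then show ?thesis using sum_cnj_root_powers[of j N] \<open>j \<in> {..<N}\<close> by simp
    qed
  qed
  also have "\<dots> = of_nat N * of_real (g 0)"
    using N by (simp add: sum.delta')
  finally show ?thesis .
qed

text \<open>
  The eigenvalue, for the \<open>l\<close>-th character, of the circulant matrix with coefficients \<open>P\<close>.
\<close>

definition symbol :: "nat \<Rightarrow> (nat \<Rightarrow> real) \<Rightarrow> nat \<Rightarrow> complex" where
  "symbol N P l = (\<Sum>d=1..N. of_real (P d) * unity_root N l ^ d)"

lemma symbol_cnj: "cnj (symbol N P l) = (\<Sum>d=1..N. of_real (P d) * cnj (unity_root N l) ^ d)"
  by (simp add: symbol_def)

lemma symbol_minus: "l \<le> N \<Longrightarrow> 1 \<le> N \<Longrightarrow> symbol N P (N - l) = cnj (symbol N P l)"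
  by (simp add: symbol_cnj) (simp add: symbol_def unity_root_minus)

lemma fourier_convolution:
  assumes N: "1 \<le> N"
  shows "fourier N (\<lambda>j. \<Sum>d=1..N. P d * g ((j + d) mod N)) l = symbol N P l * fourier N g l"
proof -
  have "fourier N (\<lambda>j. \<Sum>d=1..N. P d * g ((j + d) mod N)) l
    = (\<Sum>j<N. \<Sum>d=1..N. of_real (P d) * (cnj (unity_root N l) ^ j * of_real (g ((j + d) mod N))))"
    by (simp add: fourier_def sum_distrib_left ac_simps)
  also have "\<dots> = (\<Sum>d=1..N. \<Sum>j<N. of_real (P d) * (cnj (unity_root N l) ^ j * of_real (g ((j + d) mod N))))"
    by (rule sum.swap)
  also have "\<dots> = (\<Sum>d=1..N. of_real (P d) * (unity_root N l ^ d * fourier N g l))"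
    by (simp only: sum_distrib_left[symmetric] fourier_shift[OF N])
  finally show ?thesis by (simp add: symbol_def sum_distrib_right mult.assoc)
qed

lemma fourier_reflect:
  assumes N: "1 \<le> N"
  shows "fourier N (\<lambda>k. g ((N - k) mod N)) l = cnj (fourier N g l)"
proof -
  let ?w = "unity_root N l"
  have wN: "?w ^ N = 1" by (rule unity_root_power_N[OF N])
  have "fourier N (\<lambda>k. g ((N - k) mod N)) l = (\<Sum>k<N. ?w ^ ((N - k) mod N) * of_real (g ((N - k) mod N)))"
    unfolding fourier_def
  proof (intro sum.cong refl)
    fix k assume "k \<in> {..<N}"
    then have "?w ^ ((N - k) mod N) * ?w ^ k = 1"
      using wN by (simp add: power_mod_root[OF wN] power_add[symmetric])
    then have "?w ^ ((N - k) mod N) * (?w * cnj ?w) ^ k = cnj ?w ^ k"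
      by (simp only: power_mult_distrib mult.assoc[symmetric]) simp
    then show "cnj ?w ^ k * of_real (g ((N - k) mod N)) = ?w ^ ((N - k) mod N) * of_real (g ((N - k) mod N))"
      by (simp add: unity_root_cnj)
  qed
  also have "\<dots> = (\<Sum>m<N. ?w ^ m * of_real (g m))"
    by (rule sum.reindex_bij_witness[where i="\<lambda>k. (N - k) mod N" and j="\<lambda>k. (N - k) mod N"]) (use N in \<open>auto simp: mod_if\<close>)
  finally show ?thesis by (simp add: fourier_def)
qed

text \<open>
  For \<open>l \<noteq> 0\<close>, equation \<open>first\<close> gives the transform of \<open>e\<close> from that of \<open>f\<close>, and \<open>second\<close> gives the real
  part \<open>S / 2\<close> of the latter. By \<open>sym\<close> the factor \<open>R l\<close> is real, so real parts determine the sum over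
  all \<open>l \<noteq> 0\<close>; by Fourier inversion and \<open>e 0 = 0\<close> this sum is minus the transform of \<open>e\<close> at \<open>l = 0\<close>,
  that is minus the sum of the \<open>e j\<close>.
\<close>

lemma spectral_solution:
  fixes P P' f e :: "nat \<Rightarrow> real" and \<rho> L S C :: real
  assumes N: "1 \<le> N"
    and first: "\<And>j. j < N \<Longrightarrow> f j + e j = (\<Sum>d=1..N. P d * (f ((j + d) mod N) - \<rho> * (if (j + d) mod N = 0 then 1 else 0)))
        + (\<Sum>d=1..N. P' d * e ((j + d) mod N)) + L"
    and second: "\<And>k. k < N \<Longrightarrow> f k + f ((N - k) mod N) = (if k = 0 then S else 0) + C"
    and e0: "e 0 = 0"
    and ne: "\<And>l. 1 \<le> l \<Longrightarrow> l < N \<Longrightarrow> symbol N P' l \<noteq> 1"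
    and sym: "\<And>l. (1 - symbol N P l) * (1 - cnj (symbol N P' l)) = (1 - cnj (symbol N P l)) * (1 - symbol N P' l)"
  shows "of_real (\<Sum>j<N. e j) = of_real \<rho> * (\<Sum>l=1..<N. 1 / (1 - symbol N P' l))
      + of_real (S / 2 - \<rho>) * (\<Sum>l=1..<N. (1 - symbol N P l) / (1 - symbol N P' l))"
proof -
  define \<mu> where "\<mu> = symbol N P"
  define \<nu> where "\<nu> = symbol N P'"
  define R where "R l = (1 - \<mu> l) / (1 - \<nu> l)" for l
  define \<delta> :: "nat \<Rightarrow> real" where "\<delta> j = (if j = 0 then 1 else 0)" for j
  have lin: "fourier N (\<lambda>j. a * g j + c * h j) l = of_real a * fourier N g l + of_real c * fourier N h l" for a c g h l
    by (simp add: fourier_def sum_distrib_left sum.distrib ring_distribs ac_simps)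
  have fd: "fourier N \<delta> l = 1" for l
    using N by (simp add: fourier_def \<delta>_def if_distrib[where f="\<lambda>x. _ * of_real x"] sum.delta cong: if_cong)
  have fc: "fourier N (\<lambda>_. c) l = 0" if "1 \<le> l" "l < N" for l c
    using sum_cnj_root_powers[OF that] by (simp add: fourier_def sum_distrib_right[symmetric])
  have fcong: "fourier N g l = fourier N h l" if "\<And>j. j < N \<Longrightarrow> g j = h j" for g h l
    using that by (simp add: fourier_def)
  have eqe: "fourier N e l = - (of_real \<rho> * (\<mu> l / (1 - \<nu> l)) + fourier N f l * R l)" if l: "1 \<le> l" "l < N" for l
  proof -
    let ?g = "\<lambda>j. 1 * f j + (- \<rho>) * \<delta> j"
    have "fourier N f l + fourier N e l = fourier N (\<lambda>j. 1 * f j + 1 * e j) l"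
      unfolding lin by simp
    also have "\<dots> = fourier N (\<lambda>j. 1 * (1 * (\<Sum>d=1..N. P d * ?g ((j + d) mod N)) + 1 * (\<Sum>d=1..N. P' d * e ((j + d) mod N))) + 1 * L) l"
      by (rule fcong) (use first in \<open>simp add: \<delta>_def\<close>)
    also have "\<dots> = \<mu> l * (fourier N f l - of_real \<rho>) + \<nu> l * fourier N e l"
      unfolding lin fc[OF l] fourier_convolution[OF N, of P ?g l] fourier_convolution[OF N, of P' e l] lin[of 1 f "- \<rho>" \<delta>] fd \<mu>_def \<nu>_def
      by simp
    finally have "fourier N e l * (1 - \<nu> l) = - (of_real \<rho> * \<mu> l + fourier N f l * (1 - \<mu> l))"
      by (simp add: algebra_simps)
    moreover have "1 - \<nu> l \<noteq> 0" using ne[OF l] by (simp add: \<nu>_def)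
    ultimately have "fourier N e l = - (of_real \<rho> * \<mu> l + fourier N f l * (1 - \<mu> l)) / (1 - \<nu> l)"
      by (metis nonzero_mult_div_cancel_right)
    then show ?thesis by (simp only: R_def minus_divide_left[symmetric] add_divide_distrib times_divide_eq_right)
  qed
  have Re_f: "Re (fourier N f l) = S / 2" if l: "1 \<le> l" "l < N" for l
  proof -
    have "fourier N f l + cnj (fourier N f l) = fourier N (\<lambda>j. 1 * f j + 1 * f ((N - j) mod N)) l"
      unfolding lin fourier_reflect[OF N] by simp
    also have "\<dots> = fourier N (\<lambda>j. S * \<delta> j + 1 * C) l"
      by (rule fcong) (use second in \<open>simp add: \<delta>_def\<close>)
    also have "\<dots> = of_real S"
      unfolding lin fd fc[OF l] by simp
    finally have "Re (fourier N f l + cnj (fourier N f l)) = S" by simp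
    then show ?thesis by simp
  qed
  \<comment> \<open>Cross-multiplication turns \<open>sym\<close> into the equality of \<open>R l\<close> and its conjugate.\<close>
  have R_real: "cnj (R l) = R l" if l: "1 \<le> l" "l < N" for l
  proof -
    have 1: "1 - \<nu> l \<noteq> 0" using ne[OF l] by (simp add: \<nu>_def)
    then have 2: "1 - cnj (\<nu> l) \<noteq> 0" by (metis complex_cnj_cnj complex_cnj_diff complex_cnj_one complex_cnj_zero)
    show ?thesis
      using sym[of l] 1 2 unfolding R_def \<mu>_def[symmetric] \<nu>_def[symmetric]
      by (simp add: frac_eq_eq)
  qed
  \<comment> \<open>The summands of \<open>S1\<close> need not be real; conjugation exchanges \<open>l\<close> and \<open>N - l\<close>.\<close>
  define S1 where "S1 = (\<Sum>l=1..<N. 1 / (1 - \<nu> l))"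
  have S1_real: "cnj S1 = S1"
  proof -
    have "cnj S1 = (\<Sum>l=1..<N. 1 / (1 - \<nu> (N - l)))"
      unfolding S1_def cnj_sum using N by (intro sum.cong refl) (simp add: \<nu>_def symbol_minus)
    also have "\<dots> = S1"
      unfolding S1_def by (rule sum.reindex_bij_witness[where i="\<lambda>l. N - l" and j="\<lambda>l. N - l"]) auto
    finally show ?thesis .
  qed
  have "of_real (\<Sum>j<N. e j) = fourier N e 0"
    by (simp add: fourier_def unity_root_def)
  also have "\<dots> = - (\<Sum>l=1..<N. fourier N e l)"
  proof -
    have "{..<N} = insert 0 {1..<N}" using N by auto
    then have "(\<Sum>l<N. fourier N e l) = fourier N e 0 + (\<Sum>l=1..<N. fourier N e l)" by simp
    then show ?thesis using fourier_inversion_0[OF N, of e] e0 by (simp add: eq_neg_iff_add_eq_0)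
  qed
  also have "\<dots> = (\<Sum>l=1..<N. of_real \<rho> * (1 / (1 - \<nu> l)) + (fourier N f l - of_real \<rho>) * R l)"
  proof -
    have "- fourier N e l = of_real \<rho> * (1 / (1 - \<nu> l)) + (fourier N f l - of_real \<rho>) * R l" if "l \<in> {1..<N}" for l
    proof -
      have l: "1 \<le> l" "l < N" using that by auto
      have "1 - \<nu> l \<noteq> 0" using ne[OF l] by (simp add: \<nu>_def)
      then have eq: "\<mu> l / (1 - \<nu> l) = 1 / (1 - \<nu> l) - R l" by (simp add: R_def diff_divide_distrib)
      show ?thesis unfolding eqe[OF l] eq by (simp add: algebra_simps)
    qed
    then show ?thesis unfolding sum_negf[symmetric] by (intro sum.cong) auto
  qed
  finally have main: "of_real (\<Sum>j<N. e j) = of_real \<rho> * S1 + (\<Sum>l=1..<N. (fourier N f l - of_real \<rho>) * R l)"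
    by (simp only: sum.distrib sum_distrib_left[symmetric] S1_def)
  have "(\<Sum>j<N. e j) = Re (of_real \<rho> * S1 + (\<Sum>l=1..<N. (fourier N f l - of_real \<rho>) * R l))"
    unfolding main[symmetric] by simp
  also have "\<dots> = \<rho> * Re S1 + (\<Sum>l=1..<N. (S / 2 - \<rho>) * Re (R l))"
  proof -
    have "Re ((fourier N f l - of_real \<rho>) * R l) = (S / 2 - \<rho>) * Re (R l)" if "l \<in> {1..<N}" for l
    proof -
      have "Im (R l) = 0" using R_real[of l] that by (simp add: complex_eq_iff)
      then show ?thesis using Re_f[of l] that by simp
    qed
    then show ?thesis by simp
  qed
  finally have "of_real (\<Sum>j<N. e j) = of_real \<rho> * of_real (Re S1) + of_real (S / 2 - \<rho>) * (\<Sum>l=1..<N. complex_of_real (Re (R l)))"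
    by (simp add: sum_distrib_left)
  also have "of_real (Re S1) = S1" using S1_real by (simp add: complex_eq_iff)
  also have "(\<Sum>l=1..<N. complex_of_real (Re (R l))) = (\<Sum>l=1..<N. R l)"
  proof (intro sum.cong refl)
    fix l assume "l \<in> {1..<N}"
    then show "complex_of_real (Re (R l)) = R l" using R_real[of l] by (simp add: complex_eq_iff)
  qed
  finally show ?thesis unfolding S1_def R_def \<mu>_def \<nu>_def .
qed

lemma routing_eigenvalue_symbol: "routing_eigenvalue N p l = symbol N (pmf p) l"
  by (simp add: routing_eigenvalue_def symbol_def unity_root_def)

lemma routing_mat_eigenvector:
  assumes i: "i < N"
  shows "(\<Sum>j<N. of_real (routing_mat N p $$ (i, j)) * unity_root N l ^ j) = symbol N (pmf p) l * unity_root N l ^ i"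
    and "(\<Sum>j<N. of_real (routing_mat N p $$ (j, i)) * unity_root N l ^ j) = cnj (symbol N (pmf p) l) * unity_root N l ^ i"
proof -
  let ?w = "unity_root N l"
  have N: "1 \<le> N" using i by simp
  have wN: "?w ^ N = 1" by (rule unity_root_power_N[OF N])
  have "symbol N (pmf p) l * ?w ^ i = (\<Sum>d=1..N. of_real (pmf p d) * ?w ^ ((i + d) mod N))"
    unfolding symbol_def sum_distrib_right
    by (intro sum.cong refl) (simp add: power_mod_root[OF wN] power_add ac_simps)
  also have "\<dots> = (\<Sum>j<N. of_real (routing_mat N p $$ (i, j)) * ?w ^ j)"
    by (rule sum.reindex_bij_witness[where i="\<lambda>j. if i < j then j - i else N + j - i" and j="\<lambda>d. (i + d) mod N"])
       (use i in \<open>auto simp: routing_mat_def mod_if\<close>)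
  finally show "(\<Sum>j<N. of_real (routing_mat N p $$ (i, j)) * ?w ^ j) = symbol N (pmf p) l * ?w ^ i" ..
  have "cnj (symbol N (pmf p) l) * ?w ^ i = (\<Sum>d=1..N. of_real (pmf p d) * ?w ^ ((i + N - d) mod N))"
    unfolding symbol_cnj sum_distrib_right
  proof (intro sum.cong refl)
    fix d assume d: "d \<in> {1..N}"
    have "?w ^ ((i + N - d) mod N) * ?w ^ d = ?w ^ i"
      using d wN by (simp add: power_mod_root[OF wN] power_add[symmetric]) (simp add: power_add)
    then have "?w ^ ((i + N - d) mod N) * (?w * cnj ?w) ^ d = cnj ?w ^ d * ?w ^ i"
      by (simp only: power_mult_distrib mult.assoc[symmetric]) (simp only: mult.commute)
    then show "of_real (pmf p d) * cnj ?w ^ d * ?w ^ i = of_real (pmf p d) * ?w ^ ((i + N - d) mod N)"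
      by (simp add: unity_root_cnj)
  qed
  also have "\<dots> = (\<Sum>j<N. of_real (routing_mat N p $$ (j, i)) * ?w ^ j)"
    by (rule sum.reindex_bij_witness[where i="\<lambda>j. if j < i then i - j else N + i - j" and j="\<lambda>d. (i + N - d) mod N"])
       (use i in \<open>auto simp: routing_mat_def mod_if\<close>)
  finally show "(\<Sum>j<N. of_real (routing_mat N p $$ (j, i)) * ?w ^ j) = cnj (symbol N (pmf p) l) * ?w ^ i" ..
qed

lemma mat_mult_eigenvector:
  fixes A B :: "real mat" and w \<alpha> \<beta> :: complex
  assumes A: "A \<in> carrier_mat N N" and B: "B \<in> carrier_mat N N" and N: "1 \<le> N"
    and a: "(\<Sum>j<N. of_real (A $$ (0, j)) * w ^ j) = \<alpha>"
    and b: "\<And>i. i < N \<Longrightarrow> (\<Sum>j<N. of_real (B $$ (i, j)) * w ^ j) = \<beta> * w ^ i"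
  shows "(\<Sum>j<N. of_real ((A * B) $$ (0, j)) * w ^ j) = \<alpha> * \<beta>"
proof -
  have "(\<Sum>j<N. of_real ((A * B) $$ (0, j)) * w ^ j) = (\<Sum>j<N. \<Sum>m<N. of_real (A $$ (0, m)) * (of_real (B $$ (m, j)) * w ^ j))"
    using A B N by (intro sum.cong refl) (simp add: scalar_prod_def atLeast0LessThan sum_distrib_right mult.assoc)
  also have "\<dots> = (\<Sum>m<N. \<Sum>j<N. of_real (A $$ (0, m)) * (of_real (B $$ (m, j)) * w ^ j))"
    by (rule sum.swap)
  also have "\<dots> = (\<Sum>m<N. of_real (A $$ (0, m)) * (\<beta> * w ^ m))"
    unfolding sum_distrib_left[symmetric] by (simp add: b)
  also have "\<dots> = \<alpha> * \<beta>"
    unfolding a[symmetric] sum_distrib_right by (intro sum.cong refl) simp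
  finally show ?thesis .
qed

text \<open>
  The characters are common eigenvectors of the circulant matrices, with conjugate eigenvalues for
  the transposes. Comparing the entries \<open>0\<close> of both products applied to a character gives the identity.
\<close>

lemma routing_symmetry:
  assumes N: "1 \<le> N"
    and eq: "(1\<^sub>m N - routing_mat N p) * (1\<^sub>m N - transpose_mat (routing_mat N p')) =
         (1\<^sub>m N - transpose_mat (routing_mat N p)) * (1\<^sub>m N - routing_mat N p')"
  shows "(1 - symbol N (pmf p) l) * (1 - cnj (symbol N (pmf p') l)) = (1 - cnj (symbol N (pmf p) l)) * (1 - symbol N (pmf p') l)"
proof -
  let ?w = "unity_root N l"
  have dim: "routing_mat N q \<in> carrier_mat N N" for q by (simp add: routing_mat_def)
  have I: "(\<Sum>j<N. of_real (1\<^sub>m N $$ (i, j)) * ?w ^ j) = ?w ^ i" if "i < N" for i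
    using that by (simp add: one_mat_def if_distrib[where f="\<lambda>x. of_real x * _"] sum.delta cong: if_cong)
  have 1: "(\<Sum>j<N. of_real ((1\<^sub>m N - routing_mat N q) $$ (i, j)) * ?w ^ j) = (1 - symbol N (pmf q) l) * ?w ^ i" if "i < N" for i q
  proof -
    have "(\<Sum>j<N. of_real ((1\<^sub>m N - routing_mat N q) $$ (i, j)) * ?w ^ j)
      = (\<Sum>j<N. of_real (1\<^sub>m N $$ (i, j)) * ?w ^ j) - (\<Sum>j<N. of_real (routing_mat N q $$ (i, j)) * ?w ^ j)"
      unfolding sum_subtractf[symmetric] using that dim[of q] by (intro sum.cong refl) (simp add: algebra_simps)
    then show ?thesis unfolding I[OF that] routing_mat_eigenvector(1)[OF that] by (simp add: algebra_simps)
  qed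
  have 2: "(\<Sum>j<N. of_real ((1\<^sub>m N - transpose_mat (routing_mat N q)) $$ (i, j)) * ?w ^ j) = (1 - cnj (symbol N (pmf q) l)) * ?w ^ i" if "i < N" for i q
  proof -
    have "(\<Sum>j<N. of_real ((1\<^sub>m N - transpose_mat (routing_mat N q)) $$ (i, j)) * ?w ^ j)
      = (\<Sum>j<N. of_real (1\<^sub>m N $$ (i, j)) * ?w ^ j) - (\<Sum>j<N. of_real (routing_mat N q $$ (j, i)) * ?w ^ j)"
      unfolding sum_subtractf[symmetric] using that dim[of q] by (intro sum.cong refl) (simp add: algebra_simps)
    then show ?thesis unfolding I[OF that] routing_mat_eigenvector(2)[OF that] by (simp add: algebra_simps)
  qed
  have 0: "0 < N" using N by simp
  have c1: "1\<^sub>m N - routing_mat N q \<in> carrier_mat N N" "1\<^sub>m N - transpose_mat (routing_mat N q) \<in> carrier_mat N N" for q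
    using dim[of q] by (auto intro!: minus_carrier_mat)
  show ?thesis
    using mat_mult_eigenvector[OF c1(1) c1(2) N 1[OF 0] 2, of p p'] mat_mult_eigenvector[OF c1(2) c1(1) N 2[OF 0] 1, of p p']
    unfolding eq by simp
qed

section \<open>Moments of the batch sizes\<close>

context polling_model
begin

definition b where "b = measure_pmf.expectation batch real"
definition b2 where "b2 = measure_pmf.expectation batch (\<lambda>n. (real n)\<^sup>2)"

lemma batch_integrable: "integrable (measure_pmf batch) real"
  by (rule measure_pmf.square_integrable_imp_integrable) (use batch_sq in auto)

lemma mean_size_b: "mean_size = ennreal b"
  using nn_integral_eq_integral[OF batch_integrable]
  by (simp add: mean_size_def b_def ennreal_of_nat_eq_real_of_nat)

lemma mean_size2_b2: "mean_size2 = ennreal b2"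
  using nn_integral_eq_integral[OF batch_sq]
  by (simp add: mean_size2_def b2_def ennreal_of_nat_eq_real_of_nat)

lemma b_ge_1: "1 \<le> b"
  unfolding b_def
proof (rule measure_pmf.integral_ge_const[OF batch_integrable], rule AE_pmfI)
  fix n assume "n \<in> set_pmf batch"
  then have "n \<noteq> 0" using batch_pos by metis
  then show "1 \<le> real n" by simp
qed

lemma b2_nonneg: "0 \<le> b2"
  unfolding b2_def by (intro integral_nonneg_AE) simp

definition lam where "lam = rate * b"

lemma lam_pos: "0 < lam"
  using rate_pos b_ge_1 by (simp add: lam_def)

section \<open>Moments of the arrivals during one step\<close>

lemma first_step_station:
  assumes f: "(\<lambda>(q, a). f q a) \<in> borel_measurable (input_space \<Otimes>\<^sub>M station_law)"
  shows "(\<integral>\<^sup>+\<omega>. f (first_step h \<omega>) (station \<omega> i) \<partial>\<Omega>) = (\<integral>\<^sup>+q. \<integral>\<^sup>+a. f q a \<partial>station_law \<partial>step h)"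
proof -
  have "(\<lambda>x. (fst x, snd x i)) \<in> input_space \<Otimes>\<^sub>M stations_law \<rightarrow>\<^sub>M input_space \<Otimes>\<^sub>M station_law"
    by (intro measurable_Pair measurable_fst measurable_compose[OF measurable_snd measurable_component_singleton]) simp
  from measurable_compose[OF this f]
  have M: "(\<lambda>(q, A). f q (A i)) \<in> borel_measurable (input_space \<Otimes>\<^sub>M stations_law)"
    by (simp add: split_beta')
  have fq: "f q \<in> borel_measurable station_law" for q
    using measurable_compose[OF measurable_Pair1'[of q input_space station_law] f] by (simp add: space_pair_measure)
  show ?thesis
    by (subst nn_integral_first_step[of "\<lambda>q A. f q (A i)", OF M]) (simp add: st.nn_integral_component[OF fq])
qed

lemma measurable_total_fst: "(\<lambda>x. total (snd x) (snd (fst x))) \<in> input_space \<Otimes>\<^sub>M station_law \<rightarrow>\<^sub>M count_space UNIV"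
proof -
  have s: "snd \<in> input_space \<Otimes>\<^sub>M station_law \<rightarrow>\<^sub>M (\<Pi>\<^sub>M _\<in>UNIV. input_space)"
    using measurable_snd[of input_space station_law] unfolding measurable_cong_sets[OF refl sets_station_law] .
  have "(\<lambda>x. (snd x, snd (fst x))) \<in> input_space \<Otimes>\<^sub>M station_law \<rightarrow>\<^sub>M (\<Pi>\<^sub>M _\<in>UNIV. input_space) \<Otimes>\<^sub>M borel"
    by (rule measurable_Pair[OF s measurable_compose[OF measurable_fst measurable_snd]])
  from measurable_compose[OF this measurable_total] show ?thesis by simp
qed

lemma nn_integral_step_cong_nonneg:
  assumes "\<And>q. 0 \<le> snd q \<Longrightarrow> f q = g q"
  shows "(\<integral>\<^sup>+q. f q \<partial>step h) = (\<integral>\<^sup>+q. g q \<partial>step h)"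
  by (rule nn_integral_cong_AE, rule eventually_mono[OF AE_step_nonneg]) (rule assms)

lemma mult_moment:
  assumes m: "m \<in> {1, 2}" and c: "0 \<le> c"
  shows "(\<integral>\<^sup>+q. ennreal (c * snd q ^ m) \<partial>step h) = ennreal (c * moment h m)"
proof -
  have "(\<integral>\<^sup>+q. ennreal (c * snd q ^ m) \<partial>step h) = (\<integral>\<^sup>+q. ennreal c * ennreal (snd q ^ m) \<partial>step h)"
    using c by (simp add: ennreal_mult')
  also have "\<dots> = ennreal c * (\<integral>\<^sup>+q. ennreal (snd q ^ m) \<partial>step h)"
    by (rule nn_integral_cmult) (unfold measurable_cong_sets[OF sets_step refl], measurable)
  finally show ?thesis
    using nn_integral_step_moment[OF m] c by (simp add: ennreal_mult)
qed

lemma expected_total: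
  "(\<integral>\<^sup>+\<omega>. of_nat (total (station \<omega> i) (snd (first_step h \<omega>))) \<partial>\<Omega>) = ennreal (lam * moment h 1)"
proof -
  note [measurable] = measurable_total_fst
  have "(\<integral>\<^sup>+\<omega>. of_nat (total (station \<omega> i) (snd (first_step h \<omega>))) \<partial>\<Omega>)
    = (\<integral>\<^sup>+q. \<integral>\<^sup>+a. of_nat (total a (snd q)) \<partial>station_law \<partial>step h)"
    by (rule first_step_station[of "\<lambda>q a. of_nat (total a (snd q))"]) (simp add: split_beta')
  also have "\<dots> = (\<integral>\<^sup>+q. ennreal (lam * snd q ^ 1) \<partial>step h)"
    using rate_pos b_ge_1
    by (intro nn_integral_step_cong_nonneg) (simp add: nn_integral_total mean_size_b lam_def ennreal_mult[symmetric] ac_simps)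
  also have "\<dots> = ennreal (lam * moment h 1)"
    using lam_pos by (intro mult_moment) auto
  finally show ?thesis .
qed

lemma expected_total_square:
  "(\<integral>\<^sup>+\<omega>. of_nat ((total (station \<omega> i) (snd (first_step h \<omega>)))\<^sup>2) \<partial>\<Omega>)
    = ennreal (rate * b2 * moment h 1 + lam\<^sup>2 * moment h 2)"
proof -
  note [measurable] = measurable_total_fst
  have "(\<integral>\<^sup>+\<omega>. of_nat ((total (station \<omega> i) (snd (first_step h \<omega>)))\<^sup>2) \<partial>\<Omega>)
    = (\<integral>\<^sup>+q. \<integral>\<^sup>+a. of_nat ((total a (snd q))\<^sup>2) \<partial>station_law \<partial>step h)"
    by (rule first_step_station[of "\<lambda>q a. of_nat ((total a (snd q))\<^sup>2)"]) (simp add: split_beta')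
  also have "\<dots> = (\<integral>\<^sup>+q. ennreal (rate * b2 * snd q ^ 1) + ennreal (lam\<^sup>2 * snd q ^ 2) \<partial>step h)"
  proof (rule nn_integral_step_cong_nonneg)
    fix q :: "nat \<times> real" assume q: "0 \<le> snd q"
    show "(\<integral>\<^sup>+a. of_nat ((total a (snd q))\<^sup>2) \<partial>station_law) = ennreal (rate * b2 * snd q ^ 1) + ennreal (lam\<^sup>2 * snd q ^ 2)"
      unfolding nn_integral_total_square[OF q] mean_size_b mean_size2_b2
      using q rate_pos b_ge_1 b2_nonneg
      by (simp add: lam_def ennreal_mult[symmetric] ennreal_power power_mult_distrib ac_simps)
  qed
  also have "\<dots> = ennreal (rate * b2 * moment h 1) + ennreal (lam\<^sup>2 * moment h 2)"
  proof -
    have m1: "(\<lambda>q. ennreal (rate * b2 * snd q ^ 1)) \<in> borel_measurable (step h)"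
      and m2: "(\<lambda>q. ennreal (lam\<^sup>2 * snd q ^ 2)) \<in> borel_measurable (step h)"
      unfolding measurable_cong_sets[OF sets_step refl] by measurable
    show ?thesis
      unfolding nn_integral_add[OF m1 m2]
      using mult_moment[of 1 "rate * b2" h] mult_moment[of 2 "lam\<^sup>2" h] rate_pos b2_nonneg by simp
  qed
  also have "\<dots> = ennreal (rate * b2 * moment h 1 + lam\<^sup>2 * moment h 2)"
    using nn_integral_step_moment(2)[of 1 h] nn_integral_step_moment(2)[of 2 h] rate_pos b2_nonneg
    by (intro ennreal_plus[symmetric]) auto
  finally show ?thesis .
qed

text \<open>
  Given the step, the arrivals at two different stations are independent with the same mean
  \<open>lam * snd q\<close>; the random length of the step correlates them.
\<close>

lemma expected_total_product:
  assumes ij: "i \<noteq> j"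
  shows "(\<integral>\<^sup>+\<omega>. of_nat (total (station \<omega> i) (snd (first_step h \<omega>)) * total (station \<omega> j) (snd (first_step h \<omega>))) \<partial>\<Omega>)
    = ennreal (lam\<^sup>2 * moment h 2)"
proof -
  have M: "(\<lambda>x. total (snd x i) (snd (fst x))) \<in> input_space \<Otimes>\<^sub>M stations_law \<rightarrow>\<^sub>M count_space UNIV" for i
  proof -
    have "(\<lambda>x. (snd x, snd (fst x))) \<in> input_space \<Otimes>\<^sub>M stations_law \<rightarrow>\<^sub>M stations_law \<Otimes>\<^sub>M borel"
      by measurable
    from measurable_compose[OF this measurable_total_component[of i]] show ?thesis by simp
  qed
  have M2: "(\<lambda>(q, A). of_nat (total (A i) (snd q) * total (A j) (snd q)) :: ennreal) \<in> borel_measurable (input_space \<Otimes>\<^sub>M stations_law)"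
  proof -
    note [measurable] = M[of i] M[of j]
    show ?thesis unfolding split_beta' by measurable
  qed
  have T: "(\<lambda>a. of_nat (total a u) :: ennreal) \<in> borel_measurable station_law" for u by measurable
  have "(\<integral>\<^sup>+\<omega>. of_nat (total (station \<omega> i) (snd (first_step h \<omega>)) * total (station \<omega> j) (snd (first_step h \<omega>))) \<partial>\<Omega>)
    = (\<integral>\<^sup>+q. \<integral>\<^sup>+A. of_nat (total (A i) (snd q) * total (A j) (snd q)) \<partial>stations_law \<partial>step h)"
    by (rule nn_integral_first_step[OF M2])
  also have "\<dots> = (\<integral>\<^sup>+q. ennreal (lam\<^sup>2 * snd q ^ 2) \<partial>step h)"
  proof (rule nn_integral_step_cong_nonneg)
    fix q :: "nat \<times> real" assume q: "0 \<le> snd q"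
    let ?t = "\<lambda>a. of_nat (total a (snd q)) :: ennreal"
    have "(\<integral>\<^sup>+A. of_nat (total (A i) (snd q) * total (A j) (snd q)) \<partial>stations_law) = (\<integral>\<^sup>+a. ?t a \<partial>station_law) * (\<integral>\<^sup>+a. ?t a \<partial>station_law)"
    proof (cases "i < j")
      case True
      show ?thesis using st.nn_integral_two_components[OF T T True] by simp
    next
      case False
      then have "j < i" using ij by simp
      show ?thesis using st.nn_integral_two_components[OF T T \<open>j < i\<close>] by (simp add: mult.commute)
    qed
    also have "\<dots> = ennreal (lam\<^sup>2 * snd q ^ 2)"
      using q rate_pos b_ge_1
      by (simp add: nn_integral_total mean_size_b lam_def ennreal_mult[symmetric] power_mult_distrib power2_eq_square ac_simps)
    finally show "(\<integral>\<^sup>+A. of_nat (total (A i) (snd q) * total (A j) (snd q)) \<partial>stations_law) = ennreal (lam\<^sup>2 * snd q ^ 2)" .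
  qed
  also have "\<dots> = ennreal (lam\<^sup>2 * moment h 2)"
    by (intro mult_moment) auto
  finally show ?thesis .
qed

lemma measurable_delay: "(\<lambda>x. delay (snd (fst x)) (snd x)) \<in> borel_measurable (input_space \<Otimes>\<^sub>M station_law)"
proof -
  have c: "(\<lambda>x. count (snd x) (snd (fst x))) \<in> input_space \<Otimes>\<^sub>M station_law \<rightarrow>\<^sub>M count_space UNIV"
    by measurable
  have "(\<lambda>x. (\<lambda>n x. \<Sum>k<n. of_nat (fst (snd x k)) * ennreal (snd (fst x) - epoch (snd x) k)) (count (snd x) (snd (fst x))) x)
      \<in> borel_measurable (input_space \<Otimes>\<^sub>M station_law)"
    by (rule measurable_compose_countable[OF _ c]) measurable
  then show ?thesis by (simp add: delay_def)
qed

lemma expected_delay: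
  "(\<integral>\<^sup>+\<omega>. delay (snd (first_step h \<omega>)) (station \<omega> i) \<partial>\<Omega>) = ennreal (lam / 2 * moment h 2)"
proof -
  have "(\<integral>\<^sup>+\<omega>. delay (snd (first_step h \<omega>)) (station \<omega> i) \<partial>\<Omega>) = (\<integral>\<^sup>+q. \<integral>\<^sup>+a. delay (snd q) a \<partial>station_law \<partial>step h)"
    by (rule first_step_station[of "\<lambda>q a. delay (snd q) a"]) (simp add: split_beta' measurable_delay)
  also have "\<dots> = (\<integral>\<^sup>+q. ennreal (lam / 2 * snd q ^ 2) \<partial>step h)"
    using rate_pos b_ge_1
    by (intro nn_integral_step_cong_nonneg) (simp add: delay_def nn_integral_total_delay mean_size_b lam_def ennreal_mult[symmetric] ac_simps)
  also have "\<dots> = ennreal (lam / 2 * moment h 2)"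
    using lam_pos by (intro mult_moment) auto
  finally show ?thesis .
qed

section \<open>The mean waiting time as a stationary expectation\<close>

abbreviation tag_space :: "state pmf \<Rightarrow> ((state \<times> scenario) \<times> customer) measure" where
  "tag_space \<pi> \<equiv> (measure_pmf \<pi> \<Otimes>\<^sub>M \<Omega>) \<Otimes>\<^sub>M count_space UNIV"

lemma nn_integral_tag_space:
  assumes f: "f \<in> borel_measurable (tag_space \<pi>)"
  shows "(\<integral>\<^sup>+x. f x \<partial>tag_space \<pi>) = (\<integral>\<^sup>+z. \<integral>\<^sup>+\<omega>. \<integral>\<^sup>+c. f ((z, \<omega>), c) \<partial>count_space UNIV \<partial>\<Omega> \<partial>measure_pmf \<pi>)"
proof -
  interpret C: sigma_finite_measure "count_space (UNIV :: customer set)"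
    by (rule sigma_finite_measure_count_space)
  have g: "(\<lambda>y. \<integral>\<^sup>+c. f (y, c) \<partial>count_space UNIV) \<in> borel_measurable (measure_pmf \<pi> \<Otimes>\<^sub>M \<Omega>)"
    using f by (intro C.borel_measurable_nn_integral) (simp add: split_beta')
  show ?thesis
    by (simp add: C.nn_integral_fst[OF f, symmetric] \<Omega>.nn_integral_fst[OF g, symmetric])
qed

lemma measurable_tag_space:
  assumes "\<And>z c. (\<lambda>\<omega>. g z c \<omega>) \<in> borel_measurable \<Omega>"
  shows "(\<lambda>((z, \<omega>), c). g z c \<omega> :: ennreal) \<in> borel_measurable (tag_space \<pi>)"
proof -
  have fz: "(\<lambda>x. fst (fst x)) \<in> tag_space \<pi> \<rightarrow>\<^sub>M count_space UNIV"
    using measurable_compose[OF measurable_fst measurable_fst, of "measure_pmf \<pi>" \<Omega> "count_space UNIV"]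
    unfolding measurable_pmf_measure2 .
  have sc: "snd \<in> tag_space \<pi> \<rightarrow>\<^sub>M count_space UNIV"
    by (rule measurable_snd)
  have so: "(\<lambda>x. snd (fst x)) \<in> tag_space \<pi> \<rightarrow>\<^sub>M \<Omega>"
    by (rule measurable_compose[OF measurable_fst measurable_snd])
  have 1: "(\<lambda>x. g z c (snd (fst x))) \<in> borel_measurable (tag_space \<pi>)" for z c
    by (rule measurable_compose[OF so assms])
  have 2: "(\<lambda>x. g z (snd x) (snd (fst x))) \<in> borel_measurable (tag_space \<pi>)" for z
    by (rule measurable_compose_countable[where f="\<lambda>c x. g z c (snd (fst x))", OF 1 sc])
  have "(\<lambda>x. g (fst (fst x)) (snd x) (snd (fst x))) \<in> borel_measurable (tag_space \<pi>)"
    by (rule measurable_compose_countable[where f="\<lambda>z x. g z (snd x) (snd (fst x))", OF 2 fz])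
  then show ?thesis by (simp add: split_beta')
qed

lemma waiting_time_INF: "waiting_time N ((z, \<omega>), (i, k, r)) =
    (INF n. if served N z \<omega> i (snd z ! i + (\<Sum>j<k. batch_size \<omega> i j) + r) n then ennreal (poll_time N \<omega> z n - batch_time \<omega> i k) else \<infinity>)"
  using INF_set_if[of "\<lambda>n. ennreal (poll_time N \<omega> z n - batch_time \<omega> i k)" "{n. served N z \<omega> i (snd z ! i + (\<Sum>j<k. batch_size \<omega> i j) + r) n}"]
  by (simp only: waiting_time.simps served_def mem_Collect_eq)

lemma measurable_waiting_time: "(\<lambda>\<omega>. waiting_time N ((z, \<omega>), c)) \<in> borel_measurable \<Omega>"
proof -
  define i k r where "i = fst c" and "k = fst (snd c)" and "r = snd (snd c)"
  then have c: "c = (i, k, r)" by simp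
  have J: "(\<lambda>\<omega>. snd z ! i + (\<Sum>j<k. batch_size \<omega> i j) + r) \<in> \<Omega> \<rightarrow>\<^sub>M count_space UNIV"
    by measurable
  have "(\<lambda>\<omega>. (\<lambda>l \<omega>. INF n. if served N z \<omega> i l n then ennreal (poll_time N \<omega> z n - batch_time \<omega> i k) else \<infinity>)
      (snd z ! i + (\<Sum>j<k. batch_size \<omega> i j) + r) \<omega>) \<in> borel_measurable \<Omega>"
    by (rule measurable_compose_countable[OF _ J]) measurable
  then show ?thesis unfolding c waiting_time_INF by simp
qed

lemma measurable_arriving: "(\<lambda>\<omega>. indicator (arriving z \<omega>) c :: ennreal) \<in> borel_measurable \<Omega>"
proof -
  define i k r where "i = fst c" and "k = fst (snd c)" and "r = snd (snd c)"
  then have c: "c = (i, k, r)" by simp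
  let ?S = "{\<omega> \<in> space \<Omega>. i < N \<and> r < batch_size \<omega> i k \<and> 0 < batch_time \<omega> i k \<and> batch_time \<omega> i k \<le> poll_time N \<omega> z (Suc 0)}"
  have "{\<omega> \<in> space \<Omega>. i < N \<and> r < batch_size \<omega> i k} \<in> sets \<Omega>"
    using measurable_sets[OF measurable_batch_size[of i k], of "{m. i < N \<and> r < m}"] by (simp add: vimage_def)
  moreover have "{\<omega> \<in> space \<Omega>. 0 < batch_time \<omega> i k} \<in> sets \<Omega>"
    by (rule borel_measurable_less[OF borel_measurable_const measurable_batch_time])
  moreover have "{\<omega> \<in> space \<Omega>. batch_time \<omega> i k \<le> poll_time N \<omega> z (Suc 0)} \<in> sets \<Omega>"
    by (rule borel_measurable_le[OF measurable_batch_time measurable_poll_time])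
  ultimately have "{\<omega> \<in> space \<Omega>. i < N \<and> r < batch_size \<omega> i k} \<inter> ({\<omega> \<in> space \<Omega>. 0 < batch_time \<omega> i k}
      \<inter> {\<omega> \<in> space \<Omega>. batch_time \<omega> i k \<le> poll_time N \<omega> z (Suc 0)}) \<in> sets \<Omega>"
    by (intro sets.Int)
  also have "{\<omega> \<in> space \<Omega>. i < N \<and> r < batch_size \<omega> i k} \<inter> ({\<omega> \<in> space \<Omega>. 0 < batch_time \<omega> i k}
      \<inter> {\<omega> \<in> space \<Omega>. batch_time \<omega> i k \<le> poll_time N \<omega> z (Suc 0)}) = ?S"
    by auto
  finally have S: "?S \<in> sets \<Omega>" .
  have e: "c \<in> arriving z \<omega> \<longleftrightarrow> \<omega> \<in> ?S" for \<omega>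
    unfolding c arriving_def by simp
  have "(\<lambda>\<omega>. indicator ?S \<omega> :: ennreal) \<in> borel_measurable \<Omega>"
    using S by (rule borel_measurable_indicator)
  then show ?thesis
    unfolding indicator_def e .
qed

definition tagged :: "((state \<times> scenario) \<times> customer) set" where
  "tagged = {((z, \<omega>), (i, k, r)). i < N \<and> r < batch_size \<omega> i k \<and>
          0 < batch_time \<omega> i k \<and> batch_time \<omega> i k \<le> poll_time N \<omega> z 1}"

lemma tagged_iff: "((z, \<omega>), c) \<in> tagged \<longleftrightarrow> c \<in> arriving z \<omega>"
  by (cases c) (simp add: tagged_def arriving_def)

lemma indicator_tagged: "indicator tagged ((z, \<omega>), c) = indicator (arriving z \<omega>) c"
  by (simp only: indicator_def tagged_iff)

lemma tagged_sets: "tagged \<in> sets (tag_space \<pi>)"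
proof -
  let ?f = "\<lambda>((z, \<omega>), c). indicator (arriving z \<omega>) c :: ennreal"
  have m: "?f \<in> borel_measurable (tag_space \<pi>)"
    by (rule measurable_tag_space) (rule measurable_arriving)
  have "((z, \<omega>), c) \<in> tagged \<longleftrightarrow> ((z, \<omega>), c) \<in> ?f -` {1} \<inter> space (tag_space \<pi>)" for z \<omega> c
    by (simp add: tagged_iff space_pair_measure indicator_def)
  then have "tagged = ?f -` {1} \<inter> space (tag_space \<pi>)"
    by (intro equalityI subrelI subsetI) (auto simp only: split_paired_all)
  with measurable_sets[OF m, of "{1}"] show ?thesis by simp
qed

text \<open>
  The denominator is the mean number of customers arriving in a step. The numerator is their mean total
  waiting time, which consists of the wait before the next polling instant and, by the Markov property,
  of \<open>new_wait\<close>, evaluated by Little's law.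
\<close>

lemma mean_waiting_time_eq:
  assumes st: "stationary \<Omega> N \<pi>" and irr: "irreducible_chain \<Omega> N"
    and fin: "(\<integral>\<^sup>+z. of_nat (queue_total N z) \<partial>measure_pmf \<pi>) < \<infinity>"
  shows "mean_waiting_time \<Omega> N \<pi> =
    ((\<integral>\<^sup>+z. ennreal (real N * (lam / 2 * moment (nonempty z) 2)) \<partial>measure_pmf \<pi>)
      + (\<integral>\<^sup>+z. of_nat (total_after N z) * ennreal (moment (nonempty z) 1) \<partial>measure_pmf \<pi>))
    / (\<integral>\<^sup>+z. ennreal (real N * (lam * moment (nonempty z) 1)) \<partial>measure_pmf \<pi>)"
proof -
  have sp: "AE z in measure_pmf \<pi>. z \<in> states N"
    using st by (intro AE_pmfI) (auto simp: stationary_def)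
  have W: "waiting_time N \<in> borel_measurable (tag_space \<pi>)"
  proof -
    have m: "(\<lambda>((z, \<omega>), c). waiting_time N ((z, \<omega>), c)) \<in> borel_measurable (tag_space \<pi>)"
      by (rule measurable_tag_space) (rule measurable_waiting_time)
    show ?thesis
      by (rule measurable_cong[THEN iffD1, OF _ m]) (simp add: split_beta')
  qed
  have tc: "tagged_customer \<Omega> N \<pi> = uniform_measure (tag_space \<pi>) tagged"
    unfolding tagged_customer_def tagged_def by (rule refl)
  have mean: "mean_waiting_time \<Omega> N \<pi> = (\<integral>\<^sup>+x. waiting_time N x * indicator tagged x \<partial>tag_space \<pi>) / emeasure (tag_space \<pi>) tagged"
    unfolding mean_waiting_time_def tc
    by (rule nn_integral_uniform_measure[OF W tagged_sets])
  have den: "emeasure (tag_space \<pi>) tagged = (\<integral>\<^sup>+z. ennreal (real N * (lam * moment (nonempty z) 1)) \<partial>measure_pmf \<pi>)"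
  proof -
    have "emeasure (tag_space \<pi>) tagged = (\<integral>\<^sup>+x. indicator tagged x \<partial>tag_space \<pi>)"
      by (rule nn_integral_indicator[OF tagged_sets, symmetric])
    also have "\<dots> = (\<integral>\<^sup>+z. \<integral>\<^sup>+\<omega>. \<integral>\<^sup>+c. 1 * indicator (arriving z \<omega>) c \<partial>count_space UNIV \<partial>\<Omega> \<partial>measure_pmf \<pi>)"
      using nn_integral_tag_space[OF borel_measurable_indicator[OF tagged_sets], of \<pi>] by (simp add: indicator_tagged)
    also have "\<dots> = (\<integral>\<^sup>+z. \<integral>\<^sup>+\<omega>. (\<Sum>i<N. of_nat (total (station \<omega> i) (snd (first_step (nonempty z) \<omega>)))) \<partial>\<Omega> \<partial>measure_pmf \<pi>)"
    proof (rule nn_integral_cong, rule nn_integral_cong_AE)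
      fix z
      show "AE \<omega> in \<Omega>. (\<integral>\<^sup>+c. 1 * indicator (arriving z \<omega>) c \<partial>count_space UNIV) = (\<Sum>i<N. of_nat (total (station \<omega> i) (snd (first_step (nonempty z) \<omega>))))"
        by (rule eventually_mono[OF AE_nice], subst sum_arriving) (simp_all add: total_def batch_size_station poll_time_1)
    qed
    also have "\<dots> = (\<integral>\<^sup>+z. ennreal (real N * (lam * moment (nonempty z) 1)) \<partial>measure_pmf \<pi>)"
    proof (rule nn_integral_cong)
      fix z
      have M: "(\<lambda>\<omega>. of_nat (total (station \<omega> i) (snd (first_step (nonempty z) \<omega>))) :: ennreal) \<in> borel_measurable \<Omega>" for i
      proof -
        have "(\<lambda>\<omega>. (station \<omega>, snd (first_step (nonempty z) \<omega>))) \<in> \<Omega> \<rightarrow>\<^sub>M stations_law \<Otimes>\<^sub>M borel"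
          by measurable
        from measurable_compose[OF this measurable_total_component[of i]] show ?thesis by simp
      qed
      show "(\<integral>\<^sup>+\<omega>. (\<Sum>i<N. of_nat (total (station \<omega> i) (snd (first_step (nonempty z) \<omega>)))) \<partial>\<Omega>) = ennreal (real N * (lam * moment (nonempty z) 1))"
        unfolding nn_integral_sum[OF M] expected_total
        by (simp add: ennreal_mult' ennreal_of_nat_eq_real_of_nat)
    qed
    finally show ?thesis .
  qed
  have num: "(\<integral>\<^sup>+x. waiting_time N x * indicator tagged x \<partial>tag_space \<pi>)
    = (\<integral>\<^sup>+z. ennreal (real N * (lam / 2 * moment (nonempty z) 2)) + new_wait mean_rest z \<partial>measure_pmf \<pi>)"
  proof -
    have WT: "(\<lambda>x. waiting_time N x * indicator tagged x) \<in> borel_measurable (tag_space \<pi>)"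
      using tagged_sets by (intro borel_measurable_times_ennreal W borel_measurable_indicator) auto
    have "(\<integral>\<^sup>+x. waiting_time N x * indicator tagged x \<partial>tag_space \<pi>)
      = (\<integral>\<^sup>+z. \<integral>\<^sup>+\<omega>. \<integral>\<^sup>+c. waiting_time N ((z, \<omega>), c) * indicator (arriving z \<omega>) c \<partial>count_space UNIV \<partial>\<Omega> \<partial>measure_pmf \<pi>)"
      by (subst nn_integral_tag_space[OF WT]) (simp only: indicator_tagged)
    also have "\<dots> = (\<integral>\<^sup>+z. ennreal (real N * (lam / 2 * moment (nonempty z) 2)) + new_wait mean_rest z \<partial>measure_pmf \<pi>)"
    proof (rule nn_integral_cong_AE, rule eventually_mono[OF sp])
      fix z assume z: "z \<in> states N"
      let ?R = "\<lambda>y \<omega>'. \<Sum>i<N. \<Sum>j\<in>{after_poll z i..<snd y ! i}. rest N y \<omega>' i j"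
      have R: "?R y \<in> borel_measurable \<Omega>" for y by measurable
      have D: "(\<lambda>\<omega>. delay (snd (first_step (nonempty z) \<omega>)) (station \<omega> i)) \<in> borel_measurable \<Omega>" for i
      proof -
        have "(\<lambda>\<omega>. (first_step (nonempty z) \<omega>, station \<omega> i)) \<in> \<Omega> \<rightarrow>\<^sub>M input_space \<Otimes>\<^sub>M station_law"
          by (intro measurable_Pair measurable_first_step measurable_compose[OF measurable_stations measurable_component_singleton]) simp
        from measurable_compose[OF this measurable_delay] show ?thesis by simp
      qed
      have sh: "(\<lambda>\<omega>. next_scenario N z \<omega>) \<in> \<Omega> \<rightarrow>\<^sub>M \<Omega>" by measurable
      have RM: "(\<lambda>\<omega>. ?R (next_state N z \<omega>) (next_scenario N z \<omega>)) \<in> borel_measurable \<Omega>"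
        by (rule measurable_compose_countable[where f="\<lambda>y \<omega>. ?R y (next_scenario N z \<omega>)", OF measurable_compose[OF sh R] measurable_chain])
      have "(\<integral>\<^sup>+\<omega>. \<integral>\<^sup>+c. waiting_time N ((z, \<omega>), c) * indicator (arriving z \<omega>) c \<partial>count_space UNIV \<partial>\<Omega>)
        = (\<integral>\<^sup>+\<omega>. (\<Sum>i<N. delay (snd (first_step (nonempty z) \<omega>)) (station \<omega> i)) + ?R (next_state N z \<omega>) (next_scenario N z \<omega>) \<partial>\<Omega>)"
        by (rule nn_integral_cong_AE, rule eventually_mono[OF AE_nice]) (simp only: sum_waiting[OF _ z] poll_time_1)
      also have "\<dots> = (\<integral>\<^sup>+\<omega>. (\<Sum>i<N. delay (snd (first_step (nonempty z) \<omega>)) (station \<omega> i)) \<partial>\<Omega>)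
          + (\<integral>\<^sup>+\<omega>. ?R (next_state N z \<omega>) (next_scenario N z \<omega>) \<partial>\<Omega>)"
        by (rule nn_integral_add[OF borel_measurable_sum[OF D] RM])
      also have "(\<integral>\<^sup>+\<omega>. (\<Sum>i<N. delay (snd (first_step (nonempty z) \<omega>)) (station \<omega> i)) \<partial>\<Omega>) = ennreal (real N * (lam / 2 * moment (nonempty z) 2))"
        unfolding nn_integral_sum[OF D] expected_delay
        by (simp add: ennreal_of_nat_eq_real_of_nat ennreal_mult'[symmetric])
      also have "(\<integral>\<^sup>+\<omega>. ?R (next_state N z \<omega>) (next_scenario N z \<omega>) \<partial>\<Omega>) = (\<integral>\<^sup>+\<omega>. \<integral>\<^sup>+\<omega>'. ?R (next_state N z \<omega>) \<omega>' \<partial>\<Omega> \<partial>\<Omega>)"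
        by (rule markov[of ?R]) (rule R)
      also have "\<dots> = new_wait mean_rest z"
        unfolding new_wait_def mean_rest_def by (simp add: nn_integral_sum)
      finally show "(\<integral>\<^sup>+\<omega>. \<integral>\<^sup>+c. waiting_time N ((z, \<omega>), c) * indicator (arriving z \<omega>) c \<partial>count_space UNIV \<partial>\<Omega>)
        = ennreal (real N * (lam / 2 * moment (nonempty z) 2)) + new_wait mean_rest z" .
    qed
    finally show ?thesis .
  qed
  have "(\<integral>\<^sup>+z. ennreal (real N * (lam / 2 * moment (nonempty z) 2)) + new_wait mean_rest z \<partial>measure_pmf \<pi>)
    = (\<integral>\<^sup>+z. ennreal (real N * (lam / 2 * moment (nonempty z) 2)) \<partial>measure_pmf \<pi>)
      + (\<integral>\<^sup>+z. of_nat (total_after N z) * ennreal (moment (nonempty z) 1) \<partial>measure_pmf \<pi>)"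
    by (subst nn_integral_add) (simp_all add: little[OF st irr fin])
  then show ?thesis
    by (simp only: mean den num)
qed

end

section \<open>Stationary balance equations\<close>

text \<open>
  Removing \<open>h\<close> customers at station \<open>s\<close> changes the correlation at lag \<open>k\<close> in the two terms that contain
  \<open>s\<close>, which coincide for \<open>k = 0\<close>. The index \<open>(s + (N - k) mod N) mod N\<close> is \<open>s - k\<close> in the cyclic group.
\<close>

lemma product_sum_removed:
  fixes x :: "nat \<Rightarrow> real" and h :: real and N s k :: nat
  assumes s: "s < N" and k: "k < N"
  defines "a \<equiv> \<lambda>i. x i - (if i = s then h else 0)"
  shows "(\<Sum>i<N. a i * a ((i + k) mod N)) = (\<Sum>i<N. x i * x ((i + k) mod N))
    - h * x ((s + k) mod N) - h * x ((s + (N - k) mod N) mod N) + (if k = 0 then h * h else 0)"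
proof -
  let ?t = "(s + (N - k) mod N) mod N"
  have t: "(i + k) mod N = s \<longleftrightarrow> i = ?t" if "i < N" for i
    using that s k by (auto simp: mod_if)
  have tN: "?t < N" using s by simp
  have "(\<Sum>i<N. a i * a ((i + k) mod N)) = (\<Sum>i<N. x i * x ((i + k) mod N)
      - (if i = s then h * x ((i + k) mod N) else 0) - (if i = ?t then h * x i else 0)
      + (if i = s then (if i = ?t then h * h else 0) else 0))"
    by (intro sum.cong refl) (simp add: a_def t algebra_simps)
  also have "\<dots> = (\<Sum>i<N. x i * x ((i + k) mod N)) - h * x ((s + k) mod N) - h * x ?t + (if s = ?t then h * h else 0)"
    using s tN by (simp add: sum.distrib sum_subtractf sum.delta)
  also have "s = ?t \<longleftrightarrow> k = 0"
    using s k by (auto simp: mod_if)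
  finally show ?thesis .
qed

locale stationary_polling = polling_model +
  fixes \<pi> :: "state pmf"
  assumes st: "stationary \<Omega> N \<pi>" and irr: "irreducible_chain \<Omega> N"
    and sq: "\<And>i. i < N \<Longrightarrow> integrable (measure_pmf \<pi>) (\<lambda>(s, x). (real (x ! i))\<^sup>2)"
begin

abbreviation E :: "(state \<Rightarrow> real) \<Rightarrow> real" where "E \<equiv> measure_pmf.expectation \<pi>"

abbreviation integ :: "(state \<Rightarrow> real) \<Rightarrow> bool" where "integ \<equiv> integrable (measure_pmf \<pi>)"

lemma AE_states: "AE z in measure_pmf \<pi>. z \<in> states N"
  using st by (intro AE_pmfI) (auto simp: stationary_def)

lemma expectation_cong: "(\<And>z. z \<in> states N \<Longrightarrow> f z = g z) \<Longrightarrow> E f = E g" for f g :: "state \<Rightarrow> real"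
  by (rule integral_cong_AE) (auto intro: eventually_mono[OF AE_states])

text \<open>
  For the real-valued balance equations the integrability of the drift \<open>G\<close> has to be known; it is
  inherited from \<open>F\<close>, since both have the same nonnegative integral.
\<close>

lemma stationary_real:
  assumes F: "\<And>z. 0 \<le> F z" "integ F"
    and G: "\<And>z. z \<in> states N \<Longrightarrow> 0 \<le> G z"
    and ex: "\<And>z. z \<in> states N \<Longrightarrow> expect (\<lambda>y. ennreal (F y)) z = ennreal (G z)"
  shows "integ G" "E G = E F"
proof -
  have "(\<integral>\<^sup>+z. ennreal (G z) \<partial>measure_pmf \<pi>) = (\<integral>\<^sup>+z. expect (\<lambda>y. ennreal (F y)) z \<partial>measure_pmf \<pi>)"
    by (rule nn_integral_cong_AE, rule eventually_mono[OF AE_states]) (simp add: ex)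
  also have "\<dots> = (\<integral>\<^sup>+z. ennreal (F z) \<partial>measure_pmf \<pi>)"
    by (rule stationary_expect[OF st])
  also have "\<dots> = ennreal (E F)"
    by (rule nn_integral_eq_integral) (use F in auto)
  finally have e: "(\<integral>\<^sup>+z. ennreal (G z) \<partial>measure_pmf \<pi>) = ennreal (E F)" .
  have nn: "AE z in measure_pmf \<pi>. 0 \<le> G z"
    by (rule eventually_mono[OF AE_states]) (rule G)
  show iG: "integ G"
    by (rule integrableI_nonneg) (use nn e in auto)
  have "ennreal (E G) = ennreal (E F)"
    using nn_integral_eq_integral[OF iG nn] e by simp
  moreover have "0 \<le> E G" "0 \<le> E F"
    using nn F by (auto intro: integral_nonneg_AE)
  ultimately show "E G = E F" by simp
qed

definition busy :: "state \<Rightarrow> real" where "busy z = (if nonempty z then 1 else 0)"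

definition ahead :: "nat \<Rightarrow> state \<Rightarrow> real" where "ahead j z = real (snd z ! ((fst z + j) mod N))"

definition corr :: "nat \<Rightarrow> state \<Rightarrow> nat" where
  "corr k z = (\<Sum>i<N. snd z ! i * snd z ! ((i + k) mod N))"

lemma busy_bounds: "0 \<le> busy z" "busy z \<le> 1" "busy z * busy z = busy z"
  by (auto simp: busy_def)

lemma ahead_nonneg: "0 \<le> ahead j z"
  by (simp add: ahead_def)

lemma moment_busy: "moment (nonempty z) m = busy z * moment True m + (1 - busy z) * moment False m"
  by (simp add: busy_def)

lemma sq_queue: "i < N \<Longrightarrow> integ (\<lambda>z. (real (snd z ! i))\<^sup>2)"
  using sq[of i] unfolding split_beta' .

lemma int_queue: "i < N \<Longrightarrow> integ (\<lambda>z. real (snd z ! i))"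
  by (rule measure_pmf.square_integrable_imp_integrable[OF _ sq_queue]) simp_all

lemma int_queue_product: assumes "i < N" "j < N" shows "integ (\<lambda>z. real (snd z ! i) * real (snd z ! j))"
proof (rule Bochner_Integration.integrable_bound)
  show "integ (\<lambda>z. (real (snd z ! i))\<^sup>2 + (real (snd z ! j))\<^sup>2)"
    by (intro Bochner_Integration.integrable_add sq_queue assms)
  show "AE z in measure_pmf \<pi>. norm (real (snd z ! i) * real (snd z ! j)) \<le> norm ((real (snd z ! i))\<^sup>2 + (real (snd z ! j))\<^sup>2)"
  proof (rule AE_I2)
    fix z :: state
    have "2 * (real (snd z ! i) * real (snd z ! j)) \<le> (real (snd z ! i))\<^sup>2 + (real (snd z ! j))\<^sup>2"
      using sum_squares_bound[of "real (snd z ! i)" "real (snd z ! j)"] by simp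
    moreover have "0 \<le> real (snd z ! i) * real (snd z ! j)" by simp
    ultimately have "real (snd z ! i) * real (snd z ! j) \<le> (real (snd z ! i))\<^sup>2 + (real (snd z ! j))\<^sup>2"
      by linarith
    then show "norm (real (snd z ! i) * real (snd z ! j)) \<le> norm ((real (snd z ! i))\<^sup>2 + (real (snd z ! j))\<^sup>2)"
      by simp
  qed
qed simp

lemma int_queue_total: "integ (\<lambda>z. real (queue_total N z))"
  unfolding queue_total_def of_nat_sum by (intro Bochner_Integration.integrable_sum int_queue) simp

lemma int_corr: "integ (\<lambda>z. real (corr k z))"
  unfolding corr_def of_nat_sum of_nat_mult
  using N_pos by (intro Bochner_Integration.integrable_sum int_queue_product) auto

lemma int_bounded: "(\<And>z. \<bar>f z\<bar> \<le> real (queue_total N z)) \<Longrightarrow> integ f"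
  by (rule Bochner_Integration.integrable_bound[OF int_queue_total]) auto

lemma ahead_le: "ahead j z \<le> real (queue_total N z)"
proof -
  have "snd z ! ((fst z + j) mod N) \<le> (\<Sum>i<N. snd z ! i)"
    using N_pos by (intro member_le_sum) auto
  then have "real (snd z ! ((fst z + j) mod N)) \<le> real (\<Sum>i<N. snd z ! i)"
    by (rule of_nat_mono)
  then show ?thesis by (simp only: ahead_def queue_total_def)
qed

lemma int_ahead: "integ (ahead j)"
  using ahead_le ahead_nonneg by (intro int_bounded) simp

lemma int_busy_ahead: "integ (\<lambda>z. busy z * ahead j z)"
proof (rule int_bounded)
  fix z show "\<bar>busy z * ahead j z\<bar> \<le> real (queue_total N z)"
    using ahead_le[of j z] ahead_nonneg[of j z] by (simp add: busy_def)
qed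

lemma int_idle_ahead: "integ (\<lambda>z. (1 - busy z) * ahead j z)"
proof (rule int_bounded)
  fix z show "\<bar>(1 - busy z) * ahead j z\<bar> \<le> real (queue_total N z)"
    using ahead_le[of j z] ahead_nonneg[of j z] by (simp add: busy_def)
qed

lemma int_busy: "integ busy"
  by (rule measure_pmf.integrable_const_bound[where B=1]) (auto simp: busy_def)

definition ahead_busy where "ahead_busy j = E (\<lambda>z. busy z * ahead j z)"
definition ahead_idle where "ahead_idle j = E (\<lambda>z. (1 - busy z) * ahead j z)"
text \<open>
  The probability that the polled station is nonempty, and the moments of the time between two
  polling instants in the stationary regime.
\<close>

definition \<rho> where "\<rho> = E busy"
definition \<tau> where "\<tau> m = \<rho> * moment True m + (1 - \<rho>) * moment False m"

lemma E_moment: "E (\<lambda>z. moment (nonempty z) m) = \<tau> m" "integ (\<lambda>z. moment (nonempty z) m)"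
  unfolding moment_busy \<tau>_def \<rho>_def using int_busy by (simp_all add: left_diff_distrib)

lemma E_ahead: "E (ahead j) = ahead_busy j + ahead_idle j"
proof -
  have "E (ahead j) = E (\<lambda>z. busy z * ahead j z + (1 - busy z) * ahead j z)" by (simp add: left_diff_distrib)
  then show ?thesis unfolding ahead_busy_def ahead_idle_def by (simp only: Bochner_Integration.integral_add[OF int_busy_ahead int_idle_ahead])
qed

lemma ahead_0: "z \<in> states N \<Longrightarrow> (1 - busy z) * ahead 0 z = 0"
  by (auto simp: ahead_def busy_def nonempty_def states_def)

lemma ahead_idle_0: "ahead_idle 0 = 0"
proof -
  have "ahead_idle 0 = E (\<lambda>z. 0)" unfolding ahead_idle_def by (rule expectation_cong) (rule ahead_0)
  then show ?thesis by simp
qed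

lemma after_poll_busy: "real (after_poll z i) = real (snd z ! i) - (if i = fst z then busy z else 0)"
proof (cases "i = fst z \<and> nonempty z")
  case True
  then have "1 \<le> snd z ! i" by (simp add: nonempty_def)
  then show ?thesis using True by (simp add: after_poll_def busy_def of_nat_diff)
next
  case False
  then show ?thesis by (auto simp: after_poll_def busy_def nonempty_def)
qed

lemma after_poll_ahead:
  assumes "z \<in> states N"
  shows "real (after_poll z ((fst z + j) mod N)) = ahead j z - busy z * (if j mod N = 0 then 1 else 0)"
proof -
  have s: "fst z < N" using assms by (simp add: states_def split_beta')
  have "(fst z + j) mod N = fst z \<longleftrightarrow> j mod N = 0"
  proof -
    have "(fst z + j) mod N = (fst z + j mod N) mod N" by (simp add: mod_add_right_eq)
    moreover have "j mod N < N" using s by simp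
    moreover have "(a + t) mod N = a \<longleftrightarrow> t = 0" if "a < N" "t < N" for a t
      using that by (auto simp: mod_if)
    ultimately show ?thesis using s by (simp only:)
  qed
  then show ?thesis unfolding after_poll_busy ahead_def by simp
qed

definition jump_law :: "bool \<Rightarrow> nat pmf" where "jump_law h = (if h then p else p')"

lemma nn_integral_step_jump:
  "(\<integral>\<^sup>+q. \<phi> (fst q) \<partial>step h) = (\<Sum>d=1..N. ennreal (pmf (jump_law h) d) * \<phi> d)"
proof -
  have m: "(\<lambda>q. \<phi> (fst q)) \<in> borel_measurable input_space" by measurable
  have "(\<integral>\<^sup>+t. c \<partial>H d) = c" "(\<integral>\<^sup>+t. c \<partial>H' d) = c" for c d
    using prob_space.emeasure_space_1[OF H_prob[of d]] prob_space.emeasure_space_1[OF H'_prob[of d]] by simp_all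
  then show ?thesis
    using nn_integral_step_law[OF H_prob H_sets p_set m] nn_integral_step_law[OF H'_prob H'_sets p'_set m]
    by (cases h) (simp_all add: step_def jump_law_def)
qed

lemma expect_ahead:
  assumes z: "z \<in> states N"
  shows "expect (\<lambda>y. ennreal (ahead j y)) z
    = ennreal ((\<Sum>d=1..N. pmf (jump_law (nonempty z)) d * real (after_poll z ((fst z + (j + d)) mod N))) + lam * moment (nonempty z) 1)"
proof -
  let ?h = "nonempty z"
  let ?i = "\<lambda>d. (fst z + (j + d)) mod N"
  let ?g = "\<lambda>q A. of_nat (after_poll z (?i (fst q))) + of_nat (total (A (?i (fst q))) (snd q)) :: ennreal"
  have M1: "(\<lambda>x. total (snd x i) (snd (fst x))) \<in> input_space \<Otimes>\<^sub>M stations_law \<rightarrow>\<^sub>M count_space UNIV" for i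
  proof -
    have "(\<lambda>x. (snd x, snd (fst x))) \<in> input_space \<Otimes>\<^sub>M stations_law \<rightarrow>\<^sub>M stations_law \<Otimes>\<^sub>M borel"
      by measurable
    from measurable_compose[OF this measurable_total_component[of i]] show ?thesis by simp
  qed
  have d: "(\<lambda>x. fst (fst x)) \<in> input_space \<Otimes>\<^sub>M stations_law \<rightarrow>\<^sub>M count_space UNIV" by measurable
  have M2: "(\<lambda>x. of_nat (after_poll z (?i d)) + of_nat (total (snd x (?i d)) (snd (fst x))) :: ennreal) \<in> borel_measurable (input_space \<Otimes>\<^sub>M stations_law)" for d
    using M1[of "?i d"] by measurable
  have M: "(\<lambda>(q, A). ?g q A) \<in> borel_measurable (input_space \<Otimes>\<^sub>M stations_law)"
    unfolding split_beta'
    by (rule measurable_compose_countable[where f="\<lambda>d x. of_nat (after_poll z (?i d)) + of_nat (total (snd x (?i d)) (snd (fst x)))", OF M2 d])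
  have T: "(\<lambda>a. of_nat (total a u) :: ennreal) \<in> borel_measurable station_law" for u by measurable
  have TA: "(\<lambda>A. of_nat (total (A i) u) :: ennreal) \<in> borel_measurable stations_law" for i u
    by (rule measurable_compose[where f="\<lambda>A. A i" and N=station_law, OF measurable_component_singleton T]) simp
  have Ym: "ennreal (ahead j (successor N z (fst q, totals N A (snd q)))) = ?g q A" for q A
  proof -
    have i: "((fst z + fst q) mod N + j) mod N = ?i (fst q)"
      unfolding mod_add_left_eq by (simp only: ac_simps)
    have "?i (fst q) < N" using N_pos by simp
    then show ?thesis
      by (simp add: ahead_def successor_def totals_def i ennreal_of_nat_eq_real_of_nat)
  qed
  have "expect (\<lambda>y. ennreal (ahead j y)) z = (\<integral>\<^sup>+\<omega>. ?g (first_step ?h \<omega>) (station \<omega>) \<partial>\<Omega>)"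
    unfolding expect_def
    by (rule nn_integral_cong_AE, rule eventually_mono[OF AE_nice]) (simp only: chain_successor Ym)
  also have "\<dots> = (\<integral>\<^sup>+q. \<integral>\<^sup>+A. ?g q A \<partial>stations_law \<partial>step ?h)"
    by (rule nn_integral_first_step[OF M])
  also have "\<dots> = (\<integral>\<^sup>+q. of_nat (after_poll z (?i (fst q))) + ennreal (lam * snd q ^ 1) \<partial>step ?h)"
  proof (rule nn_integral_step_cong_nonneg)
    fix q :: "nat \<times> real" assume q: "0 \<le> snd q"
    have "(\<integral>\<^sup>+A. ?g q A \<partial>stations_law) = of_nat (after_poll z (?i (fst q))) + (\<integral>\<^sup>+A. of_nat (total (A (?i (fst q))) (snd q)) \<partial>stations_law)"
      by (subst nn_integral_add) (use TA st.P.emeasure_space_1 in auto)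
    also have "(\<integral>\<^sup>+A. of_nat (total (A (?i (fst q))) (snd q)) \<partial>stations_law) = ennreal (lam * snd q ^ 1)"
      using q rate_pos b_ge_1
      by (simp add: st.nn_integral_component[OF T] nn_integral_total mean_size_b lam_def ennreal_mult[symmetric] ac_simps)
    finally show "(\<integral>\<^sup>+A. ?g q A \<partial>stations_law) = of_nat (after_poll z (?i (fst q))) + ennreal (lam * snd q ^ 1)" .
  qed
  also have "\<dots> = (\<integral>\<^sup>+q. of_nat (after_poll z (?i (fst q))) \<partial>step ?h) + (\<integral>\<^sup>+q. ennreal (lam * snd q ^ 1) \<partial>step ?h)"
  proof (rule nn_integral_add)
    show "(\<lambda>q. of_nat (after_poll z (?i (fst q))) :: ennreal) \<in> borel_measurable (step ?h)"
      "(\<lambda>q. ennreal (lam * snd q ^ 1)) \<in> borel_measurable (step ?h)"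
      unfolding measurable_cong_sets[OF sets_step refl] by measurable
  qed
  also have "(\<integral>\<^sup>+q. of_nat (after_poll z (?i (fst q))) \<partial>step ?h) = (\<Sum>d=1..N. ennreal (pmf (jump_law ?h) d) * of_nat (after_poll z (?i d)))"
    by (rule nn_integral_step_jump)
  also have "\<dots> = ennreal (\<Sum>d=1..N. pmf (jump_law ?h) d * real (after_poll z (?i d)))"
    by (subst sum_ennreal[symmetric]) (auto simp: ennreal_mult ennreal_of_nat_eq_real_of_nat)
  also have "(\<integral>\<^sup>+q. ennreal (lam * snd q ^ 1) \<partial>step ?h) = ennreal (lam * moment ?h 1)"
    using lam_pos by (intro mult_moment) auto
  finally show ?thesis
    using lam_pos nn_integral_step_moment(2)[of 1 ?h]
    by (subst ennreal_plus) (auto intro!: sum_nonneg)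
qed

text \<open>
  Balance of the mean of \<open>ahead j\<close>: the queue \<open>j\<close> stations ahead after a jump \<open>d\<close> is the one \<open>j + d\<close> stations
  ahead before it, diminished by the customer taken if it is the polled one, and
  increased by the arrivals.
\<close>

lemma first_moments:
  assumes j: "j < N"
  shows "ahead_busy j + ahead_idle j = (\<Sum>d=1..N. pmf p d * (ahead_busy ((j + d) mod N) - \<rho> * (if (j + d) mod N = 0 then 1 else 0)))
        + (\<Sum>d=1..N. pmf p' d * ahead_idle ((j + d) mod N)) + lam * \<tau> 1"
proof -
  define G where "G z = (\<Sum>d=1..N. pmf (jump_law (nonempty z)) d * real (after_poll z ((fst z + (j + d)) mod N))) + lam * moment (nonempty z) 1" for z
  have "E G = E (ahead j)"
    by (rule stationary_real(2))
       (use ahead_nonneg int_ahead lam_pos nn_integral_step_moment(2)[of 1] in \<open>auto simp: G_def expect_ahead intro!: add_nonneg_nonneg sum_nonneg\<close>)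
  moreover have "E G = E (\<lambda>z. (\<Sum>d=1..N. pmf p d * (busy z * ahead ((j + d) mod N) z - busy z * (if (j + d) mod N = 0 then 1 else 0)))
        + (\<Sum>d=1..N. pmf p' d * ((1 - busy z) * ahead ((j + d) mod N) z)) + lam * moment (nonempty z) 1)"
  proof (rule expectation_cong)
    fix z assume z: "z \<in> states N"
    have m: "ahead ((j + d) mod N) z = ahead (j + d) z" for d by (simp add: ahead_def mod_add_right_eq)
    show "G z = (\<Sum>d=1..N. pmf p d * (busy z * ahead ((j + d) mod N) z - busy z * (if (j + d) mod N = 0 then 1 else 0)))
        + (\<Sum>d=1..N. pmf p' d * ((1 - busy z) * ahead ((j + d) mod N) z)) + lam * moment (nonempty z) 1"
      unfolding G_def after_poll_ahead[OF z] m by (cases "nonempty z") (simp_all add: busy_def jump_law_def)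
  qed
  moreover have "\<dots> = (\<Sum>d=1..N. pmf p d * (ahead_busy ((j + d) mod N) - \<rho> * (if (j + d) mod N = 0 then 1 else 0)))
        + (\<Sum>d=1..N. pmf p' d * ahead_idle ((j + d) mod N)) + lam * \<tau> 1"
  proof -
    have i1: "integ (\<lambda>z. pmf p d * (busy z * ahead ((j + d) mod N) z - busy z * (if (j + d) mod N = 0 then 1 else 0)))" for d
      using int_busy_ahead int_busy by (intro Bochner_Integration.integrable_mult_right Bochner_Integration.integrable_diff Bochner_Integration.integrable_mult_left) auto
    have i2: "integ (\<lambda>z. pmf p' d * ((1 - busy z) * ahead ((j + d) mod N) z))" for d
      using int_idle_ahead by (intro Bochner_Integration.integrable_mult_right)
    have i3: "integ (\<lambda>z. lam * moment (nonempty z) 1)" using E_moment(2) by simp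
    have e1: "E (\<lambda>z. pmf p d * (busy z * ahead ((j + d) mod N) z - busy z * (if (j + d) mod N = 0 then 1 else 0)))
        = pmf p d * (ahead_busy ((j + d) mod N) - \<rho> * (if (j + d) mod N = 0 then 1 else 0))" for d
      using int_busy_ahead int_busy unfolding ahead_busy_def \<rho>_def by simp
    have e2: "E (\<lambda>z. pmf p' d * ((1 - busy z) * ahead ((j + d) mod N) z)) = pmf p' d * ahead_idle ((j + d) mod N)" for d
      using int_idle_ahead unfolding ahead_idle_def by simp
    have s1: "integ (\<lambda>z. \<Sum>d=1..N. pmf p d * (busy z * ahead ((j + d) mod N) z - busy z * (if (j + d) mod N = 0 then 1 else 0)))"
      by (rule Bochner_Integration.integrable_sum) (rule i1)
    have s2: "integ (\<lambda>z. \<Sum>d=1..N. pmf p' d * ((1 - busy z) * ahead ((j + d) mod N) z))"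
      by (rule Bochner_Integration.integrable_sum) (rule i2)
    show ?thesis
      unfolding Bochner_Integration.integral_add[OF Bochner_Integration.integrable_add[OF s1 s2] i3]
        Bochner_Integration.integral_add[OF s1 s2] Bochner_Integration.integral_sum[OF i1] Bochner_Integration.integral_sum[OF i2]
        e1 e2 using E_moment by simp
  qed
  ultimately show ?thesis using E_ahead[of j] by simp
qed

text \<open>
  The correlation does not depend on the position of the server, hence not on its jump. At lag \<open>0\<close>
  the two stations coincide and the second moment of the arrivals has the additional term with \<open>b2\<close>.
\<close>

lemma expect_corr:
  assumes k: "k < N"
  shows "expect (\<lambda>y. ennreal (real (corr k y))) z
    = ennreal (\<Sum>i<N. real (after_poll z i) * real (after_poll z ((i + k) mod N))
        + lam * moment (nonempty z) 1 * (real (after_poll z i) + real (after_poll z ((i + k) mod N)))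
        + (lam\<^sup>2 * moment (nonempty z) 2 + (if k = 0 then rate * b2 * moment (nonempty z) 1 else 0)))"
proof -
  let ?h = "nonempty z"
  let ?T = "\<lambda>i \<omega>. total (station \<omega> i) (snd (first_step ?h \<omega>))"
  let ?a = "after_poll z"
  let ?m = "lam * moment ?h 1"
  let ?K = "lam\<^sup>2 * moment ?h 2 + (if k = 0 then rate * b2 * moment ?h 1 else 0)"
  have m0: "0 \<le> moment ?h 1" "0 \<le> moment ?h 2" using nn_integral_step_moment(2)[of 1 ?h] nn_integral_step_moment(2)[of 2 ?h] by auto
  have M: "(\<lambda>\<omega>. ?T i \<omega>) \<in> \<Omega> \<rightarrow>\<^sub>M count_space UNIV" for i
  proof -
    have "(\<lambda>\<omega>. (station \<omega>, snd (first_step ?h \<omega>))) \<in> \<Omega> \<rightarrow>\<^sub>M stations_law \<Otimes>\<^sub>M borel"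
      by measurable
    from measurable_compose[OF this measurable_total_component[of i]] show ?thesis by simp
  qed
  have MT: "(\<lambda>\<omega>. of_nat (?T i \<omega>) :: ennreal) \<in> borel_measurable \<Omega>" for i
    by (rule measurable_compose[OF M]) simp
  have MTT: "(\<lambda>\<omega>. of_nat (?T i \<omega> * ?T j \<omega>) :: ennreal) \<in> borel_measurable \<Omega>" for i j
    unfolding of_nat_mult by (rule borel_measurable_times_ennreal[OF MT MT])
  have MC: "(\<lambda>\<omega>. c * of_nat (?T i \<omega>) :: ennreal) \<in> borel_measurable \<Omega>" for c i
    by (rule borel_measurable_times_ennreal[OF borel_measurable_const MT])
  have prod: "(\<integral>\<^sup>+\<omega>. of_nat (?T i \<omega> * ?T ((i + k) mod N) \<omega>) \<partial>\<Omega>) = ennreal ?K" if "i < N" for i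
  proof (cases "k = 0")
    case True
    then have "(i + k) mod N = i" using that by simp
    then show ?thesis using True expected_total_square[of i ?h] by (simp add: power2_eq_square add.commute)
  next
    case False
    then have "i \<noteq> (i + k) mod N" using that k by (auto simp: mod_if)
    from expected_total_product[OF this] show ?thesis using False by simp
  qed
  have tm: "(\<integral>\<^sup>+\<omega>. of_nat ((?a i + ?T i \<omega>) * (?a j + ?T j \<omega>)) \<partial>\<Omega>)
      = ennreal (real (?a i) * real (?a j) + ?m * (real (?a i) + real (?a j)) + ?K)" if i: "i < N" and j: "j = (i + k) mod N" for i j
  proof -
    have "(\<integral>\<^sup>+\<omega>. of_nat ((?a i + ?T i \<omega>) * (?a j + ?T j \<omega>)) \<partial>\<Omega>)
      = (\<integral>\<^sup>+\<omega>. of_nat (?a i * ?a j) + (of_nat (?a i) * of_nat (?T j \<omega>) + (of_nat (?a j) * of_nat (?T i \<omega>) + of_nat (?T i \<omega> * ?T j \<omega>))) \<partial>\<Omega>)"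
      by (intro nn_integral_cong) (simp add: algebra_simps)
    also have "\<dots> = of_nat (?a i * ?a j) + (of_nat (?a i) * ennreal ?m + (of_nat (?a j) * ennreal ?m + ennreal ?K))"
    proof -
      have 1: "(\<integral>\<^sup>+\<omega>. of_nat (?a j) * of_nat (?T i \<omega>) + of_nat (?T i \<omega> * ?T j \<omega>) \<partial>\<Omega>) = of_nat (?a j) * ennreal ?m + ennreal ?K"
        unfolding nn_integral_add[OF MC MTT] nn_integral_cmult[OF MT] expected_total j prod[OF i] ..
      have 2: "(\<integral>\<^sup>+\<omega>. of_nat (?a i) * of_nat (?T j \<omega>) + (of_nat (?a j) * of_nat (?T i \<omega>) + of_nat (?T i \<omega> * ?T j \<omega>)) \<partial>\<Omega>)
        = of_nat (?a i) * ennreal ?m + (of_nat (?a j) * ennreal ?m + ennreal ?K)"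
        unfolding nn_integral_add[OF MC borel_measurable_add[OF MC MTT]] 1 nn_integral_cmult[OF MT] expected_total ..
      have 3: "(\<integral>\<^sup>+\<omega>. of_nat (?a i * ?a j) \<partial>\<Omega>) = (of_nat (?a i * ?a j) :: ennreal)"
        using \<Omega>.emeasure_space_1 by simp
      show ?thesis
        unfolding nn_integral_add[OF borel_measurable_const borel_measurable_add[OF MC borel_measurable_add[OF MC MTT]]] 2 3 ..
    qed
    also have "\<dots> = ennreal (real (?a i) * real (?a j)) + (ennreal (real (?a i) * ?m) + (ennreal (real (?a j) * ?m) + ennreal ?K))"
      using m0 lam_pos by (simp add: ennreal_of_nat_eq_real_of_nat ennreal_mult)
    also have "\<dots> = ennreal (real (?a i) * real (?a j) + (real (?a i) * ?m + (real (?a j) * ?m + ?K)))"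
    proof -
      have K: "0 \<le> ?K" using m0 rate_pos b2_nonneg by simp
      have m: "0 \<le> real c * ?m" for c using m0 lam_pos by simp
      have m2: "0 \<le> real (?a i) * real (?a j)" by simp
      show ?thesis
        using K m[of "?a i"] m[of "?a j"] m2 by (simp only: ennreal_plus[symmetric] add_nonneg_nonneg)
    qed
    also have "real (?a i) * real (?a j) + (real (?a i) * ?m + (real (?a j) * ?m + ?K)) = real (?a i) * real (?a j) + ?m * (real (?a i) + real (?a j)) + ?K"
      by (simp only: ring_distribs add.assoc mult.commute)
    finally show ?thesis .
  qed
  have "expect (\<lambda>y. ennreal (real (corr k y))) z = (\<integral>\<^sup>+\<omega>. (\<Sum>i<N. of_nat ((?a i + ?T i \<omega>) * (?a ((i + k) mod N) + ?T ((i + k) mod N) \<omega>))) \<partial>\<Omega>)"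
    unfolding expect_def
  proof (rule nn_integral_cong_AE, rule eventually_mono[OF AE_nice])
    fix \<omega> assume n: "nice \<omega>"
    have s: "snd (next_state N z \<omega>) ! i = ?a i + ?T i \<omega>" if "i < N" for i
      unfolding chain_successor[OF n] using that by (simp add: successor_def totals_def)
    have c: "corr k (next_state N z \<omega>) = (\<Sum>i<N. (?a i + ?T i \<omega>) * (?a ((i + k) mod N) + ?T ((i + k) mod N) \<omega>))"
      unfolding corr_def using N_pos by (intro sum.cong refl) (simp add: s)
    show "ennreal (real (corr k (next_state N z \<omega>))) = (\<Sum>i<N. of_nat ((?a i + ?T i \<omega>) * (?a ((i + k) mod N) + ?T ((i + k) mod N) \<omega>)))"
      unfolding c ennreal_of_nat_eq_real_of_nat[symmetric] by (simp only: of_nat_sum)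
  qed
  also have "\<dots> = (\<Sum>i<N. \<integral>\<^sup>+\<omega>. of_nat ((?a i + ?T i \<omega>) * (?a ((i + k) mod N) + ?T ((i + k) mod N) \<omega>)) \<partial>\<Omega>)"
  proof (rule nn_integral_sum)
    fix i
    show "(\<lambda>\<omega>. of_nat ((?a i + ?T i \<omega>) * (?a ((i + k) mod N) + ?T ((i + k) mod N) \<omega>)) :: ennreal) \<in> borel_measurable \<Omega>"
      unfolding of_nat_mult of_nat_add
      by (intro borel_measurable_times_ennreal borel_measurable_add borel_measurable_const MT)
  qed
  also have "\<dots> = (\<Sum>i<N. ennreal (real (?a i) * real (?a ((i + k) mod N)) + ?m * (real (?a i) + real (?a ((i + k) mod N))) + ?K))"
    by (intro sum.cong refl tm) auto
  also have "\<dots> = ennreal (\<Sum>i<N. real (?a i) * real (?a ((i + k) mod N)) + ?m * (real (?a i) + real (?a ((i + k) mod N))) + ?K)"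
    using m0 lam_pos rate_pos b2_nonneg by (intro sum_ennreal) (auto intro!: add_nonneg_nonneg)
  finally show ?thesis .
qed

text \<open>
  The mean total wait during one step of the customers left behind by the poll at its beginning.
\<close>

definition carried_wait where "carried_wait = E (\<lambda>z. real (total_after N z) * moment (nonempty z) 1)"

lemma queue_total_ahead: "real (queue_total N z) = (\<Sum>j<N. ahead j z)"
  using sum_mod_shift[of "\<lambda>i. real (snd z ! i)" "fst z" N]
  by (simp add: queue_total_def ahead_def add.commute)

lemma total_after_busy: "z \<in> states N \<Longrightarrow> real (total_after N z) = real (queue_total N z) - busy z"
  by (auto simp: total_after_def queue_total_def after_poll_busy sum_subtractf sum.delta states_def)

lemma int_total_after: "integ (\<lambda>z. real (total_after N z) * moment (nonempty z) 1)"
proof (rule Bochner_Integration.integrable_bound)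
  show "integ (\<lambda>z. longest_step * real (queue_total N z))" using int_queue_total by simp
  show "AE z in measure_pmf \<pi>. norm (real (total_after N z) * moment (nonempty z) 1) \<le> norm (longest_step * real (queue_total N z))"
  proof (rule AE_I2)
    fix z
    have "real (total_after N z) * moment (nonempty z) 1 \<le> real (queue_total N z) * longest_step"
      using total_after_le[of N z] moment_le_longest(1)[of "nonempty z"] moment_le_longest(2) nn_integral_step_moment(2)[of 1 "nonempty z"]
      by (intro mult_mono) simp_all
    then show "norm (real (total_after N z) * moment (nonempty z) 1) \<le> norm (longest_step * real (queue_total N z))"
      using moment_le_longest(2) nn_integral_step_moment(2)[of 1 "nonempty z"] by (simp add: mult.commute)
  qed
qed simp

lemma carried_wait_eq: "carried_wait = moment True 1 * ((\<Sum>j<N. ahead_busy j) - \<rho>) + moment False 1 * (\<Sum>j<N. ahead_idle j)"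
proof -
  have "carried_wait = E (\<lambda>z. moment True 1 * ((\<Sum>j<N. busy z * ahead j z) - busy z) + moment False 1 * (\<Sum>j<N. (1 - busy z) * ahead j z))"
    unfolding carried_wait_def
  proof (rule expectation_cong)
    fix z assume "z \<in> states N"
    then show "real (total_after N z) * moment (nonempty z) 1 = moment True 1 * ((\<Sum>j<N. busy z * ahead j z) - busy z) + moment False 1 * (\<Sum>j<N. (1 - busy z) * ahead j z)"
      by (simp only: total_after_busy queue_total_ahead) (simp add: busy_def sum_distrib_left[symmetric] algebra_simps)
  qed
  also have "\<dots> = moment True 1 * ((\<Sum>j<N. ahead_busy j) - \<rho>) + moment False 1 * (\<Sum>j<N. ahead_idle j)"
    unfolding ahead_busy_def ahead_idle_def \<rho>_def using int_busy_ahead int_idle_ahead int_busy by simp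
  finally show ?thesis .
qed

text \<open>
  Balance of the mean correlation at lag \<open>k\<close>. The mean correlation has the same value on both
  sides and cancels; what remains are the products of the removed customer with the queues at
  distance \<open>k\<close> on both sides of the server, and the arrivals.
\<close>

lemma second_moments:
  assumes k: "k < N"
  shows "ahead_busy k + ahead_busy ((N - k) mod N) = (if k = 0 then \<rho> + real N * (rate * b2 * \<tau> 1) else 0)
    + (2 * lam * carried_wait + real N * (lam\<^sup>2 * \<tau> 2))"
proof -
  define K where "K z = lam\<^sup>2 * moment (nonempty z) 2 + (if k = 0 then rate * b2 * moment (nonempty z) 1 else 0)" for z
  define G where "G z = (\<Sum>i<N. real (after_poll z i) * real (after_poll z ((i + k) mod N))
        + lam * moment (nonempty z) 1 * (real (after_poll z i) + real (after_poll z ((i + k) mod N))) + K z)" for z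
  have m0: "0 \<le> moment h 1" "0 \<le> moment h 2" for h using nn_integral_step_moment(2)[of 1 h] nn_integral_step_moment(2)[of 2 h] by auto
  have "E G = E (\<lambda>z. real (corr k z))"
  proof (rule stationary_real(2)[OF _ int_corr])
    show "expect (\<lambda>y. ennreal (real (corr k y))) z = ennreal (G z)" for z
      unfolding G_def K_def by (rule expect_corr[OF k])
    show "0 \<le> G z" for z
      unfolding G_def K_def using m0 lam_pos rate_pos b2_nonneg by (intro sum_nonneg add_nonneg_nonneg mult_nonneg_nonneg) auto
  qed simp
  moreover have "E G = E (\<lambda>z. real (corr k z) - busy z * ahead k z - busy z * ahead ((N - k) mod N) z + (if k = 0 then busy z else 0)
      + 2 * lam * (real (total_after N z) * moment (nonempty z) 1) + real N * K z)"
  proof (rule expectation_cong)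
    fix z assume z: "z \<in> states N"
    have s: "fst z < N" using z by (simp add: states_def split_beta')
    have "(\<Sum>i<N. real (after_poll z i) * real (after_poll z ((i + k) mod N)))
      = real (corr k z) - busy z * ahead k z - busy z * ahead ((N - k) mod N) z + (if k = 0 then busy z else 0)"
      unfolding after_poll_busy corr_def ahead_def of_nat_sum of_nat_mult
      using product_sum_removed[OF s k, of "\<lambda>i. real (snd z ! i)" "busy z"] busy_bounds(3)[of z] by simp
    moreover have "(\<Sum>i<N. real (after_poll z i) + real (after_poll z ((i + k) mod N))) = 2 * real (total_after N z)"
      using sum_mod_shift[of "\<lambda>i. real (after_poll z i)" k N] by (simp add: sum.distrib total_after_def)
    ultimately show "G z = real (corr k z) - busy z * ahead k z - busy z * ahead ((N - k) mod N) z + (if k = 0 then busy z else 0)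
      + 2 * lam * (real (total_after N z) * moment (nonempty z) 1) + real N * K z"
      unfolding G_def sum.distrib[of "\<lambda>i. _ i + _ i"] sum.distrib[of "\<lambda>i. _ i * _ i"] sum_distrib_left[symmetric]
      by (simp add: sum.distrib[symmetric])
  qed
  moreover have "\<dots> = E (\<lambda>z. real (corr k z)) - ahead_busy k - ahead_busy ((N - k) mod N) + (if k = 0 then \<rho> else 0)
      + 2 * lam * carried_wait + real N * (lam\<^sup>2 * \<tau> 2 + (if k = 0 then rate * b2 * \<tau> 1 else 0))"
    unfolding K_def using int_corr int_busy_ahead int_busy int_total_after E_moment
    by (cases "k = 0") (simp_all add: ahead_busy_def carried_wait_def \<rho>_def)
  ultimately show ?thesis by (auto simp: ring_distribs)
qed

end

section \<open>The load and the closed formula\<close>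

context polling_model
begin

lemma moment_2_pos:
  assumes "moment h 1 \<noteq> 0"
  shows "0 < moment h 2"
proof (rule ccontr)
  assume "\<not> 0 < moment h 2"
  then have "(\<integral>\<^sup>+q. ennreal (snd q ^ 2) \<partial>step h) = 0"
    using nn_integral_step_moment(2)[of 2 h] by (simp add: nn_integral_step_moment(1))
  moreover have "(\<lambda>q. ennreal (snd q ^ 2)) \<in> borel_measurable (step h)"
    unfolding measurable_cong_sets[OF sets_step refl] by measurable
  ultimately have "AE q in step h. ennreal (snd q ^ 2) = 0"
    by (simp add: nn_integral_0_iff_AE)
  then have "AE q in step h. ennreal (snd q ^ 1) = 0"
    by (rule eventually_mono) (simp add: ennreal_eq_0_iff)
  then have "(\<integral>\<^sup>+q. ennreal (snd q ^ 1) \<partial>step h) = (\<integral>\<^sup>+q. 0 \<partial>step h)"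
    by (rule nn_integral_cong_AE)
  then have "ennreal (moment h 1) = 0" by (simp add: nn_integral_step_moment(1)[of 1, simplified])
  then show False using assms nn_integral_step_moment(2)[of 1 h] by (simp add: ennreal_eq_0_iff)
qed

lemma b_le_b2: "b \<le> b2"
  unfolding b_def b2_def
proof (rule integral_mono[OF _ batch_sq])
  show "integrable (measure_pmf batch) real"
    by (rule measure_pmf.square_integrable_imp_integrable[OF _ batch_sq]) simp
  show "real n \<le> (real n)\<^sup>2" for n
    by (cases n) (auto simp: power2_eq_square algebra_simps)
qed

end

lemma sum_pmf_1: fixes q :: "nat pmf" shows "set_pmf q \<subseteq> {1..N} \<Longrightarrow> (\<Sum>d=1..N. pmf q d) = 1"
  by (rule sum_pmf_eq_1) simp_all

lemma sum_reflect:
  fixes g :: "nat \<Rightarrow> 'a :: comm_monoid_add"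
  shows "(\<Sum>k<N. g ((N - k) mod N)) = (\<Sum>k<N. g k)"
  by (rule sum.reindex_bij_witness[where i="\<lambda>k. (N - k) mod N" and j="\<lambda>k. (N - k) mod N"])
     (auto simp: mod_if)

context stationary_polling
begin

lemma \<rho>_pos: "0 < \<rho>"
proof -
  define z :: state where "z = (0, replicate N 1)"
  have z: "z \<in> states N" "busy z = 1"
    using N_pos by (auto simp: z_def states_def busy_def nonempty_def)
  have "\<rho> \<noteq> 0"
  proof
    assume "\<rho> = 0"
    then have "AE y in measure_pmf \<pi>. busy y = 0"
      unfolding \<rho>_def by (subst integral_nonneg_eq_0_iff_AE[symmetric]) (auto simp: int_busy busy_bounds)
    then show False
      using stationary_pos[OF st irr z(1)] z(2) by (simp add: AE_measure_pmf_iff pmf_positive_iff)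
  qed
  moreover have "0 \<le> \<rho>" unfolding \<rho>_def by (rule integral_nonneg_AE) (simp add: busy_bounds)
  ultimately show ?thesis by simp
qed

lemma \<rho>_less_1: "\<rho> < 1"
proof -
  define z :: state where "z = (0, replicate N 0)"
  have z: "z \<in> states N" "busy z = 0"
    using N_pos by (auto simp: z_def states_def busy_def nonempty_def)
  have eq: "1 - \<rho> = E (\<lambda>y. 1 - busy y)" unfolding \<rho>_def using int_busy by simp
  have "1 - \<rho> \<noteq> 0"
  proof
    assume "1 - \<rho> = 0"
    then have "AE y in measure_pmf \<pi>. 1 - busy y = 0"
      unfolding eq by (subst integral_nonneg_eq_0_iff_AE[symmetric]) (auto simp: int_busy busy_bounds)
    then show False
      using stationary_pos[OF st irr z(1)] z(2) by (simp add: AE_measure_pmf_iff pmf_positive_iff)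
  qed
  moreover have "0 \<le> 1 - \<rho>" unfolding eq by (rule integral_nonneg_AE) (simp add: busy_bounds)
  ultimately show ?thesis by simp
qed

lemma \<rho>_eq: "\<rho> = real N * lam * \<tau> 1"
proof -
  have "(\<Sum>j<N. ahead_busy j + ahead_idle j) = (\<Sum>j<N. (\<Sum>d=1..N. pmf p d * (ahead_busy ((j + d) mod N) - \<rho> * (if (j + d) mod N = 0 then 1 else 0)))
        + (\<Sum>d=1..N. pmf p' d * ahead_idle ((j + d) mod N)) + lam * \<tau> 1)"
    by (intro sum.cong refl first_moments) simp
  also have "\<dots> = (\<Sum>d=1..N. pmf p d * (\<Sum>j<N. ahead_busy ((j + d) mod N) - \<rho> * (if (j + d) mod N = 0 then 1 else 0)))
        + (\<Sum>d=1..N. pmf p' d * (\<Sum>j<N. ahead_idle ((j + d) mod N))) + real N * lam * \<tau> 1"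
    unfolding sum.distrib sum_distrib_left by (subst (1 2) sum.swap) simp
  also have "(\<lambda>d. \<Sum>j<N. ahead_busy ((j + d) mod N) - \<rho> * (if (j + d) mod N = 0 then 1 else 0)) = (\<lambda>d. (\<Sum>j<N. ahead_busy j) - \<rho>)"
  proof
    fix d
    show "(\<Sum>j<N. ahead_busy ((j + d) mod N) - \<rho> * (if (j + d) mod N = 0 then 1 else 0)) = (\<Sum>j<N. ahead_busy j) - \<rho>"
      unfolding sum_mod_shift[of "\<lambda>i. ahead_busy i - \<rho> * (if i = 0 then 1 else 0)"]
      using N_pos by (simp add: sum_subtractf sum_distrib_left[symmetric] sum.delta)
  qed
  also have "(\<lambda>d. \<Sum>j<N. ahead_idle ((j + d) mod N)) = (\<lambda>d. \<Sum>j<N. ahead_idle j)"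
    unfolding sum_mod_shift ..
  finally show ?thesis
    unfolding sum_distrib_right[symmetric] sum_pmf_1[OF p_set] sum_pmf_1[OF p'_set] sum.distrib by simp
qed

lemma sum_second_moments:
  "2 * (\<Sum>j<N. ahead_busy j) = \<rho> + real N * (rate * b2 * \<tau> 1) + real N * (2 * lam * carried_wait + real N * (lam\<^sup>2 * \<tau> 2))"
proof -
  have "(\<Sum>k<N. ahead_busy k + ahead_busy ((N - k) mod N)) = (\<Sum>k<N. (if k = 0 then \<rho> + real N * (rate * b2 * \<tau> 1) else 0)
    + (2 * lam * carried_wait + real N * (lam\<^sup>2 * \<tau> 2)))"
    by (intro sum.cong refl second_moments) simp
  then show ?thesis
    unfolding sum.distrib sum_reflect using N_pos by (simp add: sum.delta ring_distribs)
qed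

lemma load_eq: "\<rho> * (1 - real N * lam * moment True 1) = (1 - \<rho>) * (real N * lam * moment False 1)"
  using \<rho>_eq unfolding \<tau>_def by (simp add: algebra_simps)

text \<open>
  If steps after an empty poll took no time, all time would be spent after services and
  \<open>load_eq\<close> would make the load critical. In the summed second moments the queue lengths would then
  cancel and leave \<open>\<rho> = N * rate * b2 * \<tau> 1 + N\<^sup>2 * lam\<^sup>2 * \<tau> 2\<close>, although the first summand is at
  least \<open>\<rho>\<close> and the second one is positive.
\<close>

lemma empty_interval_pos: "0 < moment False 1"
proof (rule ccontr)
  assume "\<not> 0 < moment False 1"
  then have 0: "moment False 1 = 0" using nn_integral_step_moment(2)[of 1 False] by simp
  then have crit: "real N * lam * moment True 1 = 1"
    using load_eq \<rho>_pos by simp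
  then have "moment True 1 \<noteq> 0" by auto
  then have m2: "0 < moment True 2" by (rule moment_2_pos)
  have T2: "0 < \<tau> 2"
    unfolding \<tau>_def using m2 \<rho>_pos \<rho>_less_1 nn_integral_step_moment(2)[of 2 False]
    by (intro add_pos_nonneg mult_pos_pos mult_nonneg_nonneg) auto
  define F where "F = (\<Sum>j<N. ahead_busy j)"
  have carried_wait: "real N * (2 * lam * carried_wait) = 2 * (F - \<rho>)"
  proof -
    have "real N * (2 * lam * carried_wait) = 2 * (real N * lam * moment True 1) * (F - \<rho>)"
      unfolding carried_wait_eq F_def[symmetric] 0 by (simp add: ac_simps)
    then show ?thesis by (simp only: crit mult_1_right)
  qed
  have "real N * (rate * b2 * \<tau> 1) + real N * (real N * (lam\<^sup>2 * \<tau> 2)) = \<rho>"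
    using sum_second_moments unfolding F_def[symmetric] distrib_left carried_wait by simp
  moreover have "\<rho> \<le> real N * (rate * b2 * \<tau> 1)"
  proof -
    have "0 \<le> \<tau> 1" unfolding \<tau>_def using \<rho>_pos \<rho>_less_1 nn_integral_step_moment(2)[of 1] by simp
    then show ?thesis
      unfolding \<rho>_eq lam_def using b_le_b2 rate_pos by (simp add: mult.assoc mult_left_mono mult_right_mono)
  qed
  moreover have "0 < real N * (real N * (lam\<^sup>2 * \<tau> 2))"
    using T2 N_pos lam_pos by simp
  ultimately show False by linarith
qed

lemma load_less_1: "0 < 1 - real N * lam * moment True 1"
proof -
  have "0 < \<rho> * (1 - real N * lam * moment True 1)"
    unfolding load_eq using \<rho>_less_1 N_pos lam_pos empty_interval_pos by simp
  then show ?thesis using \<rho>_pos by (simp add: zero_less_mult_iff)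
qed

definition mean_wait where "mean_wait = (real N * lam * \<tau> 2 / 2 + carried_wait) / \<rho>"

lemma mean_waiting_time_ennreal: "mean_waiting_time \<Omega> N \<pi> = ennreal mean_wait"
proof -
  have m0: "0 \<le> moment h 1" "0 \<le> moment h 2" for h
    using nn_integral_step_moment(2)[of 1 h] nn_integral_step_moment(2)[of 2 h] by auto
  have "(\<integral>\<^sup>+z. of_nat (queue_total N z) \<partial>measure_pmf \<pi>) = ennreal (E (\<lambda>z. real (queue_total N z)))"
    unfolding ennreal_of_nat_eq_real_of_nat by (rule nn_integral_eq_integral[OF int_queue_total]) simp
  then have fin: "(\<integral>\<^sup>+z. of_nat (queue_total N z) \<partial>measure_pmf \<pi>) < \<infinity>" by simp
  have 1: "(\<integral>\<^sup>+z. ennreal (real N * (lam / 2 * moment (nonempty z) 2)) \<partial>measure_pmf \<pi>) = ennreal (real N * (lam / 2 * \<tau> 2))"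
    unfolding E_moment(1)[symmetric]
    using E_moment(2)[of 2] m0 lam_pos by (subst nn_integral_eq_integral) auto
  have 2: "(\<integral>\<^sup>+z. ennreal (real N * (lam * moment (nonempty z) 1)) \<partial>measure_pmf \<pi>) = ennreal \<rho>"
    unfolding \<rho>_eq E_moment(1)[symmetric]
    using E_moment(2)[of 1] m0 lam_pos by (subst nn_integral_eq_integral) (auto simp: mult.assoc)
  have 3: "(\<integral>\<^sup>+z. of_nat (total_after N z) * ennreal (moment (nonempty z) 1) \<partial>measure_pmf \<pi>) = ennreal carried_wait"
  proof -
    have "(\<integral>\<^sup>+z. of_nat (total_after N z) * ennreal (moment (nonempty z) 1) \<partial>measure_pmf \<pi>)
      = (\<integral>\<^sup>+z. ennreal (real (total_after N z) * moment (nonempty z) 1) \<partial>measure_pmf \<pi>)"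
      using m0 by (simp add: ennreal_of_nat_eq_real_of_nat ennreal_mult)
    also have "\<dots> = ennreal carried_wait"
      unfolding carried_wait_def using m0 by (intro nn_integral_eq_integral[OF int_total_after]) simp
    finally show ?thesis .
  qed
  have T2: "0 \<le> \<tau> 2" unfolding \<tau>_def using \<rho>_pos \<rho>_less_1 m0 by simp
  have B0: "0 \<le> carried_wait" unfolding carried_wait_def using m0 by (intro integral_nonneg_AE) simp
  show ?thesis
    unfolding mean_waiting_time_eq[OF st irr fin] 1 2 3 mean_wait_def
    using T2 B0 lam_pos \<rho>_pos by (simp add: ennreal_plus[symmetric] divide_ennreal del: ennreal_plus)
qed

text \<open>
  The summed second moments express the mean number of customers at busy polls by the mean waiting
  time, which turns the definition of \<open>mean_wait\<close> into a linear equation. The term \<open>(1 - \<rho>) / \<rho>\<close> is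
  eliminated by \<open>load_eq\<close>.
\<close>

lemma mean_wait_idle:
  "mean_wait * (1 - real N * lam * moment True 1) = moment False 1 * ((\<Sum>j<N. ahead_idle j) / \<rho>) + real N * lam * moment True 2 / 2
    + moment False 2 * (1 - real N * lam * moment True 1) / (2 * moment False 1) + (b2 - b) / (2 * b) * moment True 1"
proof -
  define F S D where "F = (\<Sum>j<N. ahead_busy j)" and "S = (\<Sum>j<N. ahead_idle j)" and "D = 1 - real N * lam * moment True 1"
  have mean_wait: "\<rho> * mean_wait = real N * lam * \<tau> 2 / 2 + (moment True 1 * (F - \<rho>) + moment False 1 * S)"
    unfolding mean_wait_def carried_wait_eq F_def S_def using \<rho>_pos by simp
  have b: "0 < b" using b_ge_1 by simp
  have F: "F - \<rho> = \<rho> * ((b2 - b) / (2 * b)) + real N * lam * (\<rho> * mean_wait)"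
  proof -
    have "real N * (rate * b2 * \<tau> 1) = \<rho> * (b2 / b)"
      unfolding \<rho>_eq lam_def using b by simp
    moreover have "real N * (2 * lam * carried_wait + real N * (lam\<^sup>2 * \<tau> 2)) = 2 * (real N * lam * (\<rho> * mean_wait))"
    proof -
      have "\<rho> * mean_wait = real N * lam * \<tau> 2 / 2 + carried_wait" unfolding mean_wait_def using \<rho>_pos by simp
      then show ?thesis by (simp add: power2_eq_square algebra_simps)
    qed
    ultimately have "2 * F = \<rho> + \<rho> * (b2 / b) + 2 * (real N * lam * (\<rho> * mean_wait))"
      using sum_second_moments unfolding F_def by simp
    then show ?thesis using b by (simp add: field_simps)
  qed
  have T: "real N * lam * \<tau> 2 = \<rho> * (real N * lam * moment True 2 + moment False 2 * D / moment False 1)"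
  proof -
    have "\<rho> * D / moment False 1 = (1 - \<rho>) * (real N * lam)"
      using load_eq empty_interval_pos unfolding D_def by (simp add: field_simps)
    then have "\<rho> * (moment False 2 * D / moment False 1) = moment False 2 * ((1 - \<rho>) * (real N * lam))"
      by (metis mult.left_commute times_divide_eq_right)
    then show ?thesis unfolding \<tau>_def by (simp add: algebra_simps)
  qed
  have "\<rho> * (mean_wait * D) = \<rho> * mean_wait - moment True 1 * (real N * lam * (\<rho> * mean_wait))"
    unfolding D_def by (simp add: algebra_simps)
  also have "\<dots> = \<rho> * (real N * lam * moment True 2 + moment False 2 * D / moment False 1) / 2
      + moment True 1 * (\<rho> * ((b2 - b) / (2 * b))) + moment False 1 * S"
  proof -
    have "\<rho> * mean_wait = \<rho> * (real N * lam * moment True 2 + moment False 2 * D / moment False 1) / 2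
        + (moment True 1 * (\<rho> * ((b2 - b) / (2 * b)) + real N * lam * (\<rho> * mean_wait)) + moment False 1 * S)"
      using mean_wait unfolding T F .
    then show ?thesis unfolding distrib_left[of "moment True 1"] by linarith
  qed
  also have "\<dots> = \<rho> * (moment False 1 * (S / \<rho>) + real N * lam * moment True 2 / 2
    + moment False 2 * D / (2 * moment False 1) + (b2 - b) / (2 * b) * moment True 1)"
  proof -
    have "\<rho> * (real N * lam * moment True 2 + moment False 2 * D / moment False 1) / 2
      = \<rho> * (real N * lam * moment True 2 / 2) + \<rho> * (moment False 2 * D / (2 * moment False 1))"
      by (simp add: distrib_left add_divide_distrib mult.commute)
    moreover have "moment True 1 * (\<rho> * ((b2 - b) / (2 * b))) = \<rho> * ((b2 - b) / (2 * b) * moment True 1)"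
      by (simp only: ac_simps)
    moreover have "moment False 1 * S = \<rho> * (moment False 1 * (S / \<rho>))" using \<rho>_pos by simp
    ultimately show ?thesis unfolding distrib_left[of \<rho>] by linarith
  qed
  finally show ?thesis
    using \<rho>_pos unfolding D_def[symmetric] S_def[symmetric] by simp
qed

text \<open>
  Here \<open>S / 2 - \<rho>\<close> is \<open>\<rho> * (b2 - b) / (2 * b)\<close>, which vanishes for single arrivals, and
  \<open>(1 - \<mu>) / (1 - \<mu>') = 1 - (\<mu> - \<mu>') / (1 - \<mu>')\<close>.
\<close>

lemma sum_idle_spectral:
  assumes ne: "\<And>k. 1 \<le> k \<Longrightarrow> k < N \<Longrightarrow> routing_eigenvalue N p' k \<noteq> 1"
    and eq: "(1\<^sub>m N - routing_mat N p) * (1\<^sub>m N - transpose_mat (routing_mat N p')) =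
         (1\<^sub>m N - transpose_mat (routing_mat N p)) * (1\<^sub>m N - routing_mat N p')"
  shows "complex_of_real ((\<Sum>j<N. ahead_idle j) / \<rho>) = (\<Sum>l=1..<N. 1 / (1 - routing_eigenvalue N p' l))
    + of_real ((b2 - b) / (2 * b)) * (of_real (real N - 1)
        - (\<Sum>l=1..<N. (routing_eigenvalue N p l - routing_eigenvalue N p' l) / (1 - routing_eigenvalue N p' l)))"
proof -
  let ?S = "\<rho> + real N * (rate * b2 * \<tau> 1)" and ?C = "2 * lam * carried_wait + real N * (lam\<^sup>2 * \<tau> 2)"
  let ?m = "routing_eigenvalue N p" and ?n = "routing_eigenvalue N p'"
  have N: "1 \<le> N" using N_pos by simp
  have main: "of_real (\<Sum>j<N. ahead_idle j) = of_real \<rho> * (\<Sum>l=1..<N. 1 / (1 - ?n l))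
      + of_real (?S / 2 - \<rho>) * (\<Sum>l=1..<N. (1 - ?m l) / (1 - ?n l))"
    unfolding routing_eigenvalue_symbol
  proof (rule spectral_solution[OF N first_moments second_moments ahead_idle_0])
    show "symbol N (pmf p') l \<noteq> 1" if "1 \<le> l" "l < N" for l
      using ne[OF that] by (simp add: routing_eigenvalue_symbol)
    show "(1 - symbol N (pmf p) l) * (1 - cnj (symbol N (pmf p') l)) = (1 - cnj (symbol N (pmf p) l)) * (1 - symbol N (pmf p') l)" for l
      by (rule routing_symmetry[OF N eq])
  qed
  have b: "0 < b" using b_ge_1 by simp
  have S: "?S / 2 - \<rho> = \<rho> * ((b2 - b) / (2 * b))"
  proof -
    have "real N * (rate * b2 * \<tau> 1) = \<rho> * (b2 / b)" unfolding \<rho>_eq lam_def using b by simp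
    then show ?thesis using b by (simp add: field_simps)
  qed
  have R: "(\<Sum>l=1..<N. (1 - ?m l) / (1 - ?n l)) = of_real (real N - 1) - (\<Sum>l=1..<N. (?m l - ?n l) / (1 - ?n l))"
  proof -
    have "(\<Sum>l=1..<N. (1 - ?m l) / (1 - ?n l)) = (\<Sum>l=1..<N. 1 - (?m l - ?n l) / (1 - ?n l))"
    proof (intro sum.cong refl)
      fix l assume "l \<in> {1..<N}"
      then have "1 - ?n l \<noteq> 0" using ne[of l] by auto
      then show "(1 - ?m l) / (1 - ?n l) = 1 - (?m l - ?n l) / (1 - ?n l)"
        by (simp add: field_simps)
    qed
    then show ?thesis using N by (simp add: sum_subtractf of_nat_diff)
  qed
  have "complex_of_real ((\<Sum>j<N. ahead_idle j) / \<rho>) = of_real (\<Sum>j<N. ahead_idle j) / of_real \<rho>" by simp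
  also have "\<dots> = (\<Sum>l=1..<N. 1 / (1 - ?n l)) + of_real ((b2 - b) / (2 * b)) * (\<Sum>l=1..<N. (1 - ?m l) / (1 - ?n l))"
    unfolding main S using \<rho>_pos by (simp add: add_divide_distrib)
  finally show ?thesis unfolding R .
qed

theorem mean_waiting_time_formula:
  assumes ne: "\<And>k. 1 \<le> k \<Longrightarrow> k < N \<Longrightarrow> routing_eigenvalue N p' k \<noteq> 1"
    and eq: "(1\<^sub>m N - routing_mat N p) * (1\<^sub>m N - transpose_mat (routing_mat N p')) =
         (1\<^sub>m N - transpose_mat (routing_mat N p)) * (1\<^sub>m N - routing_mat N p')"
  defines "D \<equiv> 1 - real N * lam * moment True 1"
  shows "mean_waiting_time \<Omega> N \<pi> < \<infinity> \<and>
    complex_of_real (enn2real (mean_waiting_time \<Omega> N \<pi>)) =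
      of_real (moment False 1 / D) * (\<Sum>l=1..<N. 1 / (1 - routing_eigenvalue N p' l))
      + of_real (real N * lam * moment True 2 / (2 * D))
      + of_real (moment False 2 / (2 * moment False 1))
      + of_real ((b2 - b) / (2 * b)) *
          (of_real ((moment True 1 + (real N - 1) * moment False 1) / D)
           - of_real (moment False 1 / D)
             * (\<Sum>l=1..<N. (routing_eigenvalue N p l - routing_eigenvalue N p' l) / (1 - routing_eigenvalue N p' l)))"
proof
  have D: "0 < D" unfolding D_def by (rule load_less_1)
  have "0 \<le> mean_wait"
  proof -
    have "0 \<le> carried_wait" unfolding carried_wait_def using nn_integral_step_moment(2)[of 1] by (intro integral_nonneg_AE) simp
    moreover have "0 \<le> \<tau> 2" unfolding \<tau>_def using \<rho>_pos \<rho>_less_1 nn_integral_step_moment(2)[of 2] by simp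
    ultimately show ?thesis unfolding mean_wait_def using lam_pos \<rho>_pos by simp
  qed
  then have w: "enn2real (mean_waiting_time \<Omega> N \<pi>) = mean_wait" by (simp add: mean_waiting_time_ennreal)
  show "mean_waiting_time \<Omega> N \<pi> < \<infinity>" by (simp add: mean_waiting_time_ennreal)
  define s where "s = (\<Sum>j<N. ahead_idle j) / \<rho>"
  define \<kappa> where "\<kappa> = (b2 - b) / (2 * b)"
  define S1 where "S1 = (\<Sum>l=1..<N. 1 / (1 - routing_eigenvalue N p' l))"
  define S2 where "S2 = (\<Sum>l=1..<N. (routing_eigenvalue N p l - routing_eigenvalue N p' l) / (1 - routing_eigenvalue N p' l))"
  have s: "complex_of_real s = S1 + of_real \<kappa> * (of_real (real N - 1) - S2)"
    using sum_idle_spectral[OF ne eq] unfolding s_def \<kappa>_def S1_def S2_def .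
  have "mean_wait = moment False 1 / D * s + real N * lam * moment True 2 / (2 * D) + moment False 2 / (2 * moment False 1) + \<kappa> * (moment True 1 / D)"
  proof -
    have "mean_wait = (moment False 1 * s + real N * lam * moment True 2 / 2 + moment False 2 * D / (2 * moment False 1) + \<kappa> * moment True 1) / D"
      using mean_wait_idle D unfolding s_def[symmetric] \<kappa>_def[symmetric] D_def[symmetric] by (simp add: eq_divide_eq)
    then show ?thesis using D by (simp add: add_divide_distrib)
  qed
  then have "complex_of_real mean_wait = of_real (moment False 1 / D) * complex_of_real s + of_real (real N * lam * moment True 2 / (2 * D))
      + of_real (moment False 2 / (2 * moment False 1)) + of_real \<kappa> * of_real (moment True 1 / D)"
    by (simp only: of_real_add of_real_mult)
  also have "\<dots> = of_real (moment False 1 / D) * S1 + of_real (real N * lam * moment True 2 / (2 * D))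
      + of_real (moment False 2 / (2 * moment False 1))
      + of_real \<kappa> * (of_real ((moment True 1 + (real N - 1) * moment False 1) / D) - of_real (moment False 1 / D) * S2)"
  proof -
    have 1: "(moment True 1 + (real N - 1) * moment False 1) / D = moment True 1 / D + (real N - 1) * (moment False 1 / D)"
      by (simp add: add_divide_distrib)
    have 2: "x * (u + k * (n - v)) + a + c + k * y = x * u + a + c + k * ((y + n * x) - x * v)" for x u k n v a c y :: complex
      by (simp add: algebra_simps)
    show ?thesis unfolding s 1 of_real_add of_real_mult by (rule 2)
  qed
  finally show "complex_of_real (enn2real (mean_waiting_time \<Omega> N \<pi>)) =
      of_real (moment False 1 / D) * (\<Sum>l=1..<N. 1 / (1 - routing_eigenvalue N p' l))
      + of_real (real N * lam * moment True 2 / (2 * D))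
      + of_real (moment False 2 / (2 * moment False 1))
      + of_real ((b2 - b) / (2 * b)) *
          (of_real ((moment True 1 + (real N - 1) * moment False 1) / D)
           - of_real (moment False 1 / D)
             * (\<Sum>l=1..<N. (routing_eigenvalue N p l - routing_eigenvalue N p' l) / (1 - routing_eigenvalue N p' l)))"
    unfolding w S1_def[symmetric] S2_def[symmetric] \<kappa>_def[symmetric] .
qed

end

theorem theorem6p1:
  fixes N :: nat and rate b b2 lam tau tau2 tau' tau2' :: real
    and batch p p' :: "nat pmf" and H H' :: "nat \<Rightarrow> real measure"
    and \<Omega> :: "scenario measure" and \<pi> :: "state pmf"
    and mu mu' :: "nat \<Rightarrow> complex"
  assumes "N \<ge> 1"
    and "rate > 0"
    and "0 \<notin> set_pmf batch"
    and "integrable (measure_pmf batch) (\<lambda>n. (real n)\<^sup>2)"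
    and "set_pmf p \<subseteq> {1..N}"
    and "set_pmf p' \<subseteq> {1..N}"
    and "\<And>d. prob_space (H d)" and "\<And>d. sets (H d) = sets borel"
    and "\<And>d. AE t in H d. 0 \<le> t"
    and "\<And>d. prob_space (H' d)" and "\<And>d. sets (H' d) = sets borel"
    and "\<And>d. AE t in H' d. 0 \<le> t"
    and "\<And>d. d \<in> set_pmf p \<Longrightarrow> integrable (H d) (\<lambda>t. t\<^sup>2)"
    and "\<And>d. d \<in> set_pmf p' \<Longrightarrow> integrable (H' d) (\<lambda>t. t\<^sup>2)"
    and "\<Omega> = scenarios rate batch p H p' H'"
    and "ergodic_chain \<Omega> N"
    and "stationary \<Omega> N \<pi>"
    and "\<And>i. i < N \<Longrightarrow> integrable (measure_pmf \<pi>) (\<lambda>(s, x). (real (x ! i))\<^sup>2)"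
    and "b = measure_pmf.expectation batch real"
    and "b2 = measure_pmf.expectation batch (\<lambda>n. (real n)\<^sup>2)"
    and "lam = rate * b"
    and "tau = interval_moment N p H 1" and "tau2 = interval_moment N p H 2"
    and "tau' = interval_moment N p' H' 1" and "tau2' = interval_moment N p' H' 2"
    and "mu = routing_eigenvalue N p" and "mu' = routing_eigenvalue N p'"
    and "\<And>k. 1 \<le> k \<Longrightarrow> k < N \<Longrightarrow> mu' k \<noteq> 1"
    and "(1\<^sub>m N - routing_mat N p) * (1\<^sub>m N - transpose_mat (routing_mat N p')) =
         (1\<^sub>m N - transpose_mat (routing_mat N p)) * (1\<^sub>m N - routing_mat N p')"
  shows "mean_waiting_time \<Omega> N \<pi> < \<infinity> \<and>
    complex_of_real (enn2real (mean_waiting_time \<Omega> N \<pi>)) =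
      of_real (tau' / (1 - real N * lam * tau)) * (\<Sum>l=1..<N. 1 / (1 - mu' l))
      + of_real (real N * lam * tau2 / (2 * (1 - real N * lam * tau)))
      + of_real (tau2' / (2 * tau'))
      + of_real ((b2 - b) / (2 * b)) *
          (of_real ((tau + (real N - 1) * tau') / (1 - real N * lam * tau))
           - of_real (tau' / (1 - real N * lam * tau))
             * (\<Sum>l=1..<N. (mu l - mu' l) / (1 - mu' l)))"
proof -
  have st: "stationary (scenarios rate batch p H p' H') N \<pi>"
    and irr: "irreducible_chain (scenarios rate batch p H p' H') N"
    using assms(16,17) unfolding assms(15) ergodic_chain_def by simp_all
  interpret stationary_polling rate batch N p p' H H' \<pi>
    by (intro stationary_polling.intro polling_model.intro compound_poisson.intro
        polling_model_axioms.intro stationary_polling_axioms.intro)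
      (rule assms(1-12) st irr | erule assms(13,14,18))+
  have moments: "moment True m = interval_moment N p H m" "moment False m = interval_moment N p' H' m" for m
    by (simp_all add: moment_def)
  have ne: "routing_eigenvalue N p' k \<noteq> 1" if "1 \<le> k" "k < N" for k
    using assms(28)[OF that] unfolding assms(27) .
  show ?thesis
    using mean_waiting_time_formula[OF ne assms(29)]
    unfolding assms(15,19-27) moments lam_def b_def b2_def .
qed

end
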